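(* Let $G$ be a finite group, let $p$ be a prime, and let $k\ge 2$ be an integer with $p^k$ dividing $|G|$. Assume that $G\in\mathcal{M}(p^k)$. Then $G/\mathbf{O}_{p'}(G)$ is a supersolvable group with a normal Sylow $p$-subgroup and a cyclic $p$-complement.
   Context: All groups are finite. $\mathbf{O}_{p'}(X)$ denotes the largest normal subgroup of $X$ of order prime to $p$. A $p$-complement of $X$ is a subgroup of order prime to $p$ whose index is a power of $p$. $A<B$ means that $A$ is a proper subgroup of $B$. A subgroup $H$ of $G$ is $\mathcal{M}$-supplemented in $G$ if there exists a subgroup $K$ of $G$ such that $G=HK$ and $H_iK<G$ (that is, $H_iK$ is a proper subgroup of $G$) for every maximal subgroup $H_i$ of $H$. For a prime power $p^k$ with $p\le p^k\le |G|_p$, where $|G|_p$ is the order of a Sylow $p$-subgroup of $G$, we write $G\in\mathcal{M}(p^k)$ if all subgroups of $G$ of order $p^k$ are $\mathcal{M}$-supplemented in $G$. *)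

theory Defs
  imports "HOL-Algebra.Elementary_Groups" "HOL-Algebra.Sylow" "HOL-Algebra.SndIsomorphismGrp"
begin

definition maximal_subgroup :: "'a set \<Rightarrow> ('a, 'b) monoid_scheme \<Rightarrow> bool" where
  "maximal_subgroup M G \<longleftrightarrow> subgroup M G \<and> M \<subset> carrier G \<and>
     (\<forall>L. subgroup L G \<longrightarrow> M \<subset> L \<longrightarrow> L = carrier G)"

text \<open>The product \<^term>\<open>M <#>\<^bsub>G\<^esub> K\<close> is required to be a subgroup, not merely a proper subset.\<close>

definition M_supplemented :: "'a set \<Rightarrow> ('a, 'b) monoid_scheme \<Rightarrow> bool" where
  "M_supplemented H G \<longleftrightarrow> (\<exists>K. subgroup K G \<and> carrier G = H <#>\<^bsub>G\<^esub> K \<and>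
     (\<forall>M. maximal_subgroup M (G\<lparr>carrier := H\<rparr>) \<longrightarrow>
        subgroup (M <#>\<^bsub>G\<^esub> K) G \<and> M <#>\<^bsub>G\<^esub> K \<subset> carrier G))"

text \<open>Intended for prime powers \<^term>\<open>q\<close> dividing the order of \<^term>\<open>G\<close>;
  if there is no subgroup of order \<^term>\<open>q\<close> the condition is vacuous.\<close>

definition M_class :: "nat \<Rightarrow> ('a, 'b) monoid_scheme \<Rightarrow> bool" where
  "M_class q G \<longleftrightarrow> (\<forall>H. subgroup H G \<longrightarrow> card H = q \<longrightarrow> M_supplemented H G)"

definition p_prime_core :: "nat \<Rightarrow> ('a, 'b) monoid_scheme \<Rightarrow> 'a set" where
  "p_prime_core p G = (GREATEST N. N \<lhd> G \<and> coprime (card N) p)"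

definition sylow_subgroup :: "nat \<Rightarrow> 'a set \<Rightarrow> ('a, 'b) monoid_scheme \<Rightarrow> bool" where
  "sylow_subgroup p P G \<longleftrightarrow> subgroup P G \<and> card P = p ^ multiplicity p (Coset.order G)"

definition p_complement :: "nat \<Rightarrow> 'a set \<Rightarrow> ('a, 'b) monoid_scheme \<Rightarrow> bool" where
  "p_complement p C G \<longleftrightarrow> subgroup C G \<and> coprime (card C) p \<and>
     (\<exists>m. card (rcosets\<^bsub>G\<^esub> C) = p ^ m)"

text \<open>In contrast to \<open>solvable_seq\<close>, every term of the series is normal in the whole group.\<close>

inductive supersolvable_seq :: "('a, 'b) monoid_scheme \<Rightarrow> 'a set \<Rightarrow> bool"
  for G where
    unity: "supersolvable_seq G {\<one>\<^bsub>G\<^esub>}"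
  | extension: "\<lbrakk>supersolvable_seq G K; K \<subseteq> H; H \<lhd> G;
      cyclic_group ((G\<lparr>carrier := H\<rparr>) Mod K)\<rbrakk> \<Longrightarrow> supersolvable_seq G H"

definition supersolvable :: "('a, 'b) monoid_scheme \<Rightarrow> bool" where
  "supersolvable G \<longleftrightarrow> supersolvable_seq G (carrier G)"

text \<open>In a finite group the greatest normal subgroup of order prime to \<^term>\<open>p\<close> exists.\<close>

lemma (in group) card_normal_mult_dvd:
  assumes "N \<lhd> G" "subgroup M G" "finite (carrier G)"
  shows "card (N <#> M) dvd card N * card M"
proof -
  interpret second_isomorphism_grp N G M
    using assms by (simp add: second_isomorphism_grp_def second_isomorphism_grp_axioms_def)
  have sub: "subgroup (N <#> M) G" by (rule normal_set_mult_subgroup)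
  interpret GM: group "G\<lparr>carrier := M\<rparr>" using assms(2) by (rule subgroup_imp_group)
  interpret GNM: group "G\<lparr>carrier := N <#> M\<rparr>" using sub by (rule subgroup_imp_group)
  have 1: "card (rcosets\<^bsub>G\<lparr>carrier := N <#> M\<rparr>\<^esub> N) * card N = card (N <#> M)"
    using GNM.lagrange[of N] H_contained_in_set_mult normal_imp_subgroup
      subgroup_incl[OF normal_imp_subgroup sub] assms(1)
    by (simp add: order_def)
  have 2: "card (rcosets\<^bsub>G\<lparr>carrier := M\<rparr>\<^esub> (N \<inter> M)) * card (N \<inter> M) = card M"
    using GM.lagrange[of "N \<inter> M"] normal_subgrp_intersection_normal
    by (simp add: order_def normal_def Int_commute)
  have "card (rcosets\<^bsub>G\<lparr>carrier := M\<rparr>\<^esub> (N \<inter> M)) = card (rcosets\<^bsub>G\<lparr>carrier := N <#> M\<rparr>\<^esub> N)"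
    using normal_intersection_quotient_isom
    by (auto simp: iso_def FactGroup_def dest!: bij_betw_same_card)
  with 1 2 show ?thesis
    by (metis dvd_triv_left mult.assoc mult.commute)
qed

lemma (in group) normal_set_mult_normal:
  assumes "N \<lhd> G" "M \<lhd> G"
  shows "N <#> M \<lhd> G"
proof -
  interpret second_isomorphism_grp N G M
    using assms by (simp add: second_isomorphism_grp_def second_isomorphism_grp_axioms_def normal_def)
  have "x \<otimes> h \<otimes> inv x \<in> N <#> M" if x: "x \<in> carrier G" and h: "h \<in> N <#> M" for x h
  proof -
    obtain n m where nm: "n \<in> N" "m \<in> M" "h = n \<otimes> m" using h by (auto simp: set_mult_def)
    have c: "n \<in> carrier G" "m \<in> carrier G"
      using nm assms by (auto simp: normal_def dest: subgroup.mem_carrier)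
    have "x \<otimes> h \<otimes> inv x = (x \<otimes> n \<otimes> inv x) \<otimes> (x \<otimes> m \<otimes> inv x)"
      using x c nm(3) by (simp add: m_assoc inv_solve_left)
    moreover have "x \<otimes> n \<otimes> inv x \<in> N" "x \<otimes> m \<otimes> inv x \<in> M"
      using assms nm x by (auto simp: normal_inv_iff)
    ultimately show ?thesis by (auto simp: set_mult_def)
  qed
  then show ?thesis using normal_set_mult_subgroup by (simp add: normal_inv_iff)
qed

lemma (in group) p_prime_core_greatest:
  assumes "finite (carrier G)"
  shows "p_prime_core p G \<lhd> G" "coprime (card (p_prime_core p G)) p"
    and "\<And>M. M \<lhd> G \<Longrightarrow> coprime (card M) p \<Longrightarrow> M \<subseteq> p_prime_core p G"
proof -
  let ?P = "\<lambda>N. N \<lhd> G \<and> coprime (card N) p"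
  have sub: "N \<subseteq> carrier G" if "N \<lhd> G" for N
    using that by (auto simp: normal_def dest: subgroup.subset)
  have fin: "finite {N. ?P N}"
    by (rule finite_subset[of _ "Pow (carrier G)"]) (use sub assms in auto)
  have ne: "{N. ?P N} \<noteq> {}" using one_is_normal by force
  obtain N where N: "?P N" and max: "\<And>M. ?P M \<Longrightarrow> N \<subseteq> M \<Longrightarrow> M = N"
    using finite_has_maximal[OF fin ne] by auto
  have le: "M \<subseteq> N" if M: "?P M" for M
  proof -
    have "coprime (card N * card M) p" using N M by simp
    moreover have "card (N <#> M) dvd card N * card M"
      using N M assms by (intro card_normal_mult_dvd) (auto simp: normal_def)
    ultimately have "coprime (card (N <#> M)) p" by (meson coprime_divisors dvd_refl)
    then have "?P (N <#> M)" using N M normal_set_mult_normal by blast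
    moreover have "N \<subseteq> N <#> M" "M \<subseteq> N <#> M"
    proof -
      have one: "\<one> \<in> N" "\<one> \<in> M" using N M by (auto simp: normal_def dest: subgroup.one_closed)
      show "N \<subseteq> N <#> M"
      proof
        fix n assume "n \<in> N"
        then have "n = n \<otimes> \<one>" using N sub[of N] by (metis r_one subsetD)
        with \<open>n \<in> N\<close> one show "n \<in> N <#> M" by (auto simp: set_mult_def)
      qed
      show "M \<subseteq> N <#> M"
      proof
        fix m assume "m \<in> M"
        then have "m = \<one> \<otimes> m" using M sub[of M] by (metis l_one subsetD)
        with \<open>m \<in> M\<close> one show "m \<in> N <#> M" by (auto simp: set_mult_def)
      qed
    qed
    ultimately show ?thesis using max by blast
  qed
  have eq: "p_prime_core p G = N"
    unfolding p_prime_core_def using N le by (rule Greatest_equality)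
  show "p_prime_core p G \<lhd> G" "coprime (card (p_prime_core p G)) p"
    and "\<And>M. M \<lhd> G \<Longrightarrow> coprime (card M) p \<Longrightarrow> M \<subseteq> p_prime_core p G"
    using N le by (auto simp: eq)
qed

end

theory Submission
  imports Defs "HOL-Algebra.Group_Action" "HOL-Algebra.Multiplicative_Group"
    "HOL-Number_Theory.Residue_Primitive_Roots"
begin

text \<open>
  If \<open>H\<close> of order \<open>p\<^sup>k\<close> is supplemented by \<open>K\<close>, every maximal subgroup \<open>M\<close> of \<open>H\<close> gives a subgroup \<open>MK\<close> of
  index \<open>p\<close>, hence an action of \<open>G\<close> on \<open>p\<close> points. If \<open>H\<close> is not cyclic, the actions for different \<open>M\<close> are
  the parallel classes of an affine plane on which \<open>G\<close> acts by dilatations, so each of them is affine: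
  \<open>g\<close> acts as \<open>z \<mapsto> \<theta>(g) z + \<delta>(g)\<close> on \<open>\<int>/p\<close>, with the same \<open>\<theta>\<close> for all \<open>M\<close>. If \<open>p\<close> is odd and some \<open>H\<close> is cyclic, a
  Sylow subgroup \<open>P\<close> is cyclic of order \<open>p\<^sup>k\<close>, and the action is affine by a transfer argument, which needs \<open>k \<ge> 2\<close>.
  Comparing the characters \<open>\<theta>\<close> for the various \<open>H \<le> P\<close>, one finds a single \<open>\<theta>\<close> such that the common zeros \<open>W\<close> of
  all \<open>\<theta>\<close>-cocycles in \<open>Y = ker \<theta>\<close> meet \<open>P\<close> in the Frattini subgroup of \<open>P\<close>. By Tate's theorem \<open>W\<close>, and
  so \<open>Y = PW\<close>, has a normal \<open>p\<close>-complement, while \<open>G/Y\<close> is cyclic of order dividing \<open>p - 1\<close>.\<close>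

section \<open>Fixed points and finite groups\<close>

text \<open>A supplement yields actions on p points, and such an action can be far from affine: A_5
  lies in M(5), since A_5 = C_5 A_4, so the claim fails for k = 1. A cyclic H, which has a single
  maximal subgroup, is therefore the real obstacle. A noncyclic H has two independent homomorphisms
  f, f' to Z/p, and the action through f + f' ties the other two together; for p = 2 every
  permutation of the points is a translation; for cyclic H the missing rigidity comes from x^p, a
  nontrivial element acting trivially. Maximal and Frattini subgroups are handled through
  homomorphisms to Z/p: an element of a p-group lies in the Frattini subgroup iff all of them vanish
  there. Each H detects only its own elements, and different H may have different characters, so a
  missed element v of P is tested on the H that contain, or lie in, a two-generator subgroup
  \<open><x, v>\<close>. On Y the cocycles are homomorphisms, so Tate's theorem is applied inside Y
  rather than in G. Supersolvability comes from p - 1: an automorphism of order dividing p - 1 is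
  diagonalizable over Z/p.\<close>

lemma card_fixed_points_cong:
  assumes S: "group S" "finite (carrier S)" and p: "Factorial_Ring.prime p" and cS: "card (carrier S) = p ^ n"
    and fin: "finite X"
    and cl: "\<And>s x. s \<in> carrier S \<Longrightarrow> x \<in> X \<Longrightarrow> a s x \<in> X"
    and one: "\<And>x. x \<in> X \<Longrightarrow> a \<one>\<^bsub>S\<^esub> x = x"
    and mult: "\<And>s t x. s \<in> carrier S \<Longrightarrow> t \<in> carrier S \<Longrightarrow> x \<in> X \<Longrightarrow> a (s \<otimes>\<^bsub>S\<^esub> t) x = a s (a t x)"
  shows "[card X = card {x \<in> X. \<forall>s \<in> carrier S. a s x = x}] (mod p)"
proof -
  interpret S: group S by fact
  \<comment> \<open>\<open>BijGroup X\<close> consists of extensional bijections, hence the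
    restriction; a plain function \<open>a\<close> lets cosets be moved by translation or by
    conjugation.\<close>
  define b where "b s = restrict (a s) X" for s
  have bij: "b s \<in> Bij X" if s: "s \<in> carrier S" for s
  proof -
    have "bij_betw (a s) X X"
    proof (rule bij_betw_byWitness[where f' = "a (inv\<^bsub>S\<^esub> s)"])
      show "\<forall>x\<in>X. a (inv\<^bsub>S\<^esub> s) (a s x) = x"
        using s one mult[of "inv\<^bsub>S\<^esub> s" s] by (auto simp: S.l_inv)
      show "\<forall>x\<in>X. a s (a (inv\<^bsub>S\<^esub> s) x) = x"
        using s one mult[of s "inv\<^bsub>S\<^esub> s"] by (auto simp: S.r_inv)
    qed (use cl s in auto)
    then show ?thesis by (auto simp: Bij_def b_def)
  qed
  interpret A: group_action S X b
  proof -
    have "b \<in> hom S (BijGroup X)"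
      using bij mult cl by (auto simp: hom_def BijGroup_def b_def compose_def fun_eq_iff restrict_def)
    then show "group_action S X b"
      by (simp add: group_action_def group_hom_def group_hom_axioms_def group_BijGroup S(1))
  qed
  define Fx where "Fx = {x \<in> X. \<forall>s \<in> carrier S. a s x = x}"
  define O1 where "O1 = (\<lambda>x. {x}) ` Fx"
  define O2 where "O2 = orbits S X b - O1"
  have part: "partition X (orbits S X b)" by (rule A.orbit_partition)
  have finO: "finite (orbits S X b)" using fin by (simp add: orbits_def)
  have sub: "O1 \<subseteq> orbits S X b"
  proof
    fix c assume "c \<in> O1"
    then obtain x where x: "x \<in> Fx" "c = {x}" by (auto simp: O1_def)
    then have "orbit S b x = {x}"
      using S.one_closed by (auto simp: orbit_def b_def Fx_def intro: exI[of _ "\<one>\<^bsub>S\<^esub>"])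
    then show "c \<in> orbits S X b" using x by (auto simp: orbits_def Fx_def)
  qed
  have un: "\<Union> (orbits S X b) = X" by (rule A.orbits_coverture)
  have disj: "c \<inter> d = {}" if "c \<in> orbits S X b" "d \<in> orbits S X b" "c \<noteq> d" for c d
    using A.disjoint_union that by blast
  have subX: "c \<subseteq> X" if "c \<in> orbits S X b" for c using un that by auto
  have "card X = card (\<Union> (orbits S X b))" by (simp add: un)
  also have "\<dots> = (\<Sum>c\<in>orbits S X b. card c)"
    by (rule card_Union_disjoint) (use disj finite_subset[OF subX fin] in \<open>auto simp: pairwise_def disjnt_def\<close>)
  also have "\<dots> = (\<Sum>c\<in>O1. card c) + (\<Sum>c\<in>O2. card c)"
    unfolding O2_def using sum.subset_diff[OF sub finO] by (simp add: add.commute)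
  also have "(\<Sum>c\<in>O1. card c) = card Fx"
    unfolding O1_def by (subst sum.reindex) (auto simp: inj_on_def)
  finally have e: "card X = card Fx + (\<Sum>c\<in>O2. card c)" .
  have "p dvd (\<Sum>c\<in>O2. card c)"
  proof (rule dvd_sum)
    fix c assume c: "c \<in> O2"
    then obtain x where x: "x \<in> X" "c = orbit S b x" by (auto simp: O2_def orbits_def)
    have "card c dvd p ^ n"
      using A.orbit_stabilizer_theorem[OF x(1)] x(2) cS by (metis Coset.order_def dvd_triv_left)
    then obtain i where i: "card c = p ^ i" using p divides_primepow_nat by blast
    have xc: "x \<in> c" using x A.orbit_refl by simp
    have "i \<noteq> 0"
    proof
      assume "i = 0"
      then have "c = {x}" using i xc by (auto simp: card_1_singleton_iff)
      then have "x \<in> Fx" using x by (auto simp: Fx_def orbit_def b_def)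
      then have "c \<in> O1" using \<open>c = {x}\<close> by (auto simp: O1_def)
      then show False using c by (simp add: O2_def)
    qed
    then show "p dvd card c" using i by (simp add: dvd_power)
  qed
  then show ?thesis using e by (simp add: Fx_def[symmetric] cong_def mod_add_right_eq[symmetric] del: mod_add_right_eq) 
qed

context group
begin

lemma inv_mult_cancel_left:
  assumes "x \<in> carrier G" "y \<in> carrier G"
  shows "inv x \<otimes> (x \<otimes> y) = y" and "x \<otimes> (inv x \<otimes> y) = y"
  using assms by (simp_all flip: m_assoc)

lemmas group_word_simps = m_assoc inv_mult_group inv_mult_cancel_left

lemma subgroup_finiteI:
  assumes "finite (carrier G)" "H \<subseteq> carrier G" "H \<noteq> {}"
    and cl: "\<And>x y. x \<in> H \<Longrightarrow> y \<in> H \<Longrightarrow> x \<otimes> y \<in> H"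
  shows "subgroup H G"
proof (rule subgroupI)
  fix x assume x: "x \<in> H"
  then have xc: "x \<in> carrier G" using assms by auto
  have pw: "x [^] Suc n \<in> H" for n :: nat
    by (induction n) (use x xc cl in auto)
  have "order G \<ge> 1" using assms(1) xc by (auto simp: order_def Suc_le_eq card_gt_0_iff)
  show "inv x \<in> H"
  \<comment> \<open>The inverse of x is the power with exponent |G| - 1. Closure gives positive
    powers only, so the exponent 0 is split off.\<close>
  proof (cases "order G = 1")
    case True
    then have "x = \<one>" using pow_order_eq_1[OF xc] xc by simp
    then show ?thesis using x by simp
  next
    case False
    then obtain n where n: "order G = Suc (Suc n)" using \<open>order G \<ge> 1\<close>
      by (metis One_nat_def Suc_le_D le_SucE le_zero_eq not0_implies_Suc)
    have "x [^] Suc n \<otimes> x = \<one>" using pow_order_eq_1[OF xc] n by simp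
    then have "inv x = x [^] Suc n" using xc by (metis inv_equality nat_pow_closed)
    then show ?thesis using pw by metis
  qed
qed (use assms in auto)

lemma l_coset_eq_iff:
  assumes D: "subgroup D G" and "x \<in> carrier G" "y \<in> carrier G"
  shows "x <# D = y <# D \<longleftrightarrow> inv x \<otimes> y \<in> D"
proof
  assume "x <# D = y <# D"
  moreover have "y \<in> y <# D"
    using assms subgroup.one_closed[OF D] by (force simp: l_coset_def)
  ultimately obtain d where d: "d \<in> D" "y = x \<otimes> d" by (auto simp: l_coset_def)
  then show "inv x \<otimes> y \<in> D"
    using assms subgroup.mem_carrier[OF D] by (simp add: inv_mult_cancel_left)
next
  assume h: "inv x \<otimes> y \<in> D"
  have dc: "d \<in> carrier G" if "d \<in> D" for d using that subgroup.mem_carrier[OF D] by blast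
  have "x \<otimes> d \<in> y <# D" if d: "d \<in> D" for d
  proof -
    have "x \<otimes> d = y \<otimes> (inv (inv x \<otimes> y) \<otimes> d)"
      using assms dc[OF d] by (simp add: group_word_simps)
    then show ?thesis
      using h d subgroup.m_closed[OF D] subgroup.m_inv_closed[OF D] by (auto simp: l_coset_def)
  qed
  moreover have "y \<otimes> d \<in> x <# D" if d: "d \<in> D" for d
  proof -
    have "y \<otimes> d = x \<otimes> ((inv x \<otimes> y) \<otimes> d)"
      using assms dc[OF d] by (simp add: group_word_simps)
    then show ?thesis
      using h d subgroup.m_closed[OF D] by (auto simp: l_coset_def)
  qed
  ultimately show "x <# D = y <# D" by (auto simp: l_coset_def)
qed

text \<open>Lagrange's theorem for a pair of subgroups, in left cosets because all actions below are
  by left multiplication.\<close>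

lemma card_l_cosets:
  assumes fin: "finite (carrier G)" and D: "subgroup D G" and K: "subgroup K G" and DK: "D \<subseteq> K"
  shows "card K = card ((\<lambda>x. x <# D) ` K) * card D"
proof -
  let ?C = "(\<lambda>x. x <# D) ` K"
  have Kc: "K \<subseteq> carrier G" using subgroup.subset[OF K] .
  have Dc: "D \<subseteq> carrier G" using subgroup.subset[OF D] .
  have finK: "finite K" using Kc fin by (rule finite_subset)
  have un: "\<Union> ?C = K"
  proof
    show "\<Union> ?C \<subseteq> K" using subgroup.m_closed[OF K] DK by (auto simp: l_coset_def)
    show "K \<subseteq> \<Union> ?C"
    proof
      fix x assume x: "x \<in> K"
      then have "x \<in> x <# D" using subgroup.one_closed[OF D] Kc by (force simp: l_coset_def)
      then show "x \<in> \<Union> ?C" using x by blast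
    qed
  qed
  have cardc: "card c = card D" if c: "c \<in> ?C" for c
  proof -
    obtain x where x: "x \<in> K" "c = x <# D" using c by blast
    have "c = (\<lambda>d. x \<otimes> d) ` D" using x by (auto simp: l_coset_def)
    moreover have "inj_on (\<lambda>d. x \<otimes> d) D" using x Kc Dc by (auto simp: inj_on_def subset_iff)
    ultimately show ?thesis by (simp add: card_image)
  qed
  have disj: "c \<inter> d = {}" if c: "c \<in> ?C" and d: "d \<in> ?C" and ne: "c \<noteq> d" for c d
  proof (rule ccontr)
    assume "c \<inter> d \<noteq> {}"
    then obtain w where w: "w \<in> c" "w \<in> d" by auto
    obtain x y where xy: "x \<in> K" "c = x <# D" "y \<in> K" "d = y <# D" using c d by blast
    obtain a b where ab: "a \<in> D" "b \<in> D" "w = x \<otimes> a" "w = y \<otimes> b"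
      using w xy by (auto simp: l_coset_def)
    have cc: "x \<in> carrier G" "y \<in> carrier G" "a \<in> carrier G" "b \<in> carrier G" using xy ab Kc Dc by auto
    have "x <# D = w <# D"
      using l_coset_eq_iff[OF D cc(1), of w] ab cc by (simp add: inv_mult_cancel_left)
    moreover have "y <# D = w <# D"
      using l_coset_eq_iff[OF D cc(2), of w] ab cc by (metis inv_mult_cancel_left(1) m_closed)
    ultimately show False using ne xy by simp
  qed
  have "card D * card ?C = card (\<Union> ?C)"
    by (rule card_partition) (use finK un cardc disj in auto)
  then show ?thesis using un by (simp add: mult.commute)
qed

lemma card_subgroup_dvd:
  assumes "finite (carrier G)" "subgroup D G" "subgroup K G" "D \<subseteq> K"
  shows "card D dvd card K"
  using card_l_cosets[OF assms] by simp

text \<open>The p-group S acts on the cosets of Q, whose number is prime to p, so it fixes some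
  coset gQ.\<close>

lemma sylow_conjugate:
  assumes fin: "finite (carrier G)" and p: "Factorial_Ring.prime p"
    and S: "subgroup S G" "card S = p ^ n" and Q: "subgroup Q G" "\<not> p dvd order G div card Q"
  obtains g where "g \<in> carrier G" "\<And>s. s \<in> S \<Longrightarrow> inv g \<otimes> s \<otimes> g \<in> Q"
proof -
  let ?X = "(\<lambda>x. x <# Q) ` carrier G"
  let ?F = "{c \<in> ?X. \<forall>s \<in> carrier (G\<lparr>carrier := S\<rparr>). s <# c = c}"
  have Sc: "S \<subseteq> carrier G" and Qc: "Q \<subseteq> carrier G" using S Q subgroup.subset by auto
  have sub: "x <# Q \<subseteq> carrier G" if "x \<in> carrier G" for x
    using that Qc by (rule l_coset_subset_G[rotated])
  have "[card ?X = card ?F] (mod p)"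
  proof (rule card_fixed_points_cong)
    show "group (G\<lparr>carrier := S\<rparr>)" by (rule subgroup_imp_group[OF S(1)])
    show "finite (carrier (G\<lparr>carrier := S\<rparr>))" using Sc fin by (auto intro: finite_subset)
    show "card (carrier (G\<lparr>carrier := S\<rparr>)) = p ^ n" using S by simp
    show "finite ?X" using fin by simp
    fix s c assume s: "s \<in> carrier (G\<lparr>carrier := S\<rparr>)" and c: "c \<in> ?X"
    obtain x where x: "x \<in> carrier G" "c = x <# Q" using c by auto
    have "s <# c = (s \<otimes> x) <# Q" using x s Sc Qc by (auto simp: lcos_m_assoc)
    then show "s <# c \<in> ?X" using x s Sc by auto
  next
    fix c assume "c \<in> ?X"
    then show "\<one>\<^bsub>G\<lparr>carrier := S\<rparr>\<^esub> <# c = c" using lcos_mult_one sub by auto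
  next
    fix s t c assume "s \<in> carrier (G\<lparr>carrier := S\<rparr>)" "t \<in> carrier (G\<lparr>carrier := S\<rparr>)" "c \<in> ?X"
    then show "s \<otimes>\<^bsub>G\<lparr>carrier := S\<rparr>\<^esub> t <# c = s <# (t <# c)"
      using lcos_m_assoc sub Sc by (auto simp: subset_iff)
  qed (use p in auto)
  moreover have "card ?X = order G div card Q"
    using card_l_cosets[OF fin Q(1) subgroup_self Qc] finite_subset[OF Qc fin] subgroup.one_closed[OF Q(1)]
    by (auto simp: order_def card_gt_0_iff)
  ultimately have "\<not> p dvd card ?F" using Q(2) by (simp add: cong_dvd_iff)
  then have "?F \<noteq> {}" by (metis card.empty dvd_0_right)
  then obtain g where g: "g \<in> carrier G" "\<And>s. s \<in> S \<Longrightarrow> s <# (g <# Q) = g <# Q" by auto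
  have "inv g \<otimes> s \<otimes> g \<in> Q" if s: "s \<in> S" for s
  proof -
    have sc: "s \<in> carrier G" using s Sc by auto
    have "(s \<otimes> g) <# Q = g <# Q" using g s sc Qc by (simp add: lcos_m_assoc[symmetric])
    then show ?thesis using l_coset_eq_iff[OF Q(1) g(1), of "s \<otimes> g"] g sc by (simp add: m_assoc)
  qed
  then show ?thesis using that g(1) by blast
qed

text \<open>The last member of x, x^p, x^(p^2), ... outside M is the desired power.\<close>

lemma exists_power_step:
  assumes "x \<in> carrier G" "x \<notin> M" "x [^] (p ^ n) \<in> M"
  shows "\<exists>j. x [^] (p ^ j) \<notin> M \<and> (x [^] (p ^ j)) [^] (p::nat) \<in> M"
proof -
  define j where "j = (LEAST i. x [^] (p ^ i) \<in> M)"
  have j: "x [^] (p ^ j) \<in> M" unfolding j_def using assms(3) by (rule LeastI)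
  have "j \<noteq> 0" using j assms by (metis nat_pow_eone power_0)
  then obtain i where i: "j = Suc i" using not0_implies_Suc by blast
  have "x [^] (p ^ i) \<notin> M" using not_less_Least[of i "\<lambda>i. x [^] (p ^ i) \<in> M"] i j_def by auto
  moreover have "(x [^] (p ^ i)) [^] p \<in> M" using j i assms(1) by (simp add: nat_pow_pow mult.commute)
  ultimately show ?thesis by blast
qed

text \<open>An injection of a finite set into itself is onto, so the inverse conjugation preserves M
  too.\<close>

lemma conj_stable_finite:
  assumes "finite M" "M \<subseteq> carrier G" "z \<in> carrier G" "\<And>m. m \<in> M \<Longrightarrow> inv z \<otimes> m \<otimes> z \<in> M" "m \<in> M"
  shows "z \<otimes> m \<otimes> inv z \<in> M"
proof -
  have "inj_on (\<lambda>m. inv z \<otimes> m \<otimes> z) M"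
    using assms(2,3) by (auto simp: inj_on_def subset_iff)
  then have "(\<lambda>m. inv z \<otimes> m \<otimes> z) ` M = M"
    using assms by (intro card_subset_eq) (auto simp: card_image)
  then obtain m' where "m' \<in> M" "m = inv z \<otimes> m' \<otimes> z" using assms(5) by blast
  moreover from this have "z \<otimes> m \<otimes> inv z = m'" using assms(2,3) by (simp add: group_word_simps subset_iff)
  ultimately show ?thesis by simp
qed

lemma conj_nat_pow:
  assumes "g \<in> carrier G" "a \<in> carrier G"
  shows "(g \<otimes> a \<otimes> inv g) [^] (i::nat) = g \<otimes> a [^] i \<otimes> inv g"
proof (induction i)
  case (Suc i)
  then show ?case using assms by (simp add: group_word_simps)
qed (use assms in simp)

lemma subgroup_nat_pow_closed:
  "subgroup H G \<Longrightarrow> x \<in> H \<Longrightarrow> x [^] (n::nat) \<in> H"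
  by (metis int_pow_int subgroup_int_pow_closed)

lemma pow_card_subgroup:
  assumes "subgroup J G" "x \<in> J" shows "x [^] card J = \<one>"
proof -
  interpret J: group "G\<lparr>carrier := J\<rparr>" by (rule subgroup_imp_group[OF assms(1)])
  have "x [^]\<^bsub>G\<lparr>carrier := J\<rparr>\<^esub> Coset.order (G\<lparr>carrier := J\<rparr>) = \<one>" using J.pow_order_eq_1[of x] assms by simp
  then show ?thesis by (simp add: order_def nat_pow_def)
qed

end

section \<open>Homomorphisms to the integers mod p\<close>

text \<open>A homomorphism S -> Z/q with integers as representatives; values outside S do not
  matter, and linear combinations are formed pointwise. The modulus is p except for transfer in a
  cyclic Sylow subgroup, where it is \<open>p^k\<close>.\<close>

definition (in group) phom :: "nat \<Rightarrow> 'a set \<Rightarrow> ('a \<Rightarrow> int) \<Rightarrow> bool" where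
  "phom q S f \<longleftrightarrow> (\<forall>x\<in>S. \<forall>y\<in>S. [f (x \<otimes> y) = f x + f y] (mod int q))"

context group
begin

lemma phom_mult: "phom q S f \<Longrightarrow> x \<in> S \<Longrightarrow> y \<in> S \<Longrightarrow> [f (x \<otimes> y) = f x + f y] (mod int q)"
  by (simp add: phom_def)

lemma phom_subset: "phom q S f \<Longrightarrow> T \<subseteq> S \<Longrightarrow> phom q T f"
  by (auto simp: phom_def)

lemma phom_one:
  assumes "subgroup S G" "phom q S f"
  shows "[f \<one> = 0] (mod int q)"
proof -
  have "\<one> \<in> S" using assms(1) by (rule subgroup.one_closed)
  then have "[f \<one> = f \<one> + f \<one>] (mod int q)" using phom_mult[OF assms(2), of \<one> \<one>] by (metis l_one one_closed)
  then have "int q dvd f \<one> - (f \<one> + f \<one>)" unfolding cong_iff_dvd_diff .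
  then show ?thesis by (simp add: cong_0_iff)
qed

lemma phom_inv:
  assumes "subgroup S G" "phom q S f" "x \<in> S"
  shows "[f (inv x) = - f x] (mod int q)"
proof -
  have x: "x \<in> carrier G" "inv x \<in> S"
    using subgroup.mem_carrier[OF assms(1,3)] subgroup.m_inv_closed[OF assms(1,3)] by auto
  have "[f x + f (inv x) = f \<one>] (mod int q)"
    using phom_mult[OF assms(2,3) x(2)] x by (simp add: cong_sym)
  then have "[f x + f (inv x) = 0] (mod int q)"
    using phom_one[OF assms(1,2)] cong_trans by blast
  then show ?thesis by (simp add: cong_iff_dvd_diff add.commute)
qed

lemma phom_pow:
  assumes "subgroup S G" "phom q S f" "x \<in> S"
  shows "[f (x [^] (n::nat)) = int n * f x] (mod int q)"
proof (induction n)
  case 0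
  then show ?case using phom_one[OF assms(1,2)] by simp
next
  case (Suc n)
  have "[f (x [^] n \<otimes> x) = f (x [^] n) + f x] (mod int q)"
    using phom_mult[OF assms(2)] subgroup_nat_pow_closed[OF assms(1,3)] assms(3) by blast
  also have "[f (x [^] n) + f x = int n * f x + f x] (mod int q)" using Suc by (simp add: cong_add)
  finally show ?case by (simp add: algebra_simps)
qed

lemma phom_conj:
  assumes "subgroup S G" "phom q S f" "x \<in> S" "y \<in> S"
  shows "[f (x \<otimes> y \<otimes> inv x) = f y] (mod int q)"
proof -
  have c: "inv x \<in> S" "x \<otimes> y \<in> S" using assms subgroup.m_inv_closed subgroup.m_closed by metis+
  have "[f (x \<otimes> y \<otimes> inv x) = f (x \<otimes> y) + f (inv x)] (mod int q)" using phom_mult[OF assms(2) c(2,1)] .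
  also have "[f (x \<otimes> y) + f (inv x) = f x + f y + - f x] (mod int q)"
    using phom_mult[OF assms(2-4)] phom_inv[OF assms(1-3)] by (rule cong_add)
  finally show ?thesis by simp
qed

lemma phom_kernel_subgroup:
  assumes "finite (carrier G)" "subgroup S G" "phom q S f"
  shows "subgroup {x \<in> S. int q dvd f x} G"
proof (rule subgroup_finiteI)
  show "{x \<in> S. int q dvd f x} \<noteq> {}"
    using phom_one[OF assms(2,3)] subgroup.one_closed[OF assms(2)] by (auto simp: cong_0_iff)
  fix x y assume "x \<in> {x \<in> S. int q dvd f x}" "y \<in> {x \<in> S. int q dvd f x}"
  then show "x \<otimes> y \<in> {x \<in> S. int q dvd f x}"
    using cong_dvd_iff[OF phom_mult[OF assms(3), of x y]] subgroup.m_closed[OF assms(2)] by simp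
qed (use assms subgroup.subset in auto)

lemma phom_lincomb:
  "phom q S f \<Longrightarrow> phom q S g \<Longrightarrow> phom q S (\<lambda>x. a * f x + b * g x)"
  unfolding phom_def
proof (intro ballI)
  fix x y assume *: "\<forall>x\<in>S. \<forall>y\<in>S. [f (x \<otimes> y) = f x + f y] (mod int q)"
    "\<forall>x\<in>S. \<forall>y\<in>S. [g (x \<otimes> y) = g x + g y] (mod int q)" "x \<in> S" "y \<in> S"
  have "[a * f (x \<otimes> y) + b * g (x \<otimes> y) = a * (f x + f y) + b * (g x + g y)] (mod int q)"
    using * by (intro cong_add cong_mult) auto
  then show "[a * f (x \<otimes> y) + b * g (x \<otimes> y) = (a * f x + b * g x) + (a * f y + b * g y)] (mod int q)"
    by (simp add: algebra_simps)
qed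

end

section \<open>Subgroup growth in p-groups\<close>

locale prime_group = group G for G (structure) +
  fixes p :: nat
  assumes fin: "finite (carrier G)" and prime_p: "Factorial_Ring.prime p"
begin

lemma p_pos: "p > 0" "p > 1" "p \<noteq> 0"
  using prime_p prime_gt_0_nat prime_gt_1_nat by auto

lemma prime_int_p: "Factorial_Ring.prime (int p)"
  using prime_p by simp

text \<open>Normalizers grow: M acts on the cosets of M in J, the number of fixed ones is divisible
  by p, and a fixed coset other than M consists of elements normalizing M. A suitable power then has
  its p-th power in M.\<close>

lemma p_group_growth:
  assumes J: "subgroup J G" "card J = p ^ n" and M: "subgroup M G" "M \<subset> J"
  obtains z where "z \<in> J" "z \<notin> M" "z [^] p \<in> M" "\<And>m. m \<in> M \<Longrightarrow> z \<otimes> m \<otimes> inv z \<in> M"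
proof -
  let ?X = "(\<lambda>x. x <# M) ` J"
  let ?F = "{c \<in> ?X. \<forall>s \<in> carrier (G\<lparr>carrier := M\<rparr>). s <# c = c}"
  have Jc: "J \<subseteq> carrier G" and Mc: "M \<subseteq> carrier G" using J M subgroup.subset by auto
  have finJ: "finite J" "finite M" using Jc Mc fin finite_subset by auto
  have sub: "x <# M \<subseteq> carrier G" if "x \<in> J" for x
    using that Mc Jc by (intro l_coset_subset_G) auto
  have cM: "card M dvd p ^ n" using card_subgroup_dvd[OF fin M(1) J(1)] M(2) J(2) by auto
  then obtain i where i: "card M = p ^ i" using prime_p divides_primepow_nat by blast
  have cX: "p ^ n = card ?X * card M" using card_l_cosets[OF fin M(1) J(1)] M(2) J(2) by auto
  have "[card ?X = card ?F] (mod p)"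
  proof (rule card_fixed_points_cong)
    show "group (G\<lparr>carrier := M\<rparr>)" by (rule subgroup_imp_group[OF M(1)])
    show "card (carrier (G\<lparr>carrier := M\<rparr>)) = p ^ i" using i by simp
    fix s c assume s: "s \<in> carrier (G\<lparr>carrier := M\<rparr>)" and c: "c \<in> ?X"
    obtain x where x: "x \<in> J" "c = x <# M" using c by auto
    have "s <# c = (s \<otimes> x) <# M" using x s Mc Jc lcos_m_assoc[OF Mc, of s x] by auto
    moreover have "s \<otimes> x \<in> J" using s x M(2) subgroup.m_closed[OF J(1)] by auto
    ultimately show "s <# c \<in> ?X" by auto
  next
    fix c assume "c \<in> ?X"
    then show "\<one>\<^bsub>G\<lparr>carrier := M\<rparr>\<^esub> <# c = c" using lcos_mult_one sub by auto
  next
    fix s t c assume "s \<in> carrier (G\<lparr>carrier := M\<rparr>)" "t \<in> carrier (G\<lparr>carrier := M\<rparr>)" "c \<in> ?X"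
    then show "s \<otimes>\<^bsub>G\<lparr>carrier := M\<rparr>\<^esub> t <# c = s <# (t <# c)"
      using lcos_m_assoc sub Mc by (auto simp: subset_iff)
  qed (use prime_p finJ in auto)
  moreover have "p dvd card ?X"
  proof -
    have "card M < card J" using M(2) finJ by (simp add: psubset_card_mono)
    then have "card ?X \<noteq> 1" using cX J(2) by auto
    moreover have "card ?X dvd p ^ n" using cX by simp
    ultimately show ?thesis using prime_p divides_primepow_nat
      by (metis dvd_power neq0_conv power_0)
  qed
  ultimately have pF: "p dvd card ?F" by (simp add: cong_dvd_iff)
  have MF: "M \<in> ?F"
    using subgroup.one_closed[OF J(1)] lcos_mult_one[OF Mc] coset_join3[OF _ M(1)] Mc
    by (auto simp: image_iff intro!: bexI[of _ \<one>])
  have "\<exists>c \<in> ?F. c \<noteq> M"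
  proof (rule ccontr)
    assume "\<not> ?thesis"
    then have "?F = {M}" using MF by blast
    then show False using pF p_pos by simp
  qed
  then obtain x where x: "x \<in> J" "x <# M \<noteq> M" "\<And>s. s \<in> M \<Longrightarrow> s <# (x <# M) = x <# M" by auto
  have xc: "x \<in> carrier G" using x Jc by auto
  have xM: "x \<notin> M" using x(2) coset_join3[OF xc M(1)] by blast
  have inv: "inv x \<otimes> s \<otimes> x \<in> M" if s: "s \<in> M" for s
  proof -
    have sc: "s \<in> carrier G" using s Mc by auto
    have "(s \<otimes> x) <# M = x <# M" using x s sc xc Mc by (simp add: lcos_m_assoc[symmetric])
    then show ?thesis using l_coset_eq_iff[OF M(1) xc, of "s \<otimes> x"] xc sc by (simp add: m_assoc)
  qed
  have cnj: "x \<otimes> s \<otimes> inv x \<in> M" if "s \<in> M" for s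
    using conj_stable_finite[OF finJ(2) Mc xc inv that] .
  have cnjp: "x [^] k \<otimes> s \<otimes> inv (x [^] k) \<in> M" if "s \<in> M" for s and k :: nat
    using that
  proof (induction k arbitrary: s)
    case 0
    then show ?case using Mc by auto
  next
    case (Suc k)
    have "x [^] k \<otimes> (x \<otimes> s \<otimes> inv x) \<otimes> inv (x [^] k) \<in> M" by (rule Suc.IH[OF cnj[OF Suc.prems]])
    moreover have "s \<in> carrier G" using Suc.prems Mc by auto
    ultimately show ?case using xc by (simp add: group_word_simps)
  qed
  have "x [^] (p ^ n) \<in> M" using pow_card_subgroup[OF J(1) x(1)] J(2) subgroup.one_closed[OF M(1)] by simp
  then obtain j where j: "x [^] (p ^ j) \<notin> M" "(x [^] (p ^ j)) [^] p \<in> M"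
    using exists_power_step[OF xc xM] by blast
  show ?thesis
    by (rule that[of "x [^] (p ^ j)"]) (use j cnjp subgroup_nat_pow_closed[OF J(1) x(1)] in auto)
qed

text \<open>M is normal of index p in \<open>M<z>\<close>, and f reads off the exponent of z, which
  is determined mod p.\<close>

lemma cyclic_extension:
  assumes M: "subgroup M G" and z: "z \<in> carrier G" "z \<notin> M" "z [^] p \<in> M"
    and cnj: "\<And>m. m \<in> M \<Longrightarrow> z \<otimes> m \<otimes> inv z \<in> M"
  obtains f where "subgroup {m \<otimes> z [^] (i::nat) | m i. m \<in> M} G" "M \<subseteq> {m \<otimes> z [^] (i::nat) | m i. m \<in> M}" "z \<in> {m \<otimes> z [^] (i::nat) | m i. m \<in> M}" "card {m \<otimes> z [^] (i::nat) | m i. m \<in> M} = p * card M" "phom p {m \<otimes> z [^] (i::nat) | m i. m \<in> M} f"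
    "\<And>m i. m \<in> M \<Longrightarrow> [f (m \<otimes> z [^] i) = int i] (mod int p)"
    "\<And>b. b \<in> {m \<otimes> z [^] (i::nat) | m i. m \<in> M} \<Longrightarrow> int p dvd f b \<longleftrightarrow> b \<in> M"
proof -
  define B where "B = {m \<otimes> z [^] (i::nat) | m i. m \<in> M}"
  have Mc: "M \<subseteq> carrier G" using subgroup.subset[OF M] .
  have mc: "\<And>m. m \<in> M \<Longrightarrow> m \<in> carrier G" using Mc by auto
  have finM: "finite M" using Mc fin finite_subset by auto
  have M1: "\<one> \<in> M" using subgroup.one_closed[OF M] .
  have cnjp: "z [^] k \<otimes> s \<otimes> inv (z [^] k) \<in> M" if "s \<in> M" for s and k :: nat
    using that
  proof (induction k arbitrary: s)
    case 0
    then show ?case using Mc by auto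
  next
    case (Suc k)
    have "z [^] k \<otimes> (z \<otimes> s \<otimes> inv z) \<otimes> inv (z [^] k) \<in> M" by (rule Suc.IH[OF cnj[OF Suc.prems]])
    then show ?case using mc[OF Suc.prems] z by (simp add: group_word_simps)
  qed
  have pm: "z [^] i \<in> M \<longleftrightarrow> p dvd i" for i :: nat
  proof
    assume "p dvd i"
    then obtain j where "i = p * j" by auto
    then have "z [^] i = (z [^] p) [^] j" using z by (simp add: nat_pow_pow)
    then show "z [^] i \<in> M" using subgroup_nat_pow_closed[OF M z(3)] by simp
  next
    assume i: "z [^] i \<in> M"
    show "p dvd i"
    proof (rule ccontr)
      assume "\<not> p dvd i"
      then have "coprime i p" using prime_p by (metis coprime_commute prime_imp_coprime)
      then obtain a where a: "[i * a = Suc 0] (mod p)" using cong_solve_coprime_nat by blast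
      then have "i * a mod p = 1" using p_pos by (simp add: cong_def)
      then obtain b where b: "i * a = p * b + 1" by (metis div_mod_decomp mult.commute)
      have "z [^] (i * a) = z [^] (p * b) \<otimes> z" using b z by (simp flip: nat_pow_mult)
      then have "z = inv (z [^] (p * b)) \<otimes> z [^] (i * a)" using z by (simp add: inv_mult_cancel_left)
      also have "\<dots> = inv ((z [^] p) [^] b) \<otimes> (z [^] i) [^] a" using z by (simp add: nat_pow_pow)
      also have "\<dots> \<in> M"
        using subgroup_nat_pow_closed[OF M] z(3) i subgroup.m_inv_closed[OF M] subgroup.m_closed[OF M] by blast
      finally show False using z by simp
    qed
  qed
  have uniq: "[i = j] (mod p)"
    if "m \<in> M" "m' \<in> M" "m \<otimes> z [^] i = m' \<otimes> z [^] j" for m m' and i j :: nat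
  proof -
    have *: "[i = j] (mod p)"
      if "m \<in> M" "m' \<in> M" "m \<otimes> z [^] i = m' \<otimes> z [^] j" and le: "i \<le> j" for m m' and i j :: nat
    proof -
      obtain d where d: "j = d + i" using le by (metis add.commute le_Suc_ex)
      have "m \<otimes> z [^] i = (m' \<otimes> z [^] d) \<otimes> z [^] i"
        using that d z mc by (simp add: m_assoc nat_pow_mult)
      then have "m = m' \<otimes> z [^] d" using that z mc by simp
      then have "inv m' \<otimes> m = z [^] d" using that z mc by (simp add: inv_mult_cancel_left)
      moreover have "inv m' \<otimes> m \<in> M" using that subgroup.m_inv_closed[OF M] subgroup.m_closed[OF M] by blast
      ultimately have "p dvd d" using pm by metis
      then show ?thesis using d by (simp add: cong_def mod_add_left_eq[symmetric] del: mod_add_left_eq) 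
    qed
    show ?thesis
    proof (cases "i \<le> j")
      case True
      then show ?thesis using * that by blast
    next
      case False
      then show ?thesis using *[of m' m j i] that by (auto intro: cong_sym)
    qed
  qed
  have prod: "(m \<otimes> z [^] i) \<otimes> (m' \<otimes> z [^] j) = (m \<otimes> (z [^] i \<otimes> m' \<otimes> inv (z [^] i))) \<otimes> z [^] (i + j)"
    if "m \<in> M" "m' \<in> M" for m m' and i j :: nat
    using that mc z by (simp add: group_word_simps flip: nat_pow_mult)
  have prodM: "m \<otimes> (z [^] i \<otimes> m' \<otimes> inv (z [^] i)) \<in> M" if "m \<in> M" "m' \<in> M" for m m' and i :: nat
    using that cnjp subgroup.m_closed[OF M] by blast
  have B: "subgroup B G"
  proof (rule subgroup_finiteI[OF fin])
    show "B \<subseteq> carrier G" using mc z by (auto simp: B_def)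
    show "B \<noteq> {}" using M1 by (auto simp: B_def)
    fix x y assume "x \<in> B" "y \<in> B"
    then obtain m i m' j where "m \<in> M" "m' \<in> M" "x = m \<otimes> z [^] (i::nat)" "y = m' \<otimes> z [^] (j::nat)"
      by (auto simp: B_def)
    then show "x \<otimes> y \<in> B" unfolding B_def using prod prodM by blast
  qed
  have MB: "M \<subseteq> B"
  proof
    fix m assume "m \<in> M"
    then have "m = m \<otimes> z [^] (0::nat)" using mc by simp
    then show "m \<in> B" using \<open>m \<in> M\<close> unfolding B_def by blast
  qed
  have zB: "z \<in> B"
  proof -
    have "z = \<one> \<otimes> z [^] (1::nat)" using z by simp
    then show ?thesis using M1 unfolding B_def by blast
  qed
  have "bij_betw (\<lambda>(m, i). m \<otimes> z [^] i) (M \<times> {..<p}) B"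
    unfolding bij_betw_def
  proof
    show "inj_on (\<lambda>(m, i). m \<otimes> z [^] i) (M \<times> {..<p})"
    proof (rule inj_onI, clarify)
      fix m i m' j assume h: "m \<in> M" "m' \<in> M" "i < p" "j < p" "m \<otimes> z [^] i = m' \<otimes> z [^] j"
      then have "[i = j] (mod p)" using uniq by blast
      then have "i = j" using h by (simp add: cong_def)
      then show "m = m' \<and> i = j" using h mc z by simp
    qed
    show "(\<lambda>(m, i). m \<otimes> z [^] i) ` (M \<times> {..<p}) = B"
    proof
      show "(\<lambda>(m, i). m \<otimes> z [^] i) ` (M \<times> {..<p}) \<subseteq> B" by (auto simp: B_def)
      show "B \<subseteq> (\<lambda>(m, i). m \<otimes> z [^] i) ` (M \<times> {..<p})"
      proof
        fix b assume "b \<in> B"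
        then obtain m i where b: "m \<in> M" "b = m \<otimes> z [^] (i::nat)" by (auto simp: B_def)
        have "z [^] i = z [^] (p * (i div p)) \<otimes> z [^] (i mod p)" using z by (simp add: nat_pow_mult)
        then have "b = (m \<otimes> z [^] (p * (i div p))) \<otimes> z [^] (i mod p)" using b mc z by (simp add: m_assoc)
        moreover have "m \<otimes> z [^] (p * (i div p)) \<in> M" using pm b subgroup.m_closed[OF M] by simp
        ultimately show "b \<in> (\<lambda>(m, i). m \<otimes> z [^] i) ` (M \<times> {..<p})"
          using p_pos by (force simp: image_iff)
      qed
    qed
  qed
  then have "card B = card (M \<times> {..<p})" by (metis bij_betw_same_card)
  then have cB: "card B = p * card M" by (simp add: card_cartesian_product mult.commute)
  \<comment> \<open>Any exponent will do, since \<open>uniq\<close> makes all choices congruent mod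
    p.\<close>
  define f where "f b = int (SOME i::nat. \<exists>m\<in>M. b = m \<otimes> z [^] i)" for b
  have fv: "[f (m \<otimes> z [^] i) = int i] (mod int p)" if m: "m \<in> M" for m and i :: nat
  proof -
    have "\<exists>m'\<in>M. m \<otimes> z [^] i = m' \<otimes> z [^] (SOME j::nat. \<exists>m'\<in>M. m \<otimes> z [^] i = m' \<otimes> z [^] j)"
      by (rule someI[of "\<lambda>j. \<exists>m'\<in>M. m \<otimes> z [^] i = m' \<otimes> z [^] j" i]) (use m in blast)
    then have "[i = (SOME j::nat. \<exists>m'\<in>M. m \<otimes> z [^] i = m' \<otimes> z [^] j)] (mod p)" using uniq m by blast
    then show ?thesis unfolding f_def by (simp add: cong_int_iff cong_sym)
  qed
  have ph: "phom p B f" unfolding phom_def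
  proof (intro ballI)
    fix x y assume "x \<in> B" "y \<in> B"
    then obtain m i m' j where h: "m \<in> M" "m' \<in> M" "x = m \<otimes> z [^] (i::nat)" "y = m' \<otimes> z [^] (j::nat)"
      by (auto simp: B_def)
    have "[f (x \<otimes> y) = int (i + j)] (mod int p)" using h prod fv[OF prodM, of m m' i "i + j"] by simp
    moreover have "[f x + f y = int i + int j] (mod int p)" using h fv by (intro cong_add) auto
    ultimately show "[f (x \<otimes> y) = f x + f y] (mod int p)" by (metis cong_sym cong_trans of_nat_add)
  qed
  have ker: "int p dvd f b \<longleftrightarrow> b \<in> M" if "b \<in> B" for b
  proof -
    obtain m i where b: "m \<in> M" "b = m \<otimes> z [^] (i::nat)" using \<open>b \<in> B\<close> by (auto simp: B_def)
    have "int p dvd f b \<longleftrightarrow> p dvd i" using fv[OF b(1), of i] b(2) by (simp add: cong_dvd_iff int_dvd_int_iff)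
    also have "\<dots> \<longleftrightarrow> z [^] i \<in> M" using pm by simp
    also have "\<dots> \<longleftrightarrow> b \<in> M"
    proof
      assume "z [^] i \<in> M" then show "b \<in> M" using b subgroup.m_closed[OF M] by simp
    next
      assume "b \<in> M"
      then have "inv m \<otimes> b \<in> M" using b subgroup.m_closed[OF M] subgroup.m_inv_closed[OF M] by blast
      then show "z [^] i \<in> M" using b z mc by (simp add: inv_mult_cancel_left)
    qed
    finally show ?thesis .
  qed
  show ?thesis using that[OF B[unfolded B_def] MB[unfolded B_def] zB[unfolded B_def] cB[unfolded B_def] ph[unfolded B_def] fv ker[unfolded B_def]] .
qed

lemma finite_subgroups: "finite {M. subgroup M G \<and> Q M}"
proof (rule finite_subset[of _ "Pow (carrier G)"])
  show "{M. subgroup M G \<and> Q M} \<subseteq> Pow (carrier G)" using subgroup.subset by blast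
qed (use fin in simp)

lemma maximal_subgroup_with:
  assumes "subgroup S G" "Q S"
  obtains M where "subgroup M G" "Q M" "\<And>B. subgroup B G \<Longrightarrow> Q B \<Longrightarrow> M \<subseteq> B \<Longrightarrow> M = B"
proof -
  have "{M. subgroup M G \<and> Q M} \<noteq> {}" using assms by blast
  then obtain M where "M \<in> {M. subgroup M G \<and> Q M}" "\<forall>B\<in>{M. subgroup M G \<and> Q M}. M \<subseteq> B \<longrightarrow> M = B"
    using finite_has_maximal[OF finite_subgroups[of Q]] by blast
  then show ?thesis using that by blast
qed

text \<open>A subgroup maximal among the proper ones containing S must be normal of index p, because
  \<open>p_group_growth\<close> and \<open>cyclic_extension\<close> enlarge it to all of J. Thus
  homomorphisms to Z/p separate J from each proper subgroup.\<close>

lemma p_group_phom: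
  assumes J: "subgroup J G" "card J = p ^ n" and S: "subgroup S G" "S \<subset> J"
  obtains f j where "phom p J f" "\<And>s. s \<in> S \<Longrightarrow> int p dvd f s" "j \<in> J" "\<not> int p dvd f j"
proof -
  obtain M where M: "subgroup M G" "S \<subseteq> M" "M \<subset> J"
    and max: "\<And>B. subgroup B G \<Longrightarrow> S \<subseteq> B \<Longrightarrow> B \<subset> J \<Longrightarrow> M \<subseteq> B \<Longrightarrow> M = B"
    using maximal_subgroup_with[OF S(1), where Q = "\<lambda>M. S \<subseteq> M \<and> M \<subset> J"] S(2) by (metis order_refl)
  obtain z where z: "z \<in> J" "z \<notin> M" "z [^] p \<in> M" "\<And>m. m \<in> M \<Longrightarrow> z \<otimes> m \<otimes> inv z \<in> M"
    using p_group_growth[OF J M(1,3)] by blast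
  have zc: "z \<in> carrier G" using z(1) subgroup.subset[OF J(1)] by auto
  let ?B = "{m \<otimes> z [^] (i::nat) | m i. m \<in> M}"
  obtain f where f: "subgroup ?B G" "M \<subseteq> ?B" "z \<in> ?B" "card ?B = p * card M" "phom p ?B f"
    "\<And>m i. m \<in> M \<Longrightarrow> [f (m \<otimes> z [^] (i::nat)) = int i] (mod int p)"
    "\<And>b. b \<in> ?B \<Longrightarrow> int p dvd f b \<longleftrightarrow> b \<in> M"
    using cyclic_extension[OF M(1) zc z(2,3,4)] by blast
  have "?B \<subseteq> J"
    using M(3) z(1) subgroup_nat_pow_closed[OF J(1) z(1)] subgroup.m_closed[OF J(1)] by blast
  moreover have "\<not> ?B \<subset> J" using max[OF f(1)] f(2,3) M(2) z(2) by blast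
  ultimately have B: "?B = J" by blast
  show ?thesis
    by (rule that[of f z]) (use f(5,7)[unfolded B] M(2,3) z(1,2) in auto)
qed

text \<open>Growth proceeds by factors of exactly p, so a largest subgroup of order at most
  \<open>p^k\<close> cannot stop short of \<open>p^k\<close>.\<close>

lemma subgroup_between:
  assumes P: "subgroup P G" "card P = p ^ n" and A: "subgroup A G" "A \<subseteq> P" "card A \<le> p ^ k" "k \<le> n"
  obtains H where "subgroup H G" "A \<subseteq> H" "H \<subseteq> P" "card H = p ^ k"
proof -
  obtain M where M: "subgroup M G" "A \<subseteq> M" "M \<subseteq> P" "card M \<le> p ^ k"
    and max: "\<And>B. subgroup B G \<Longrightarrow> A \<subseteq> B \<Longrightarrow> B \<subseteq> P \<Longrightarrow> card B \<le> p ^ k \<Longrightarrow> M \<subseteq> B \<Longrightarrow> M = B"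
    using maximal_subgroup_with[OF A(1), where Q = "\<lambda>M. A \<subseteq> M \<and> M \<subseteq> P \<and> card M \<le> p ^ k"] A by (metis order_refl)
  have "card M dvd p ^ n" using card_subgroup_dvd[OF fin M(1) P(1) M(3)] P(2) by simp
  then obtain i where i: "card M = p ^ i" using prime_p divides_primepow_nat by blast
  have ik: "i \<le> k" using M(4) i p_pos by simp
  have "i = k"
  proof (rule ccontr)
    assume "i \<noteq> k"
    then have "i < k" using ik by simp
    then have "M \<noteq> P" using i P(2) A(4) p_pos by auto
    then have MP: "M \<subset> P" using M(3) by auto
    obtain z where z: "z \<in> P" "z \<notin> M" "z [^] p \<in> M" "\<And>m. m \<in> M \<Longrightarrow> z \<otimes> m \<otimes> inv z \<in> M"
      using p_group_growth[OF P M(1) MP] by blast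
    have zc: "z \<in> carrier G" using z(1) subgroup.subset[OF P(1)] by auto
    let ?B = "{m \<otimes> z [^] (i::nat) | m i. m \<in> M}"
    obtain f where f: "subgroup ?B G" "M \<subseteq> ?B" "z \<in> ?B" "card ?B = p * card M" "phom p ?B f"
    "\<And>m i. m \<in> M \<Longrightarrow> [f (m \<otimes> z [^] (i::nat)) = int i] (mod int p)"
    "\<And>b. b \<in> ?B \<Longrightarrow> int p dvd f b \<longleftrightarrow> b \<in> M"
      using cyclic_extension[OF M(1) zc z(2,3,4)] by blast
    have "?B \<subseteq> P"
      using M(3) z(1) subgroup_nat_pow_closed[OF P(1) z(1)] subgroup.m_closed[OF P(1)] by blast
    moreover have "card ?B \<le> p ^ k"
      using f(4) i \<open>i < k\<close> p_pos by (simp flip: power_Suc)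
    ultimately have "M = ?B" using max[OF f(1)] f(2) M(2) by blast
    then show False using f(3) z(2) by blast
  qed
  then show ?thesis using that M i by blast
qed

text \<open>Fixed points of the conjugation action of \<open>P\<close> on \<open>D / E\<close>, for \<open>E\<close> maximal among the proper
  subgroups of \<open>D\<close> normalized by \<open>P\<close>.\<close>

lemma p_group_invariant_phom:
  assumes P: "subgroup P G" "card P = p ^ n" and D: "subgroup D G" "D \<subseteq> P" "D \<noteq> {\<one>}"
    and norm: "\<And>y d. y \<in> P \<Longrightarrow> d \<in> D \<Longrightarrow> y \<otimes> d \<otimes> inv y \<in> D"
  obtains f d where "phom p D f" "\<And>y d. y \<in> P \<Longrightarrow> d \<in> D \<Longrightarrow> [f (y \<otimes> d \<otimes> inv y) = f d] (mod int p)"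
    "d \<in> D" "\<not> int p dvd f d"
proof -
  have Pc: "P \<subseteq> carrier G" using subgroup.subset[OF P(1)] .
  have pc: "\<And>y. y \<in> P \<Longrightarrow> y \<in> carrier G" using Pc by auto
  have Dc: "D \<subseteq> carrier G" using D Pc by auto
  have finD: "finite D" using Dc fin finite_subset by auto
  let ?Q = "\<lambda>M. M \<subset> D \<and> (\<forall>y\<in>P. \<forall>d\<in>M. y \<otimes> d \<otimes> inv y \<in> M)"
  have triv: "?Q {\<one>}"
    using D subgroup.one_closed[OF D(1)] pc by auto
  obtain E where E: "subgroup E G" "?Q E"
    and Emax: "\<And>B. subgroup B G \<Longrightarrow> ?Q B \<Longrightarrow> E \<subseteq> B \<Longrightarrow> E = B"
    using maximal_subgroup_with[OF triv_subgroup, where Q = "?Q", OF triv] by metis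
  from E have E: "subgroup E G" "E \<subset> D" and En: "\<And>y d. y \<in> P \<Longrightarrow> d \<in> E \<Longrightarrow> y \<otimes> d \<otimes> inv y \<in> E"
    by auto
  have max: "subgroup B G \<Longrightarrow> B \<subset> D \<Longrightarrow> (\<And>y d. y \<in> P \<Longrightarrow> d \<in> B \<Longrightarrow> y \<otimes> d \<otimes> inv y \<in> B) \<Longrightarrow> E \<subseteq> B \<Longrightarrow> E = B" for B
    by (rule Emax) auto
  have Ec: "E \<subseteq> carrier G" using E Dc by auto
  let ?X = "(\<lambda>x. x <# E) ` D"
  define a where "a y c = (\<lambda>x. y \<otimes> x \<otimes> inv y) ` c" for y c
  let ?F = "{c \<in> ?X. \<forall>s \<in> carrier (G\<lparr>carrier := P\<rparr>). a s c = c}"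
  have aco: "a y (x <# E) = (y \<otimes> x \<otimes> inv y) <# E" if y: "y \<in> P" and x: "x \<in> D" for y x
  proof
    have c: "y \<in> carrier G" "x \<in> carrier G" using y x pc Dc by auto
    have "y \<otimes> (x \<otimes> e) \<otimes> inv y = (y \<otimes> x \<otimes> inv y) \<otimes> (y \<otimes> e \<otimes> inv y)" if "e \<in> E" for e
      using that c Ec by (simp add: group_word_simps subset_iff)
    then show "a y (x <# E) \<subseteq> (y \<otimes> x \<otimes> inv y) <# E"
      using En[OF y] by (force simp: a_def l_coset_def)
    have "(y \<otimes> x \<otimes> inv y) \<otimes> e = y \<otimes> (x \<otimes> (inv y \<otimes> e \<otimes> inv (inv y))) \<otimes> inv y" if "e \<in> E" for e
      using that c Ec by (simp add: group_word_simps subset_iff)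
    then show "(y \<otimes> x \<otimes> inv y) <# E \<subseteq> a y (x <# E)"
      using En[OF subgroup.m_inv_closed[OF P(1) y]] by (fastforce simp: a_def l_coset_def)
  qed
  have "[card ?X = card ?F] (mod p)"
  proof (rule card_fixed_points_cong)
    show "group (G\<lparr>carrier := P\<rparr>)" by (rule subgroup_imp_group[OF P(1)])
    show "card (carrier (G\<lparr>carrier := P\<rparr>)) = p ^ n" using P by simp
    fix s c assume s: "s \<in> carrier (G\<lparr>carrier := P\<rparr>)" and c: "c \<in> ?X"
    then show "a s c \<in> ?X" using aco norm by auto
  next
    fix c assume "c \<in> ?X"
    then obtain x where x: "x \<in> D" "c = x <# E" by auto
    then show "a \<one>\<^bsub>G\<lparr>carrier := P\<rparr>\<^esub> c = c" using aco[OF subgroup.one_closed[OF P(1)]] Dc by auto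
  next
    fix s t c assume s: "s \<in> carrier (G\<lparr>carrier := P\<rparr>)" and t: "t \<in> carrier (G\<lparr>carrier := P\<rparr>)" and "c \<in> ?X"
    then obtain x where x: "x \<in> D" "c = x <# E" by auto
    have "s \<otimes> t \<otimes> x \<otimes> inv (s \<otimes> t) = s \<otimes> (t \<otimes> x \<otimes> inv t) \<otimes> inv s"
      using s t x pc Dc by (simp add: group_word_simps subset_iff)
    then show "a (s \<otimes>\<^bsub>G\<lparr>carrier := P\<rparr>\<^esub> t) c = a s (a t c)"
      using s t x aco norm subgroup.m_closed[OF P(1)] by simp
  qed (use prime_p finD Pc fin finite_subset in auto)
  moreover have "p dvd card ?X"
  proof -
    have cX: "card D = card ?X * card E" using card_l_cosets[OF fin E(1) D(1)] E(2) by auto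
    have "card E < card D" using E(2) finD by (simp add: psubset_card_mono)
    then have "card ?X \<noteq> 1" using cX by auto
    moreover have "card ?X dvd p ^ n"
      using cX card_subgroup_dvd[OF fin D(1) P(1) D(2)] P(2) by (metis dvd_mult_left)
    ultimately show ?thesis using prime_p divides_primepow_nat
      by (metis dvd_power neq0_conv power_0)
  qed
  ultimately have pF: "p dvd card ?F" by (simp add: cong_dvd_iff)
  have E1: "\<one> \<in> E" "\<one> \<in> D" using subgroup.one_closed E(1) D(1) by auto
  have "\<one> <# E = E" using lcos_mult_one[OF Ec] .
  then have EF: "E \<in> ?F" using aco[OF _ E1(2)] pc E1 by (auto simp: image_iff intro!: bexI[of _ \<one>])
  have "\<exists>c \<in> ?F. c \<noteq> E"
  proof (rule ccontr)
    assume "\<not> ?thesis"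
    then have "?F = {E}" using EF by blast
    then show False using pF p_pos by simp
  qed
  then obtain x where x: "x \<in> D" "x <# E \<noteq> E" "\<And>s. s \<in> P \<Longrightarrow> a s (x <# E) = x <# E" by auto
  have xc: "x \<in> carrier G" using x Dc by auto
  have xE: "x \<notin> E" using x(2) coset_join3[OF xc E(1)] by blast
  \<comment> \<open>The preimage in D of the fixed points on D/E. It is closed under products, so
    replacing x by a power whose p-th power lies in E stays inside.\<close>
  define C where "C = {w \<in> D. \<forall>y\<in>P. inv w \<otimes> (y \<otimes> w \<otimes> inv y) \<in> E}"
  have xC: "x \<in> C"
  proof -
    have "inv x \<otimes> (y \<otimes> x \<otimes> inv y) \<in> E" if y: "y \<in> P" for y
      using x(3)[OF y] aco[OF y x(1)] l_coset_eq_iff[OF E(1) xc, of "y \<otimes> x \<otimes> inv y"] xc pc[OF y] by simp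
    then show ?thesis using x by (auto simp: C_def)
  qed
  have Cm: "u \<otimes> w \<in> C" if u: "u \<in> C" and w: "w \<in> C" for u w
  proof -
    have uw: "u \<in> D" "w \<in> D" "u \<in> carrier G" "w \<in> carrier G" using u w Dc by (auto simp: C_def)
    have "inv (u \<otimes> w) \<otimes> (y \<otimes> (u \<otimes> w) \<otimes> inv y) \<in> E" if y: "y \<in> P" for y
    proof -
      have "inv (u \<otimes> w) \<otimes> (y \<otimes> (u \<otimes> w) \<otimes> inv y)
        = (inv w \<otimes> (inv u \<otimes> (y \<otimes> u \<otimes> inv y)) \<otimes> inv (inv w)) \<otimes> (inv w \<otimes> (y \<otimes> w \<otimes> inv y))"
        using uw pc[OF y] by (simp add: group_word_simps)
      also have "\<dots> \<in> E"
      proof (rule subgroup.m_closed[OF E(1)])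
        have "inv w \<in> P" using uw D(2) subgroup.m_inv_closed[OF P(1)] by auto
        then show "inv w \<otimes> (inv u \<otimes> (y \<otimes> u \<otimes> inv y)) \<otimes> inv (inv w) \<in> E"
          by (rule En) (use u y in \<open>auto simp: C_def\<close>)
        show "inv w \<otimes> (y \<otimes> w \<otimes> inv y) \<in> E" using w y by (auto simp: C_def)
      qed
      finally show ?thesis .
    qed
    then show ?thesis using uw subgroup.m_closed[OF D(1)] by (auto simp: C_def)
  qed
  have C1: "\<one> \<in> C" using E1 pc by (auto simp: C_def)
  have Cp: "x [^] (i::nat) \<in> C" for i
    by (induction i) (use C1 Cm xC in auto)
  have "x [^] (p ^ n) \<in> E" using pow_card_subgroup[OF P(1), of x] x(1) D(2) P(2) E1 by auto
  then obtain j where j: "x [^] (p ^ j) \<notin> E" "(x [^] (p ^ j)) [^] p \<in> E"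
    using exists_power_step[OF xc xE] by blast
  define z where "z = x [^] (p ^ j)"
  have z: "z \<notin> E" "z [^] p \<in> E" "z \<in> carrier G" "z \<in> D" using j xc Cp by (auto simp: z_def C_def)
  have zC: "z [^] (i::nat) \<in> C" for i using Cp xc by (simp add: z_def nat_pow_pow)
  have zn: "z \<otimes> m \<otimes> inv z \<in> E" if "m \<in> E" for m using En that z(4) D(2) by auto
  let ?B = "{m \<otimes> z [^] (i::nat) | m i. m \<in> E}"
  obtain f where f: "subgroup ?B G" "E \<subseteq> ?B" "z \<in> ?B" "card ?B = p * card E" "phom p ?B f"
    "\<And>m i. m \<in> E \<Longrightarrow> [f (m \<otimes> z [^] (i::nat)) = int i] (mod int p)"
    "\<And>b. b \<in> ?B \<Longrightarrow> int p dvd f b \<longleftrightarrow> b \<in> E"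
    using cyclic_extension[OF E(1) z(3,1,2) zn] by blast
  have cj: "\<exists>e\<in>E. y \<otimes> (m \<otimes> z [^] i) \<otimes> inv y = e \<otimes> z [^] i" if y: "y \<in> P" and m: "m \<in> E" for y m and i :: nat
  proof -
    define w where "w = z [^] i"
    have w: "w \<in> C" "w \<in> D" "w \<in> carrier G" using zC Dc unfolding w_def C_def by auto
    have mc: "m \<in> carrier G" using m Ec by auto
    have "y \<otimes> (m \<otimes> w) \<otimes> inv y = ((y \<otimes> m \<otimes> inv y) \<otimes> (w \<otimes> (inv w \<otimes> (y \<otimes> w \<otimes> inv y)) \<otimes> inv w)) \<otimes> w"
      using w pc[OF y] mc by (simp add: group_word_simps)
    moreover have "(y \<otimes> m \<otimes> inv y) \<otimes> (w \<otimes> (inv w \<otimes> (y \<otimes> w \<otimes> inv y)) \<otimes> inv w) \<in> E"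
    proof (rule subgroup.m_closed[OF E(1)])
      show "y \<otimes> m \<otimes> inv y \<in> E" using En y m by auto
      show "w \<otimes> (inv w \<otimes> (y \<otimes> w \<otimes> inv y)) \<otimes> inv w \<in> E"
        by (rule En) (use w y D(2) in \<open>auto simp: C_def\<close>)
    qed
    ultimately show ?thesis unfolding w_def by blast
  qed
  have BD: "?B \<subseteq> D"
    using E(2) subgroup_nat_pow_closed[OF D(1) z(4)] subgroup.m_closed[OF D(1)] by blast
  \<comment> \<open>P acts trivially on \<open>?B\<close>/E, so \<open>?B\<close> is invariant under
    P and the maximality of E makes it all of D.\<close>
  have "\<not> ?B \<subset> D"
  proof
    assume "?B \<subset> D"
    then have "E = ?B"
    proof (rule max[OF f(1)])
      fix y d assume y: "y \<in> P" and "d \<in> ?B"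
      then obtain m i where "m \<in> E" "d = m \<otimes> z [^] (i::nat)" by auto
      then show "y \<otimes> d \<otimes> inv y \<in> ?B" using cj[OF y, of m i] by blast
    qed (use f in blast)
    then show False using f(3) z(1) by blast
  qed
  then have B: "?B = D" using BD by blast
  have inv: "[f (y \<otimes> d \<otimes> inv y) = f d] (mod int p)" if y: "y \<in> P" and d: "d \<in> D" for y d
  proof -
    obtain m i where m: "m \<in> E" "d = m \<otimes> z [^] (i::nat)" using d B by blast
    obtain e where e: "e \<in> E" "y \<otimes> d \<otimes> inv y = e \<otimes> z [^] i" using cj[OF y m(1)] m(2) by blast
    show ?thesis using f(6)[OF m(1), of i] f(6)[OF e(1), of i] m(2) e(2) by (metis cong_sym cong_trans)
  qed
  show ?thesis
    by (rule that[of f z]) (use f(5,7)[unfolded B] inv z in auto)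
qed

end

section \<open>Transfer and the theorem of Tate\<close>

context prime_group
begin

text \<open>Cauchy's theorem, as the case \<open>p ^ 1\<close> of Sylow's existence theorem.\<close>

lemma order_p_element:
  assumes R: "subgroup R G" "p dvd card R"
  obtains r where "r \<in> R" "r \<noteq> \<one>" "r [^] p = \<one>"
proof -
  interpret R: group "G\<lparr>carrier := R\<rparr>" by (rule subgroup_imp_group[OF R(1)])
  obtain m where m: "card R = p ^ 1 * m" using R(2) by auto
  have "finite R" using subgroup.subset[OF R(1)] fin finite_subset by auto
  then obtain H where H: "subgroup H (G\<lparr>carrier := R\<rparr>)" "card H = p ^ 1"
    using sylow_thm[of p "G\<lparr>carrier := R\<rparr>" 1 m] R.group_axioms prime_p m by (auto simp: order_def)
  have HG: "subgroup H G" "H \<subseteq> R" using H(1) R(1) subgroup.subset incl_subgroup by fastforce+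
  have "\<exists>r\<in>H. r \<noteq> \<one>"
  proof (rule ccontr)
    assume "\<not> ?thesis"
    then have "H \<subseteq> {\<one>}" by blast
    then have "card H \<le> 1" by (metis card.empty card_mono card_1_singleton_iff finite.simps One_nat_def)
    then show False using H(2) p_pos by simp
  qed
  then obtain r where "r \<in> H" "r \<noteq> \<one>" by blast
  moreover have "r [^] p = \<one>" using pow_card_subgroup[OF HG(1) \<open>r \<in> H\<close>] H(2) by simp
  ultimately show ?thesis using that HG(2) by blast
qed

text \<open>With |G| = p^n m, the exponent e is a multiple of m, so w^e is a p-element; and it is 1
  mod p, so homomorphisms to Z/p do not distinguish w^e from w. Their values can thus be read off in
  P.\<close>

lemma p_element_conj:
  assumes P: "subgroup P G" "card P = p ^ n" "\<not> p dvd order G div card P" and w: "w \<in> carrier G"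
  obtains b e where "b \<in> carrier G" "[e = 1] (mod p)" "b \<otimes> w [^] (e::nat) \<otimes> inv b \<in> P"
proof -
  define m where "m = order G div card P"
  have m: "order G = p ^ n * m"
    using card_subgroup_dvd[OF fin P(1) subgroup_self subgroup.subset[OF P(1)]] P(2)
    by (simp add: m_def order_def)
  have "coprime m p" using P(3) prime_p unfolding m_def by (metis coprime_commute prime_imp_coprime)
  then obtain c where c: "[m * c = Suc 0] (mod p)" using cong_solve_coprime_nat by blast
  define e where "e = m * c"
  define x where "x = w [^] e"
  have xc: "x \<in> carrier G" using w by (simp add: x_def)
  have "x [^] (p ^ n) = (w [^] order G) [^] c"
    using w m by (simp add: x_def e_def nat_pow_pow ac_simps)
  then have x1: "x [^] (p ^ n) = \<one>" using pow_order_eq_1[OF w] by simp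
  let ?S = "generate G {x}"
  have S: "subgroup ?S G" using generate_is_subgroup xc by simp
  have "card ?S = ord x" using generate_pow_card[OF xc] by simp
  moreover have "ord x dvd p ^ n" using x1 pow_eq_id[OF xc] by simp
  ultimately obtain i where "card ?S = p ^ i" using prime_p divides_primepow_nat by metis
  then obtain g where g: "g \<in> carrier G" "\<And>s. s \<in> ?S \<Longrightarrow> inv g \<otimes> s \<otimes> g \<in> P"
    using sylow_conjugate[OF fin prime_p S _ P(1,3)] by metis
  have "x \<in> ?S" by (simp add: generate.incl)
  then have "inv g \<otimes> w [^] e \<otimes> inv (inv g) \<in> P" using g unfolding x_def by simp
  then show ?thesis using that[of "inv g" e] g c unfolding e_def by simp
qed

end

text \<open>Transfer for the group of pairs (g, s) with s in S and \<open>g s^-1\<close> in K,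
  acting on the cosets of D in K by xD -> g x s^-1 D; the S-invariance of f makes it a homomorphism.
  The pairs (k, 1) give the usual transfer on K. The pairs (s, s) give a homomorphism on S, and (d,
  1)(1, d) = (d, d) links the two.\<close>

lemma (in group) transfer_hom:
  assumes fin: "finite (carrier G)"
    and D: "subgroup D G" and K: "subgroup K G" and DK: "D \<subseteq> K" and S: "subgroup S G"
    and nD: "\<And>s d. s \<in> S \<Longrightarrow> d \<in> D \<Longrightarrow> s \<otimes> d \<otimes> inv s \<in> D"
    and nK: "\<And>s k. s \<in> S \<Longrightarrow> k \<in> K \<Longrightarrow> s \<otimes> k \<otimes> inv s \<in> K"
    and f: "phom q D f" and fS: "\<And>s d. s \<in> S \<Longrightarrow> d \<in> D \<Longrightarrow> [f (s \<otimes> d \<otimes> inv s) = f d] (mod int q)"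
  obtains F :: "'a \<Rightarrow> 'a \<Rightarrow> int" where
    "\<And>g h s t. s \<in> S \<Longrightarrow> t \<in> S \<Longrightarrow> g \<in> carrier G \<Longrightarrow> h \<in> carrier G \<Longrightarrow>
       g \<otimes> inv s \<in> K \<Longrightarrow> h \<otimes> inv t \<in> K \<Longrightarrow> [F (g \<otimes> h) (s \<otimes> t) = F g s + F h t] (mod int q)"
    "\<And>d. d \<in> D \<Longrightarrow> d \<in> S \<Longrightarrow> [F \<one> d = - (int (card K div card D) * f d)] (mod int q)"
    "\<And>z. z \<in> D \<Longrightarrow> (\<And>k. k \<in> K \<Longrightarrow> k \<otimes> z = z \<otimes> k) \<Longrightarrow> [F z \<one> = int (card K div card D) * f z] (mod int q)"
proof -
  let ?C = "(\<lambda>x. x <# D) ` K"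
  define r where "r c = (SOME x. x \<in> K \<and> c = x <# D)" for c
  define a where "a g s c = (\<lambda>x. g \<otimes> x \<otimes> inv s) ` c" for g s c
  \<comment> \<open>The summand takes the D-component of \<open>g r(c) s^-1\<close> relative to the
    representative of its own coset.\<close>
  define F where "F g s = (\<Sum>c\<in>?C. f (inv (r (a g s c)) \<otimes> (g \<otimes> r c \<otimes> inv s)))" for g s
  have Kc: "\<And>k. k \<in> K \<Longrightarrow> k \<in> carrier G" using subgroup.mem_carrier[OF K] .
  have Dc: "\<And>k. k \<in> D \<Longrightarrow> k \<in> carrier G" using subgroup.mem_carrier[OF D] .
  have Sc: "\<And>k. k \<in> S \<Longrightarrow> k \<in> carrier G" using subgroup.mem_carrier[OF S] .
  have finK: "finite K" using finite_subset[OF subgroup.subset[OF K] fin] .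
  have finD: "finite D" using finite_subset[OF subgroup.subset[OF D] fin] .
  have r: "r c \<in> K" "c = r c <# D" if "c \<in> ?C" for c
  proof -
    obtain x where "x \<in> K \<and> c = x <# D" using \<open>c \<in> ?C\<close> by blast
    then have "r c \<in> K \<and> c = r c <# D" unfolding r_def by (rule someI)
    then show "r c \<in> K" "c = r c <# D" by auto
  qed
  have gK: "g \<otimes> k \<otimes> inv s \<in> K" if "g \<otimes> inv s \<in> K" "g \<in> carrier G" "s \<in> S" "k \<in> K" for g s k
  proof -
    have "g \<otimes> k \<otimes> inv s = (g \<otimes> inv s) \<otimes> (s \<otimes> k \<otimes> inv s)"
      using that Kc Sc by (simp add: group_word_simps)
    then show ?thesis using that nK subgroup.m_closed[OF K] by simp
  qed
  have aco: "a g s (x <# D) = (g \<otimes> x \<otimes> inv s) <# D"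
    if "g \<in> carrier G" "x \<in> K" "s \<in> S" for g s x
  proof
    have c: "g \<in> carrier G" "x \<in> carrier G" "s \<in> carrier G" using that Kc Sc by auto
    have "g \<otimes> (x \<otimes> d) \<otimes> inv s = (g \<otimes> x \<otimes> inv s) \<otimes> (s \<otimes> d \<otimes> inv s)" if "d \<in> D" for d
      using that c Dc by (simp add: group_word_simps)
    then show "a g s (x <# D) \<subseteq> (g \<otimes> x \<otimes> inv s) <# D"
      using nD[OF that(3)] by (force simp: a_def l_coset_def)
    have "(g \<otimes> x \<otimes> inv s) \<otimes> d = g \<otimes> (x \<otimes> (inv s \<otimes> d \<otimes> inv (inv s))) \<otimes> inv s" if "d \<in> D" for d
      using that c Dc by (simp add: group_word_simps)
    then show "(g \<otimes> x \<otimes> inv s) <# D \<subseteq> a g s (x <# D)"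
      using nD[OF subgroup.m_inv_closed[OF S that(3)]] by (fastforce simp: a_def l_coset_def)
  qed
  have aC: "a g s c \<in> ?C" if "g \<otimes> inv s \<in> K" "g \<in> carrier G" "s \<in> S" "c \<in> ?C" for g s c
    using aco[OF that(2) r(1)[OF that(4)] that(3)] r(2)[OF that(4)] gK[OF that(1-3) r(1)[OF that(4)]] by auto
  have inD: "inv (r (a g s c)) \<otimes> (g \<otimes> r c \<otimes> inv s) \<in> D"
    if "g \<otimes> inv s \<in> K" "g \<in> carrier G" "s \<in> S" "c \<in> ?C" for g s c
  proof -
    have 1: "r (a g s c) \<in> K" "a g s c = r (a g s c) <# D" using r[OF aC[OF that]] by auto
    have "a g s c = (g \<otimes> r c \<otimes> inv s) <# D"
      using aco[OF that(2) r(1)[OF that(4)] that(3)] r(2)[OF that(4)] by simp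
    then show ?thesis
      using 1 l_coset_eq_iff[OF D Kc[OF 1(1)], of "g \<otimes> r c \<otimes> inv s"] that Sc Kc r(1) by simp
  qed
  have aa: "a (g \<otimes> h) (s \<otimes> t) c = a g s (a h t c)"
    if "g \<in> carrier G" "h \<in> carrier G" "s \<in> S" "t \<in> S" "h \<otimes> inv t \<in> K" "c \<in> ?C" for g h s t c
  proof -
    have x: "r c \<in> K" "c = r c <# D" using r that by auto
    have "a (g \<otimes> h) (s \<otimes> t) c = (g \<otimes> h \<otimes> r c \<otimes> inv (s \<otimes> t)) <# D"
      using x aco[of "g \<otimes> h" "r c" "s \<otimes> t"] that subgroup.m_closed[OF S] by simp
    also have "g \<otimes> h \<otimes> r c \<otimes> inv (s \<otimes> t) = g \<otimes> (h \<otimes> r c \<otimes> inv t) \<otimes> inv s"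
      using that Sc Kc x by (simp add: group_word_simps)
    also have "\<dots> <# D = a g s (a h t c)"
      using x aco[of h "r c" t] aco[of g "h \<otimes> r c \<otimes> inv t" s] gK that by simp
    finally show ?thesis .
  qed
  have bij: "bij_betw (a h t) ?C ?C" if "h \<otimes> inv t \<in> K" "h \<in> carrier G" "t \<in> S" for h t
  proof -
    have "inj_on (a h t) ?C"
    proof (rule inj_onI)
      fix c d assume cd: "c \<in> ?C" "d \<in> ?C" "a h t c = a h t d"
      have tc: "t \<in> carrier G" using that Sc by auto
      have "\<And>c. c \<in> ?C \<Longrightarrow> c \<subseteq> carrier G" using l_coset_subset_G[OF subgroup.subset[OF D] Kc] by blast
      then have sub: "c \<subseteq> carrier G" "d \<subseteq> carrier G" using cd by auto
      have "inj_on (\<lambda>x. h \<otimes> x \<otimes> inv t) (carrier G)" using that tc by (auto simp: inj_on_def m_assoc)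
      then show "c = d" using cd(3) sub unfolding a_def by (meson inj_on_image_eq_iff)
    qed
    moreover have "a h t ` ?C \<subseteq> ?C" using aC[OF that] by blast
    ultimately show ?thesis using finK by (simp add: bij_betw_def endo_inj_surj)
  qed
  have hom: "[F (g \<otimes> h) (s \<otimes> t) = F g s + F h t] (mod int q)"
    if s: "s \<in> S" and t: "t \<in> S" and g: "g \<in> carrier G" and h: "h \<in> carrier G"
      and gs: "g \<otimes> inv s \<in> K" and ht: "h \<otimes> inv t \<in> K" for g h s t
  proof -
    have "[f (inv (r (a (g \<otimes> h) (s \<otimes> t) c)) \<otimes> (g \<otimes> h \<otimes> r c \<otimes> inv (s \<otimes> t)))
      = f (inv (r (a g s (a h t c))) \<otimes> (g \<otimes> r (a h t c) \<otimes> inv s))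
      + f (inv (r (a h t c)) \<otimes> (h \<otimes> r c \<otimes> inv t))] (mod int q)" if c: "c \<in> ?C" for c
    proof -
      define u v w where "u = r c" and "v = r (a h t c)" and "w = r (a g s (a h t c))"
      have hc: "a h t c \<in> ?C" using aC[OF ht h t c] .
      have uvw: "u \<in> carrier G" "v \<in> carrier G" "w \<in> carrier G"
        using r(1) Kc c hc aC[OF gs g s hc] unfolding u_def v_def w_def by auto
      have d1: "inv v \<otimes> (h \<otimes> u \<otimes> inv t) \<in> D" using inD[OF ht h t c] by (simp add: u_def v_def)
      have d2: "inv w \<otimes> (g \<otimes> v \<otimes> inv s) \<in> D" using inD[OF gs g s hc] by (simp add: w_def v_def)
      \<comment> \<open>The component belonging to (h, t) comes out conjugated by s, which f does
        not notice.\<close>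
      have "inv w \<otimes> (g \<otimes> h \<otimes> u \<otimes> inv (s \<otimes> t))
        = (inv w \<otimes> (g \<otimes> v \<otimes> inv s)) \<otimes> (s \<otimes> (inv v \<otimes> (h \<otimes> u \<otimes> inv t)) \<otimes> inv s)"
        using uvw g h Sc[OF s] Sc[OF t] by (simp add: group_word_simps)
      then have "[f (inv w \<otimes> (g \<otimes> h \<otimes> u \<otimes> inv (s \<otimes> t)))
        = f (inv w \<otimes> (g \<otimes> v \<otimes> inv s)) + f (s \<otimes> (inv v \<otimes> (h \<otimes> u \<otimes> inv t)) \<otimes> inv s)] (mod int q)"
        using phom_mult[OF f d2 nD[OF s d1]] by simp
      also have "[f (inv w \<otimes> (g \<otimes> v \<otimes> inv s)) + f (s \<otimes> (inv v \<otimes> (h \<otimes> u \<otimes> inv t)) \<otimes> inv s)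
        = f (inv w \<otimes> (g \<otimes> v \<otimes> inv s)) + f (inv v \<otimes> (h \<otimes> u \<otimes> inv t))] (mod int q)"
        by (rule cong_add[OF cong_refl fS[OF s d1]])
      finally show ?thesis using aa[OF g h s t ht c] unfolding u_def v_def w_def by simp
    qed
    then have "[F (g \<otimes> h) (s \<otimes> t)
      = (\<Sum>c\<in>?C. f (inv (r (a g s (a h t c))) \<otimes> (g \<otimes> r (a h t c) \<otimes> inv s))
      + f (inv (r (a h t c)) \<otimes> (h \<otimes> r c \<otimes> inv t)))] (mod int q)"
      unfolding F_def by (rule cong_sum)
    moreover have "(\<Sum>c\<in>?C. f (inv (r (a g s (a h t c))) \<otimes> (g \<otimes> r (a h t c) \<otimes> inv s))) = F g s"
      unfolding F_def
      using sum.reindex_bij_betw[OF bij[OF ht h t], of "\<lambda>c. f (inv (r (a g s c)) \<otimes> (g \<otimes> r c \<otimes> inv s))"] by simp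
    ultimately show ?thesis by (simp add: sum.distrib F_def)
  qed
  have cC: "card ?C = card K div card D"
  proof -
    have "card D > 0" using finD subgroup.one_closed[OF D] by (auto simp: card_gt_0_iff)
    then show ?thesis using card_l_cosets[OF fin D K DK] by simp
  qed
  have K1: "\<one> \<in> K" and S1: "\<one> \<in> S" using subgroup.one_closed K S by auto
  have c2: "[F \<one> d = - (int (card K div card D) * f d)] (mod int q)" if d: "d \<in> D" "d \<in> S" for d
  proof -
    have dK: "\<one> \<otimes> inv d \<in> K" using d DK subgroup.m_inv_closed[OF K] Dc by auto
    have "[f (inv (r (a \<one> d c)) \<otimes> (\<one> \<otimes> r c \<otimes> inv d)) = - f d] (mod int q)" if c: "c \<in> ?C" for c
    proof -
      have u: "r c \<in> carrier G" using r(1)[OF c] Kc by auto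
      have "a \<one> d c = (\<one> \<otimes> r c \<otimes> inv d) <# D"
        using aco[OF one_closed r(1)[OF c] d(2)] r(2)[OF c] by simp
      also have "\<dots> = r c <# D"
        using l_coset_eq_iff[OF D u, of "\<one> \<otimes> r c \<otimes> inv d"] u Dc[OF d(1)] subgroup.m_inv_closed[OF D d(1)]
        by (simp add: inv_mult_cancel_left)
      finally have "a \<one> d c = c" using r(2)[OF c] by simp
      then show ?thesis using phom_inv[OF D f d(1)] u Dc[OF d(1)] by (simp add: inv_mult_cancel_left)
    qed
    then have "[F \<one> d = (\<Sum>c\<in>?C. - f d)] (mod int q)" unfolding F_def by (rule cong_sum)
    then show ?thesis using cC by simp
  qed
  have c3: "[F z \<one> = int (card K div card D) * f z] (mod int q)"
    if z: "z \<in> D" and cen: "\<And>k. k \<in> K \<Longrightarrow> k \<otimes> z = z \<otimes> k" for z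
  proof -
    have "inv (r (a z \<one> c)) \<otimes> (z \<otimes> r c \<otimes> inv \<one>) = z" if c: "c \<in> ?C" for c
    proof -
      have u: "r c \<in> carrier G" using r(1)[OF c] Kc by auto
      have zu: "z \<otimes> r c \<otimes> inv \<one> = r c \<otimes> z" using cen[OF r(1)[OF c]] u Dc[OF z] by simp
      have "a z \<one> c = (z \<otimes> r c \<otimes> inv \<one>) <# D"
        using aco[OF Dc[OF z] r(1)[OF c] S1] r(2)[OF c] by simp
      also have "\<dots> = r c <# D"
        using l_coset_eq_iff[OF D u, of "r c \<otimes> z"] u Dc[OF z] z zu
        by (simp add: inv_mult_cancel_left)
      finally have "a z \<one> c = c" using r(2)[OF c] by simp
      then show ?thesis using u Dc[OF z] zu by (simp add: inv_mult_cancel_left)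
    qed
    then have "F z \<one> = (\<Sum>c\<in>?C. f z)" unfolding F_def by (intro sum.cong) auto
    then show ?thesis using cC by simp
  qed
  show ?thesis using that[OF hom c2 c3] by blast
qed

context prime_group
begin

lemma cong_solve_mod_p:
  assumes "\<not> int p dvd a"
  obtains i :: nat where "[int i * a = b] (mod int p)"
proof -
  have "coprime a (int p)" using assms prime_int_p by (metis coprime_commute prime_imp_coprime)
  then obtain x where x: "[a * x = 1] (mod int p)" using cong_solve_coprime_int by blast
  define i where "i = nat ((x * b) mod int p)"
  have "int i = (x * b) mod int p" using p_pos by (simp add: i_def)
  then have "[int i * a = (x * b) * a] (mod int p)" by (simp add: cong_mult cong_refl)
  also have "[(x * b) * a = 1 * b] (mod int p)" using cong_mult[OF x cong_refl[of b]] by (simp add: ac_simps)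
  finally show ?thesis using that by simp
qed

text \<open>G = PK makes the natural map from cosets of P \<inter> K in K to cosets of P in G
  bijective.\<close>

lemma index_Int_normal:
  assumes P: "subgroup P G" and K: "K \<lhd> G" and GPK: "\<And>g. g \<in> carrier G \<Longrightarrow> \<exists>x\<in>P. g \<otimes> inv x \<in> K"
  shows "card K div card (P \<inter> K) = order G div card P"
proof -
  let ?D = "P \<inter> K"
  have sK: "subgroup K G" using K by (simp add: normal_imp_subgroup)
  have sD: "subgroup ?D G" by (rule subgroups_Inter_pair[OF P sK])
  have Kc: "\<And>k. k \<in> K \<Longrightarrow> k \<in> carrier G" using subgroup.mem_carrier[OF sK] .
  have Pc: "\<And>k. k \<in> P \<Longrightarrow> k \<in> carrier G" using subgroup.mem_carrier[OF P] .
  have pos: "card P > 0" "card ?D > 0"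
    using finite_subset[OF subgroup.subset fin] subgroup.one_closed P sD by (auto simp: card_gt_0_iff)
  have im: "(\<lambda>x. x <# P) ` carrier G = (\<lambda>x. x <# P) ` K"
  proof
    show "(\<lambda>x. x <# P) ` carrier G \<subseteq> (\<lambda>x. x <# P) ` K"
    proof
      fix c assume "c \<in> (\<lambda>x. x <# P) ` carrier G"
      then obtain g where g: "g \<in> carrier G" "c = g <# P" by auto
      obtain x where x: "x \<in> P" "g \<otimes> inv x \<in> K" using GPK g by auto
      have "g <# P = (g \<otimes> inv x) <# P"
        using l_coset_eq_iff[OF P g(1), of "g \<otimes> inv x"] g x Pc subgroup.m_inv_closed[OF P x(1)]
        by (simp add: inv_mult_cancel_left)
      then show "c \<in> (\<lambda>x. x <# P) ` K" using g x by blast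
    qed
  qed (use Kc in auto)
  have eq: "x <# ?D = y <# ?D \<longleftrightarrow> x <# P = y <# P" if "x \<in> K" "y \<in> K" for x y
    using that l_coset_eq_iff[OF sD, of x y] l_coset_eq_iff[OF P, of x y] Kc
      subgroup.m_closed[OF sK] subgroup.m_inv_closed[OF sK] by auto
  have "card ((\<lambda>x. x <# ?D) ` K) = card ((\<lambda>x. x <# P) ` K)"
  proof -
    define h where "h c = (SOME x. x \<in> K \<and> c = x <# ?D) <# P" for c
    have h: "h (x <# ?D) = x <# P" if "x \<in> K" for x
    proof -
      have "(SOME y. y \<in> K \<and> x <# ?D = y <# ?D) \<in> K \<and> x <# ?D = (SOME y. y \<in> K \<and> x <# ?D = y <# ?D) <# ?D"
        by (rule someI[of _ x]) (use that in blast)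
      then show ?thesis using eq that unfolding h_def by blast
    qed
    have "bij_betw h ((\<lambda>x. x <# ?D) ` K) ((\<lambda>x. x <# P) ` K)"
      unfolding bij_betw_def
    proof
      show "inj_on h ((\<lambda>x. x <# ?D) ` K)" using h eq by (auto simp: inj_on_def)
      show "h ` (\<lambda>x. x <# ?D) ` K = (\<lambda>x. x <# P) ` K" using h by (force simp: image_iff)
    qed
    then show ?thesis by (rule bij_betw_same_card)
  qed
  then show ?thesis
    using card_l_cosets[OF fin sD sK] card_l_cosets[OF fin P subgroup_self subgroup.subset[OF P]] im pos
    by (simp add: order_def)
qed

text \<open>The hypothesis on \<open>phom\<close> says that \<open>P \<inter> K\<close> lies in the Frattini subgroup of \<open>P\<close>, so this is a theorem
  of Tate. If \<open>D = P \<inter> K\<close> is nontrivial, the transfer to \<open>D\<close> of a \<open>P\<close>-invariant homomorphism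
  \<open>f : D \<rightarrow> \<int>/p\<close> extends a multiple of \<open>f\<close> to \<open>K\<close>: on \<open>D\<close> it differs from that multiple by
  the restriction of a homomorphism \<open>P \<rightarrow> \<int>/p\<close>. Its kernel is a smaller choice of \<open>K\<close>.\<close>

theorem tate_normal_p_complement:
  assumes P: "subgroup P G" "card P = p ^ n" "\<not> p dvd order G div card P"
    and K: "K \<lhd> G" and GPK: "\<And>g. g \<in> carrier G \<Longrightarrow> \<exists>x\<in>P. g \<otimes> inv x \<in> K"
    and Fr: "\<And>f x. phom p P f \<Longrightarrow> x \<in> P \<Longrightarrow> x \<in> K \<Longrightarrow> int p dvd f x"
  shows "\<exists>R. R \<lhd> G \<and> \<not> p dvd card R \<and> (\<forall>g\<in>carrier G. \<exists>x\<in>P. g \<otimes> inv x \<in> R)"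
  using K GPK Fr
proof (induction "card K" arbitrary: K rule: less_induct)
  case less
  note K = less.prems(1) and GPK = less.prems(2) and Fr = less.prems(3)
  have sK: "subgroup K G" using K by (simp add: normal_imp_subgroup)
  have Kc: "\<And>k. k \<in> K \<Longrightarrow> k \<in> carrier G" using subgroup.mem_carrier[OF sK] .
  have Pc: "\<And>k. k \<in> P \<Longrightarrow> k \<in> carrier G" using subgroup.mem_carrier[OF P(1)] .
  have Kn: "g \<otimes> k \<otimes> inv g \<in> K" if "g \<in> carrier G" "k \<in> K" for g k
    using K that by (auto simp: normal_inv_iff)
  have P1: "\<one> \<in> P" and K1: "\<one> \<in> K" using subgroup.one_closed P(1) sK by auto
  define D where "D = P \<inter> K"
  have sD: "subgroup D G" unfolding D_def by (rule subgroups_Inter_pair[OF P(1) sK])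
  show ?case
  proof (cases "D = {\<one>}")
    case True
    \<comment> \<open>An element r of order p in K would have a power r^e, with e prime to p,
      conjugate into P \<inter> K = 1.\<close>
    have "\<not> p dvd card K"
    proof
      assume "p dvd card K"
      then obtain r where r: "r \<in> K" "r \<noteq> \<one>" "r [^] p = \<one>" using order_p_element[OF sK] by blast
      obtain b e where b: "b \<in> carrier G" "[e = 1] (mod p)" "b \<otimes> r [^] (e::nat) \<otimes> inv b \<in> P"
        using p_element_conj[OF P Kc[OF r(1)]] by blast
      have rc: "r \<in> carrier G" using r Kc by auto
      have "b \<otimes> r [^] e \<otimes> inv b \<in> K" using Kn[OF b(1)] subgroup_nat_pow_closed[OF sK r(1)] by blast
      then have "b \<otimes> r [^] e \<otimes> inv b = \<one>" using b(3) True by (auto simp: D_def)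
      then have "b \<otimes> r [^] e = b" using b(1) rc by (metis inv_solve_right l_one m_closed nat_pow_closed one_closed)
      then have re: "r [^] e = \<one>" using b(1) rc by simp
      have "ord r dvd p" "ord r dvd e" using re r(3) pow_eq_id[OF rc] by auto
      moreover have "coprime e p" using b(2) by (metis cong_imp_coprime cong_sym coprime_1_left)
      ultimately have "ord r = 1" by (metis coprime_common_divisor_nat)
      then show False using ord_eq_1[OF rc] r(2) by simp
    qed
    then show ?thesis using K GPK by blast
  next
    case False
    have Dn: "y \<otimes> d \<otimes> inv y \<in> D" if "y \<in> P" "d \<in> D" for y d
      using that Kn Pc subgroup.m_closed[OF P(1)] subgroup.m_inv_closed[OF P(1)] by (auto simp: D_def)
    obtain f d where f: "phom p D f" "\<And>y d. y \<in> P \<Longrightarrow> d \<in> D \<Longrightarrow> [f (y \<otimes> d \<otimes> inv y) = f d] (mod int p)"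
      and d: "d \<in> D" "\<not> int p dvd f d"
      using p_group_invariant_phom[OF P(1,2) sD _ False Dn] D_def by blast
    have KnP: "s \<otimes> k \<otimes> inv s \<in> K" if "s \<in> P" "k \<in> K" for s k using Kn Pc that by blast
    have DK: "D \<subseteq> K" by (auto simp: D_def)
    obtain F :: "'a \<Rightarrow> 'a \<Rightarrow> int" where
      F: "\<And>g h s t. s \<in> P \<Longrightarrow> t \<in> P \<Longrightarrow> g \<in> carrier G \<Longrightarrow> h \<in> carrier G \<Longrightarrow>
       g \<otimes> inv s \<in> K \<Longrightarrow> h \<otimes> inv t \<in> K \<Longrightarrow> [F (g \<otimes> h) (s \<otimes> t) = F g s + F h t] (mod int p)"
      and F1: "\<And>d. d \<in> D \<Longrightarrow> d \<in> P \<Longrightarrow> [F \<one> d = - (int (card K div card D) * f d)] (mod int p)"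
    proof (rule transfer_hom[OF fin sD sK DK P(1), where q = p and f = f], goal_cases)
      case (5 F)
      show ?case by (rule 5(1)[OF 5(2,3)])
    qed (use Dn KnP f in auto)
    have index: "\<not> p dvd card K div card D"
      using index_Int_normal[OF P(1) K GPK] P(3) by (simp add: D_def)
    \<comment> \<open>The pairs (k, 1) give \<open>\<psi>\<close> on K; the pairs (x, x) give, in
      \<open>phP\<close>, a homomorphism on P, to which \<open>Fr\<close> applies.\<close>
    define \<psi> where "\<psi> k = F k \<one>" for k
    have ph: "phom p K \<psi>"
      unfolding phom_def \<psi>_def using F[OF P1 P1] Kc by simp
    have phP: "phom p P (\<lambda>x. F x x)"
      unfolding phom_def using F Pc K1 by simp
    have "\<not> int p dvd \<psi> d"
    proof
      have dP: "d \<in> P" "d \<in> K" "d \<in> carrier G" using d(1) Pc by (auto simp: D_def)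
      have idK: "inv d \<in> K" using subgroup.m_inv_closed[OF sK dP(2)] .
      assume a: "int p dvd \<psi> d"
      \<comment> \<open>(d, 1)(1, d) = (d, d), where F vanishes by \<open>Fr\<close>; so
        \<open>\<psi> d\<close> is minus the value at (1, d), which is a unit times f d.\<close>
      have "[F (d \<otimes> \<one>) (\<one> \<otimes> d) = F d \<one> + F \<one> d] (mod int p)"
        by (rule F) (use dP P1 idK in auto)
      moreover have "int p dvd F (d \<otimes> \<one>) (\<one> \<otimes> d)" using Fr[OF phP dP(1,2)] dP by simp
      ultimately have "int p dvd F \<one> d" using a unfolding \<psi>_def
        by (metis cong_dvd_iff dvd_add_right_iff)
      then have "int p dvd int (card K div card D) * f d" using cong_dvd_iff[OF F1[OF d(1) dP(1)]] by simp
      then show False using d(2) index prime_int_p by (simp add: prime_dvd_mult_iff int_dvd_int_iff)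
    qed
    note \<psi>d = this
    define N where "N = {k \<in> K. int p dvd \<psi> k}"
    have sN: "subgroup N G" unfolding N_def by (rule phom_kernel_subgroup[OF fin sK ph])
    \<comment> \<open>Among pairs, (x k x^-1, 1) is the conjugate of (k, 1) by (x, x).\<close>
    have \<psi>P: "[\<psi> (x \<otimes> k \<otimes> inv x) = \<psi> k] (mod int p)" if x: "x \<in> P" and k: "k \<in> K" for x k
    proof -
      have c: "x \<in> carrier G" "k \<in> carrier G" "inv x \<in> P" using x k Pc Kc subgroup.m_inv_closed[OF P(1)] by auto
      have "[F (x \<otimes> inv x) (x \<otimes> inv x) = F x x + F (inv x) (inv x)] (mod int p)"
        by (rule F) (use c x K1 in auto)
      then have 1: "[F \<one> \<one> = F x x + F (inv x) (inv x)] (mod int p)" using c by simp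
      have "[F (\<one> \<otimes> \<one>) (\<one> \<otimes> \<one>) = F \<one> \<one> + F \<one> \<one>] (mod int p)"
        by (rule F) (use P1 K1 in auto)
      then have "[F \<one> \<one> = 0] (mod int p)" by (simp add: cong_iff_dvd_diff)
      then have z: "[F x x + F (inv x) (inv x) = 0] (mod int p)" by (rule cong_trans[OF cong_sym[OF 1]])
      have "[F ((x \<otimes> k) \<otimes> inv x) ((x \<otimes> \<one>) \<otimes> inv x) = F (x \<otimes> k) (x \<otimes> \<one>) + F (inv x) (inv x)] (mod int p)"
        by (rule F) (use c x k Kn K1 in auto)
      also have "[F (x \<otimes> k) (x \<otimes> \<one>) + F (inv x) (inv x) = (F x x + F k \<one>) + F (inv x) (inv x)] (mod int p)"
        by (rule cong_add[OF F cong_refl]) (use c x k P1 K1 in auto)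
      also have "(F x x + F k \<one>) + F (inv x) (inv x) = F k \<one> + (F x x + F (inv x) (inv x))" by simp
      also have "[F k \<one> + (F x x + F (inv x) (inv x)) = F k \<one> + 0] (mod int p)"
        by (rule cong_add[OF cong_refl z])
      finally show ?thesis using c unfolding \<psi>_def by simp
    qed
    have "N \<lhd> G"
      unfolding normal_inv_iff
    proof (intro conjI ballI sN)
      fix g k assume g: "g \<in> carrier G" and k: "k \<in> N"
      then have kK: "k \<in> K" "int p dvd \<psi> k" by (auto simp: N_def)
      obtain x where x: "x \<in> P" "g \<otimes> inv x \<in> K" using GPK g by auto
      define u where "u = g \<otimes> inv x"
      have u: "u \<in> K" "u \<in> carrier G" "g = u \<otimes> x" using x g Pc by (auto simp: u_def m_assoc)
      have xk: "x \<otimes> k \<otimes> inv x \<in> K" using Kn Pc x kK by auto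
      have "g \<otimes> k \<otimes> inv g = u \<otimes> (x \<otimes> k \<otimes> inv x) \<otimes> inv u"
        using u x kK Kc Pc by (simp add: group_word_simps)
      moreover have "[\<psi> (u \<otimes> (x \<otimes> k \<otimes> inv x) \<otimes> inv u) = \<psi> k] (mod int p)"
        using phom_conj[OF sK ph u(1) xk] \<psi>P[OF x(1) kK(1)] by (rule cong_trans)
      ultimately show "g \<otimes> k \<otimes> inv g \<in> N"
        using Kn[OF g kK(1)] kK(2) by (simp add: N_def cong_dvd_iff)
    qed
    moreover have "card N < card K"
    proof (rule psubset_card_mono)
      show "finite K" using finite_subset[OF subgroup.subset[OF sK] fin] .
      show "N \<subset> K" using \<psi>d d(1) DK by (auto simp: N_def)
    qed
    moreover have "\<exists>x\<in>P. g \<otimes> inv x \<in> N" if g: "g \<in> carrier G" for g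
    proof -
      obtain x where x: "x \<in> P" "g \<otimes> inv x \<in> K" using GPK g by auto
      define u where "u = g \<otimes> inv x"
      have u: "u \<in> K" "u \<in> carrier G" "g = u \<otimes> x" using x g Pc by (auto simp: u_def m_assoc)
      have dP: "d \<in> P" "d \<in> K" "d \<in> carrier G" using d(1) Pc by (auto simp: D_def)
      \<comment> \<open>Since d lies in P, a power of it may be moved from the K-part of g to the
        P-part, which brings the K-part into N.\<close>
      obtain i :: nat where i: "[int i * \<psi> d = - \<psi> u] (mod int p)" using cong_solve_mod_p[OF \<psi>d] by blast
      have di: "d [^] i \<in> P" "d [^] i \<in> K" "d [^] i \<in> carrier G"
        using subgroup_nat_pow_closed P(1) sK dP by auto
      have "[\<psi> (u \<otimes> d [^] i) = \<psi> u + \<psi> (d [^] i)] (mod int p)" by (rule phom_mult[OF ph u(1) di(2)])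
      also have "[\<psi> u + \<psi> (d [^] i) = \<psi> u + - \<psi> u] (mod int p)"
        by (rule cong_add[OF cong_refl cong_trans[OF phom_pow[OF sK ph dP(2)] i]])
      finally have "u \<otimes> d [^] i \<in> N" using subgroup.m_closed[OF sK u(1) di(2)] by (simp add: N_def cong_0_iff)
      moreover have "u \<otimes> d [^] i = g \<otimes> inv (inv (d [^] i) \<otimes> x)"
        using u di x Pc by (simp add: group_word_simps)
      moreover have "inv (d [^] i) \<otimes> x \<in> P" using di x subgroup.m_closed[OF P(1)] subgroup.m_inv_closed[OF P(1)] by blast
      ultimately show ?thesis by auto
    qed
    moreover have "int p dvd h x" if "phom p P h" "x \<in> P" "x \<in> N" for h x
      using Fr[OF that(1,2)] that(3) by (auto simp: N_def)
    ultimately show ?thesis using less.hyps by blast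
  qed
qed

end

section \<open>Cocycles from supplements\<close>

context prime_group
begin

lemma fermat_int:
  assumes "\<not> int p dvd a" shows "[a ^ (p - 1) = 1] (mod int p)"
proof -
  define b where "b = nat (a mod int p)"
  have b: "int b = a mod int p" using p_pos by (simp add: b_def)
  then have ab: "[int b = a] (mod int p)" by (simp add: cong_def)
  then have "\<not> p dvd b" using assms by (metis cong_dvd_iff int_dvd_int_iff)
  then have "[int (b ^ (p - 1)) = int 1] (mod int p)"
    using fermat_theorem[OF prime_p] cong_int_iff by blast
  then show ?thesis using cong_pow[OF ab, of "p - 1"] by (metis cong_sym cong_trans of_nat_1 of_nat_power)
qed

lemma fermat_int_power: "[(a::int) ^ (p ^ n) = a] (mod int p)"
proof (induction n)
  case (Suc n)
  have *: "[b ^ p = b] (mod int p)" for b :: int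
  proof (cases "int p dvd b")
    case True
    moreover from this have "int p dvd b ^ p" using p_pos by (meson dvd_power dvd_trans)
    ultimately show ?thesis by (simp add: cong_def mod_eq_0_iff_dvd)
  next
    case False
    have "b ^ p = b * b ^ (p - 1)" using p_pos by (metis Suc_diff_1 power_Suc)
    then show ?thesis using cong_mult[OF cong_refl[of b] fermat_int[OF False]] by simp
  qed
  have "a ^ (p ^ Suc n) = (a ^ (p ^ n)) ^ p" by (metis power_Suc2 power_mult)
  then show ?case using *[of "a ^ (p ^ n)"] Suc cong_trans by metis
qed simp

text \<open>Integers stand for their residues mod \<open>p\<close>. A \<open>\<theta>\<close>-cocycle \<open>\<delta>\<close> is the translation part of an affine action
  \<open>g \<cdot> z = \<theta>(g) z + \<delta>(g)\<close> of \<open>G\<close> on \<open>\<int>/p\<close>; for \<open>\<theta> = 1\<close> it is a homomorphism.\<close>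

definition character :: "('a \<Rightarrow> int) \<Rightarrow> bool" where
  "character \<theta> \<longleftrightarrow> [\<theta> \<one> = 1] (mod int p) \<and>
     (\<forall>x\<in>carrier G. \<forall>y\<in>carrier G. [\<theta> (x \<otimes> y) = \<theta> x * \<theta> y] (mod int p))"

definition cocycle :: "('a \<Rightarrow> int) \<Rightarrow> ('a \<Rightarrow> int) \<Rightarrow> bool" where
  "cocycle \<theta> \<delta> \<longleftrightarrow> (\<forall>x\<in>carrier G. \<forall>y\<in>carrier G. [\<delta> (x \<otimes> y) = \<delta> x + \<theta> x * \<delta> y] (mod int p))"

lemma character_pow:
  assumes "character \<theta>" "x \<in> carrier G" shows "[\<theta> (x [^] (n::nat)) = \<theta> x ^ n] (mod int p)"
proof (induction n)
  case 0
  then show ?case using assms by (simp add: character_def)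
next
  case (Suc n)
  have "[\<theta> (x [^] n \<otimes> x) = \<theta> (x [^] n) * \<theta> x] (mod int p)" using assms by (simp add: character_def)
  also have "[\<theta> (x [^] n) * \<theta> x = \<theta> x ^ n * \<theta> x] (mod int p)" by (rule cong_mult[OF Suc cong_refl])
  finally show ?case by (simp add: mult.commute)
qed

lemma character_inv:
  assumes "character \<theta>" "x \<in> carrier G" shows "[\<theta> x * \<theta> (inv x) = 1] (mod int p)"
proof -
  have "[\<theta> (x \<otimes> inv x) = \<theta> x * \<theta> (inv x)] (mod int p)"
    using assms inv_closed unfolding character_def by blast
  moreover have "[\<theta> \<one> = 1] (mod int p)" using assms by (simp add: character_def)
  ultimately show ?thesis using assms by (metis cong_sym cong_trans r_inv)
qed

lemma character_nonzero:
  assumes "character \<theta>" "x \<in> carrier G" shows "\<not> int p dvd \<theta> x"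
proof
  assume "int p dvd \<theta> x"
  then have "int p dvd 1" using cong_dvd_iff[OF character_inv[OF assms]] by simp
  then show False using p_pos by simp
qed

text \<open>Raising to the power \<open>p^n\<close> fixes the residue of \<open>\<theta> x\<close>,
  but takes it to \<open>\<theta> \<one>\<close>.\<close>

lemma character_p_element:
  assumes "character \<theta>" "x \<in> carrier G" "x [^] (p ^ n) = \<one>" shows "[\<theta> x = 1] (mod int p)"
proof -
  have "[\<theta> x = \<theta> x ^ (p ^ n)] (mod int p)" using fermat_int_power by (rule cong_sym)
  also have "[\<theta> x ^ (p ^ n) = \<theta> (x [^] (p ^ n))] (mod int p)" using character_pow[OF assms(1,2)] by (rule cong_sym)
  also have "[\<theta> (x [^] (p ^ n)) = 1] (mod int p)" using assms by (simp add: character_def)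
  finally show ?thesis .
qed

lemma character_p_subgroup:
  assumes "character \<theta>" "subgroup P G" "card P = p ^ n" "x \<in> P" shows "[\<theta> x = 1] (mod int p)"
  using character_p_element[OF assms(1)] pow_card_subgroup[OF assms(2,4)] assms subgroup.mem_carrier by metis

lemma cocycle_phom:
  assumes "cocycle \<theta> \<delta>" "S \<subseteq> carrier G" "\<And>x. x \<in> S \<Longrightarrow> [\<theta> x = 1] (mod int p)"
  shows "phom p S \<delta>"
  unfolding phom_def
proof (intro ballI)
  fix x y assume xy: "x \<in> S" "y \<in> S"
  have "[\<delta> (x \<otimes> y) = \<delta> x + \<theta> x * \<delta> y] (mod int p)" using assms xy by (auto simp: cocycle_def)
  also have "[\<delta> x + \<theta> x * \<delta> y = \<delta> x + 1 * \<delta> y] (mod int p)"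
    using assms xy by (intro cong_add cong_mult) auto
  finally show "[\<delta> (x \<otimes> y) = \<delta> x + \<delta> y] (mod int p)" by simp
qed

lemma cocycle_one: assumes "character \<theta>" "cocycle \<theta> \<delta>" shows "int p dvd \<delta> \<one>"
proof -
  have "[\<delta> (\<one> \<otimes> \<one>) = \<delta> \<one> + \<theta> \<one> * \<delta> \<one>] (mod int p)" using assms unfolding cocycle_def by blast
  also have "[\<delta> \<one> + \<theta> \<one> * \<delta> \<one> = \<delta> \<one> + 1 * \<delta> \<one>] (mod int p)"
    using assms by (intro cong_add cong_mult) (auto simp: character_def)
  finally have "int p dvd \<delta> \<one> - (\<delta> \<one> + \<delta> \<one>)" by (simp add: cong_iff_dvd_diff)
  then show ?thesis by simp
qed

text \<open>Such a u acts as a translation, and conjugating a translation by an affine map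
  multiplies it by the slope.\<close>

lemma cocycle_conj:
  assumes \<theta>: "character \<theta>" and \<delta>: "cocycle \<theta> \<delta>" and g: "g \<in> carrier G" and u: "u \<in> carrier G" "[\<theta> u = 1] (mod int p)"
  shows "[\<delta> (g \<otimes> u \<otimes> inv g) = \<theta> g * \<delta> u] (mod int p)"
proof -
  have c: "\<And>x y. x \<in> carrier G \<Longrightarrow> y \<in> carrier G \<Longrightarrow> [\<delta> (x \<otimes> y) = \<delta> x + \<theta> x * \<delta> y] (mod int p)"
    using \<delta> by (simp add: cocycle_def)
  have "[\<theta> (g \<otimes> u) = \<theta> g * \<theta> u] (mod int p)" using \<theta> g u by (simp add: character_def)
  also have "[\<theta> g * \<theta> u = \<theta> g * 1] (mod int p)" by (rule cong_mult[OF cong_refl u(2)])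
  finally have t: "[\<theta> (g \<otimes> u) = \<theta> g] (mod int p)" by simp
  have z: "[\<delta> g + \<theta> g * \<delta> (inv g) = 0] (mod int p)"
    using c[of g "inv g"] cocycle_one[OF \<theta> \<delta>] g by (metis cong_0_iff cong_sym cong_trans inv_closed r_inv)
  have "[\<delta> (g \<otimes> u \<otimes> inv g) = \<delta> (g \<otimes> u) + \<theta> (g \<otimes> u) * \<delta> (inv g)] (mod int p)" using c g u by simp
  also have "[\<delta> (g \<otimes> u) + \<theta> (g \<otimes> u) * \<delta> (inv g) = (\<delta> g + \<theta> g * \<delta> u) + \<theta> g * \<delta> (inv g)] (mod int p)"
    using c[OF g u(1)] t by (intro cong_add cong_mult) auto
  also have "(\<delta> g + \<theta> g * \<delta> u) + \<theta> g * \<delta> (inv g) = \<theta> g * \<delta> u + (\<delta> g + \<theta> g * \<delta> (inv g))" by simp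
  also have "[\<theta> g * \<delta> u + (\<delta> g + \<theta> g * \<delta> (inv g)) = \<theta> g * \<delta> u + 0] (mod int p)"
    by (rule cong_add[OF cong_refl z])
  finally show ?thesis by simp
qed

text \<open>\<open>r g\<close> is an \<open>H\<close>-part of \<open>g \<in> G = HK\<close>. For a homomorphism \<open>f : H \<rightarrow> \<int>/p\<close>, the map \<open>g \<mapsto> f (r g)\<close>
  identifies the left cosets of \<open>ker f K\<close>, a subgroup of index \<open>p\<close>, with \<open>\<int>/p\<close>.\<close>

definition H_part :: "'a set \<Rightarrow> ('a \<Rightarrow> 'a) \<Rightarrow> bool" where
  "H_part H r \<longleftrightarrow> (\<forall>g\<in>carrier G. r g \<in> H) \<and>
    (\<forall>f. phom p H f \<longrightarrow>
      (\<forall>h\<in>H. [f (r h) = f h] (mod int p)) \<and>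
      (\<forall>h\<in>H. \<forall>g\<in>carrier G. [f (r (h \<otimes> g)) = f h + f (r g)] (mod int p)) \<and>
      (\<forall>g\<in>carrier G. \<forall>x\<in>carrier G. \<forall>y\<in>carrier G.
         [f (r x) = f (r y)] (mod int p) \<longrightarrow> [f (r (g \<otimes> x)) = f (r (g \<otimes> y))] (mod int p)))"

text \<open>Any element outside the kernel generates H together with it. This is how maximal
  subgroups in the definition of a supplement are reached from homomorphisms.\<close>

lemma phom_kernel_maximal:
  assumes H: "subgroup H G" and f: "phom p H f" and x: "x \<in> H" "\<not> int p dvd f x"
  shows "maximal_subgroup {h \<in> H. int p dvd f h} (G\<lparr>carrier := H\<rparr>)"
proof -
  let ?M = "{h \<in> H. int p dvd f h}"
  have M: "subgroup ?M G" by (rule phom_kernel_subgroup[OF fin H f])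
  have "L = H" if L: "subgroup L (G\<lparr>carrier := H\<rparr>)" "?M \<subset> L" for L
  proof
    have LG: "subgroup L G" by (rule incl_subgroup[OF H L(1)])
    show "L \<subseteq> H" using subgroup.subset[OF L(1)] by simp
    obtain l where l: "l \<in> L" "\<not> int p dvd f l" using L(2) \<open>L \<subseteq> H\<close> by blast
    show "H \<subseteq> L"
    proof
      fix h assume h: "h \<in> H"
      have lH: "l \<in> H" using l \<open>L \<subseteq> H\<close> by auto
      obtain i :: nat where i: "[int i * f l = - f h] (mod int p)" using cong_solve_mod_p[OF l(2)] by blast
      have li: "l [^] i \<in> L" "l [^] i \<in> H" using subgroup_nat_pow_closed LG l(1) H lH by auto
      have "[f (h \<otimes> l [^] i) = f h + f (l [^] i)] (mod int p)" by (rule phom_mult[OF f h li(2)])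
      also have "[f h + f (l [^] i) = f h + - f h] (mod int p)"
        by (rule cong_add[OF cong_refl cong_trans[OF phom_pow[OF H f lH] i]])
      finally have "h \<otimes> l [^] i \<in> ?M" using subgroup.m_closed[OF H h li(2)] by (simp add: cong_0_iff)
      then have "(h \<otimes> l [^] i) \<otimes> inv (l [^] i) \<in> L"
        using L(2) li subgroup.m_closed[OF LG] subgroup.m_inv_closed[OF LG] by blast
      then show "h \<in> L" using h li subgroup.mem_carrier[OF H] by (simp add: m_assoc)
    qed
  qed
  moreover have "subgroup ?M (G\<lparr>carrier := H\<rparr>)" by (rule subgroup_incl[OF M H]) auto
  ultimately show ?thesis using x unfolding maximal_subgroup_def by auto
qed

text \<open>Choose H-parts with respect to K arbitrarily. For nonzero f, the product of ker f and K
  is a proper subgroup meeting H in ker f, and its left cosets are the fibres of f (r g) mod p. The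
  choice does not involve f, so one r serves all f.\<close>

lemma M_supplemented_H_part:
  assumes H: "subgroup H G" and supp: "M_supplemented H G"
  obtains r where "H_part H r"
proof -
  obtain K where K: "subgroup K G" "carrier G = H <#> K"
    and T: "\<And>M. maximal_subgroup M (G\<lparr>carrier := H\<rparr>) \<Longrightarrow> subgroup (M <#> K) G \<and> M <#> K \<subset> carrier G"
    using supp unfolding M_supplemented_def by blast
  have Hc: "\<And>h. h \<in> H \<Longrightarrow> h \<in> carrier G" and Kc: "\<And>h. h \<in> K \<Longrightarrow> h \<in> carrier G"
    using subgroup.mem_carrier[OF H] subgroup.mem_carrier[OF K(1)] by auto
  have K1: "\<one> \<in> K" "\<one> \<in> H" using subgroup.one_closed K(1) H by auto
  define r where "r g = (SOME h. h \<in> H \<and> (\<exists>k\<in>K. g = h \<otimes> k))" for g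
  have r: "r g \<in> H" "\<exists>k\<in>K. g = r g \<otimes> k" if g: "g \<in> carrier G" for g
  proof -
    obtain h k where "h \<in> H" "k \<in> K" "g = h \<otimes> k" using g K(2) by (auto simp: set_mult_def)
    then have "\<exists>h. h \<in> H \<and> (\<exists>k\<in>K. g = h \<otimes> k)" by blast
    then have "r g \<in> H \<and> (\<exists>k\<in>K. g = r g \<otimes> k)" unfolding r_def by (rule someI_ex)
    then show "r g \<in> H" "\<exists>k\<in>K. g = r g \<otimes> k" by auto
  qed
  have main: "(\<forall>h\<in>H. [f (r h) = f h] (mod int p)) \<and>
      (\<forall>h\<in>H. \<forall>g\<in>carrier G. [f (r (h \<otimes> g)) = f h + f (r g)] (mod int p)) \<and>
      (\<forall>g\<in>carrier G. \<forall>x\<in>carrier G. \<forall>y\<in>carrier G.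
         [f (r x) = f (r y)] (mod int p) \<longrightarrow> [f (r (g \<otimes> x)) = f (r (g \<otimes> y))] (mod int p))"
    if f: "phom p H f" for f
  proof (cases "\<forall>h\<in>H. int p dvd f h")
    case True
    then have "int p dvd f (r g)" if "g \<in> carrier G" for g using r(1)[OF that] by blast
    then show ?thesis using True Hc by (auto simp: cong_def mod_eq_0_iff_dvd[THEN iffD2] mod_add_eq[symmetric] simp del: mod_add_eq)
  next
    case False
    then obtain x0 where x0: "x0 \<in> H" "\<not> int p dvd f x0" by blast
    define M where "M = {h \<in> H. int p dvd f h}"
    define TT where "TT = M <#> K"
    have TT: "subgroup TT G" "TT \<subset> carrier G"
      using T[OF phom_kernel_maximal[OF H f x0]] by (auto simp: TT_def M_def)
    have M1: "\<one> \<in> M" using K1 phom_one[OF H f] by (simp add: M_def cong_0_iff)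
    have MT: "M \<subseteq> TT"
    proof
      fix m assume "m \<in> M"
      then have "m = m \<otimes> \<one>" "m \<in> M" using Hc by (auto simp: M_def)
      then show "m \<in> TT" using K1 unfolding TT_def set_mult_def by blast
    qed
    have KT: "K \<subseteq> TT"
    proof
      fix m assume "m \<in> K"
      then have "m = \<one> \<otimes> m" "m \<in> K" using Kc by auto
      then show "m \<in> TT" using M1 unfolding TT_def set_mult_def by blast
    qed
    \<comment> \<open>Otherwise \<open>TT\<close> would contain all of H, by maximality of M, and K,
      hence all of G.\<close>
    have HT: "int p dvd f x" if x: "x \<in> H" "x \<in> TT" for x
    proof (rule ccontr)
      assume nx: "\<not> int p dvd f x"
      have "H \<subseteq> TT"
      proof
        fix h assume h: "h \<in> H"
        obtain i :: nat where i: "[int i * f x = - f h] (mod int p)" using cong_solve_mod_p[OF nx] by blast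
        have li: "x [^] i \<in> TT" "x [^] i \<in> H" using subgroup_nat_pow_closed TT(1) x H by auto
        have "[f (h \<otimes> x [^] i) = f h + f (x [^] i)] (mod int p)" by (rule phom_mult[OF f h li(2)])
        also have "[f h + f (x [^] i) = f h + - f h] (mod int p)"
          by (rule cong_add[OF cong_refl cong_trans[OF phom_pow[OF H f x(1)] i]])
        finally have "h \<otimes> x [^] i \<in> M" using subgroup.m_closed[OF H h li(2)] by (simp add: cong_0_iff M_def)
        then have "(h \<otimes> x [^] i) \<otimes> inv (x [^] i) \<in> TT"
          using MT li subgroup.m_closed[OF TT(1)] subgroup.m_inv_closed[OF TT(1)] by blast
        then show "h \<in> TT" using h li Hc by (simp add: m_assoc)
      qed
      then have "carrier G \<subseteq> TT" using KT subgroup.m_closed[OF TT(1)] K(2) by (auto simp: set_mult_def)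
      then show False using TT(2) by blast
    qed
    \<comment> \<open>The coordinate f (r x) is a complete invariant of the left coset of x modulo
      \<open>TT\<close>, so left multiplication acts on coordinates.\<close>
    have iff: "[f (r x) = f (r y)] (mod int p) \<longleftrightarrow> inv x \<otimes> y \<in> TT" if x: "x \<in> carrier G" and y: "y \<in> carrier G" for x y
    proof -
      obtain k where k: "k \<in> K" "x = r x \<otimes> k" using r[OF x] by blast
      obtain l where l: "l \<in> K" "y = r y \<otimes> l" using r[OF y] by blast
      have rr: "r x \<in> H" "r y \<in> H" "inv (r x) \<in> H" "inv (r x) \<otimes> r y \<in> H"
        using r x y subgroup.m_inv_closed[OF H] subgroup.m_closed[OF H] by auto
      have c: "r x \<in> carrier G" "r y \<in> carrier G" "k \<in> carrier G" "l \<in> carrier G" using rr k l Hc Kc by auto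
      have "[f (inv (r x) \<otimes> r y) = f (inv (r x)) + f (r y)] (mod int p)" by (rule phom_mult[OF f rr(3,2)])
      also have "[f (inv (r x)) + f (r y) = - f (r x) + f (r y)] (mod int p)"
        by (rule cong_add[OF phom_inv[OF H f rr(1)] cong_refl])
      finally have "[f (inv (r x) \<otimes> r y) = - f (r x) + f (r y)] (mod int p)" .
      then have "int p dvd f (inv (r x) \<otimes> r y) \<longleftrightarrow> int p dvd f (r y) - f (r x)"
        by (simp add: cong_dvd_iff)
      then have "[f (r x) = f (r y)] (mod int p) \<longleftrightarrow> int p dvd f (inv (r x) \<otimes> r y)"
        by (simp add: cong_iff_dvd_diff dvd_diff_commute)
      also have "\<dots> \<longleftrightarrow> inv (r x) \<otimes> r y \<in> TT" using HT rr MT by (auto simp: M_def)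
      also have "\<dots> \<longleftrightarrow> inv x \<otimes> y \<in> TT"
      proof
        have xy: "inv x = inv k \<otimes> inv (r x)" using k(2) c by (metis inv_mult_group)
        have e: "inv x \<otimes> y = inv k \<otimes> (inv (r x) \<otimes> r y) \<otimes> l"
        proof -
          have "inv x \<otimes> y = inv k \<otimes> inv (r x) \<otimes> (r y \<otimes> l)" using xy l(2) by simp
          then show ?thesis using c by (simp add: m_assoc)
        qed
        have kl: "k \<in> TT" "l \<in> TT" "inv k \<in> TT" "inv l \<in> TT"
          using k l KT subgroup.m_inv_closed[OF TT(1)] by auto
        show "inv (r x) \<otimes> r y \<in> TT \<Longrightarrow> inv x \<otimes> y \<in> TT" using e kl subgroup.m_closed[OF TT(1)] by simp
        assume "inv x \<otimes> y \<in> TT"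
        then have "k \<otimes> (inv x \<otimes> y) \<otimes> inv l \<in> TT" using kl subgroup.m_closed[OF TT(1)] by simp
        then show "inv (r x) \<otimes> r y \<in> TT" unfolding e using c by (simp add: group_word_simps)
      qed
      finally show ?thesis .
    qed
    have W: "[f (r (h \<otimes> t)) = f h] (mod int p)" if h: "h \<in> H" and t: "t \<in> TT" for h t
    proof -
      have tc: "t \<in> carrier G" "h \<in> carrier G" using t h TT(2) Hc by auto
      obtain k where k: "k \<in> K" "h \<otimes> t = r (h \<otimes> t) \<otimes> k" using r[of "h \<otimes> t"] tc by auto
      define x where "x = r (h \<otimes> t)"
      have x: "x \<in> H" "x \<in> carrier G" using r(1)[of "h \<otimes> t"] tc Hc by (auto simp: x_def)
      have kc: "k \<in> carrier G" using k Kc by auto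
      have "inv h \<otimes> x = t \<otimes> inv k"
      proof -
        have "x = h \<otimes> t \<otimes> inv k" using k(2) x tc kc unfolding x_def[symmetric] by (simp add: inv_solve_right)
        then show ?thesis using tc kc by (simp add: group_word_simps)
      qed
      also have "\<dots> \<in> TT" using t k KT subgroup.m_closed[OF TT(1)] subgroup.m_inv_closed[OF TT(1)] by blast
      finally have tt: "inv h \<otimes> x \<in> TT" .
      have hx: "inv h \<in> H" "inv h \<otimes> x \<in> H" using h x subgroup.m_closed[OF H] subgroup.m_inv_closed[OF H] by auto
      have "[0 = f (inv h \<otimes> x)] (mod int p)" using HT[OF hx(2) tt] by (simp add: cong_iff_dvd_diff)
      also have "[f (inv h \<otimes> x) = f (inv h) + f x] (mod int p)" by (rule phom_mult[OF f hx(1) x(1)])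
      also have "[f (inv h) + f x = - f h + f x] (mod int p)" by (rule cong_add[OF phom_inv[OF H f h] cong_refl])
      finally show ?thesis unfolding x_def by (simp add: cong_iff_dvd_diff dvd_diff_commute)
    qed
    have W': "[f (r h) = f h] (mod int p)" if "h \<in> H" for h
      using W[OF that subgroup.one_closed[OF TT(1)]] that Hc by simp
    have B: "[f (r (h \<otimes> g)) = f h + f (r g)] (mod int p)" if h: "h \<in> H" and g: "g \<in> carrier G" for h g
    proof -
      obtain k where k: "k \<in> K" "g = r g \<otimes> k" using r[OF g] by blast
      have rg: "r g \<in> H" using r(1)[OF g] .
      have "h \<otimes> g = (h \<otimes> r g) \<otimes> k" using k h rg Hc Kc by (metis m_assoc)
      then have "[f (r (h \<otimes> g)) = f (h \<otimes> r g)] (mod int p)"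
        using W[OF subgroup.m_closed[OF H h rg], of k] k KT by auto
      also have "[f (h \<otimes> r g) = f h + f (r g)] (mod int p)" by (rule phom_mult[OF f h rg])
      finally show ?thesis .
    qed
    have C: "[f (r (g \<otimes> x)) = f (r (g \<otimes> y))] (mod int p)"
      if "g \<in> carrier G" "x \<in> carrier G" "y \<in> carrier G" "[f (r x) = f (r y)] (mod int p)" for g x y
      using that iff[of x y] iff[of "g \<otimes> x" "g \<otimes> y"] by (simp add: group_word_simps)
    show ?thesis using W' B C by blast
  qed
  show ?thesis by (rule that[of r]) (use r(1) main in \<open>auto simp: H_part_def\<close>)
qed

text \<open>The common zeros in \<open>H\<close> of the \<open>\<theta>\<close>-cocycles lie in the Frattini subgroup of \<open>H\<close>, when \<open>H\<close> is a
  \<open>p\<close>-group.\<close>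

definition detects :: "('a \<Rightarrow> int) \<Rightarrow> 'a set \<Rightarrow> bool" where
  "detects \<theta> H \<longleftrightarrow> (\<forall>h\<in>H. (\<forall>\<delta>. cocycle \<theta> \<delta> \<longrightarrow> int p dvd \<delta> h) \<longrightarrow> (\<forall>f. phom p H f \<longrightarrow> int p dvd f h))"

section \<open>Affine actions and their slopes\<close>

lemma H_part_mem: "H_part H r \<Longrightarrow> g \<in> carrier G \<Longrightarrow> r g \<in> H"
  by (simp add: H_part_def)

lemma H_part_self: "H_part H r \<Longrightarrow> phom p H f \<Longrightarrow> h \<in> H \<Longrightarrow> [f (r h) = f h] (mod int p)"
  by (simp add: H_part_def)

lemma H_part_left_mult:
  "H_part H r \<Longrightarrow> phom p H f \<Longrightarrow> h \<in> H \<Longrightarrow> g \<in> carrier G \<Longrightarrow> [f (r (h \<otimes> g)) = f h + f (r g)] (mod int p)"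
  by (simp add: H_part_def)

lemma H_part_action:
  "H_part H r \<Longrightarrow> phom p H f \<Longrightarrow> g \<in> carrier G \<Longrightarrow> x \<in> carrier G \<Longrightarrow> y \<in> carrier G \<Longrightarrow>
   [f (r x) = f (r y)] (mod int p) \<Longrightarrow> [f (r (g \<otimes> x)) = f (r (g \<otimes> y))] (mod int p)"
  by (simp add: H_part_def)

lemma H_part_action_H:
  assumes "H_part H r" "phom p H f" "subgroup H G" "g \<in> carrier G" "x \<in> H" "y \<in> H" "[f x = f y] (mod int p)"
  shows "[f (r (g \<otimes> x)) = f (r (g \<otimes> y))] (mod int p)"
proof (rule H_part_action[OF assms(1,2,4)])
  show "x \<in> carrier G" "y \<in> carrier G" using assms subgroup.mem_carrier by metis+
  show "[f (r x) = f (r y)] (mod int p)"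
    using H_part_self[OF assms(1,2,5)] H_part_self[OF assms(1,2,6)] assms(7) by (metis cong_sym cong_trans)
qed

lemma H_part_mult_right:
  assumes "H_part H r" "phom p H f" "subgroup H G" "g \<in> carrier G" "g' \<in> carrier G"
  shows "[f (r (g \<otimes> g')) = f (r (g \<otimes> r g'))] (mod int p)"
proof (rule H_part_action[OF assms(1,2,4,5)])
  show "r g' \<in> carrier G" using H_part_mem[OF assms(1,5)] subgroup.mem_carrier[OF assms(3)] by simp
  show "[f (r g') = f (r (r g'))] (mod int p)"
    using H_part_self[OF assms(1,2) H_part_mem[OF assms(1,5)]] by (rule cong_sym)
qed

text \<open>If \<open>\<sigma>\<^sub>f\<close> is the permutation of \<open>\<int>/p\<close> induced by \<open>g\<close> through \<open>f\<close>, normalized by \<open>\<sigma>\<^sub>f 0 = 0\<close>, then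
  \<open>\<sigma>\<^bsub>f+f'\<^esub> (a + b) = \<sigma>\<^sub>f a + \<sigma>\<^bsub>f'\<^esub> b\<close>, which forces all three to be the same linear map.\<close>

lemma H_part_linear:
  assumes H: "subgroup H G" and r: "H_part H r" and f: "phom p H f" and f': "phom p H f'"
    and x: "x \<in> H" "[f x = 1] (mod int p)" "[f' x = 0] (mod int p)"
    and y: "y \<in> H" "[f y = 0] (mod int p)" "[f' y = 1] (mod int p)"
    and g: "g \<in> carrier G" and h: "h \<in> H"
  shows "[f (r (g \<otimes> h)) = f (r g) + (f (r (g \<otimes> x)) - f (r g)) * f h] (mod int p)"
    and "[f' (r (g \<otimes> h)) = f' (r g) + (f (r (g \<otimes> x)) - f (r g)) * f' h] (mod int p)"
proof -
  have xp: "x [^] n \<in> H" "y [^] n \<in> H" for n :: nat using subgroup_nat_pow_closed[OF H] x y by auto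
  have xy: "x [^] a \<otimes> y [^] b \<in> H" for a b :: nat using xp subgroup.m_closed[OF H] by blast
  have fx: "[f (x [^] n) = int n] (mod int p)" "[f' (x [^] n) = 0] (mod int p)" for n :: nat
    using cong_trans[OF phom_pow[OF H f x(1), of n] cong_mult[OF cong_refl x(2)]]
      cong_trans[OF phom_pow[OF H f' x(1), of n] cong_mult[OF cong_refl x(3)]] by auto
  have fy: "[f (y [^] n) = 0] (mod int p)" "[f' (y [^] n) = int n] (mod int p)" for n :: nat
    using cong_trans[OF phom_pow[OF H f y(1), of n] cong_mult[OF cong_refl y(2)]]
      cong_trans[OF phom_pow[OF H f' y(1), of n] cong_mult[OF cong_refl y(3)]] by auto
  have fxy: "[f (x [^] a \<otimes> y [^] b) = int a] (mod int p)" "[f' (x [^] a \<otimes> y [^] b) = int b] (mod int p)" for a b :: nat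
    using cong_trans[OF phom_mult[OF f xp(1)[of a] xp(2)[of b]] cong_add[OF fx(1) fy(1)]]
      cong_trans[OF phom_mult[OF f' xp(1)[of a] xp(2)[of b]] cong_add[OF fx(2) fy(2)]] by auto
  define A where "A n = f (r (g \<otimes> x [^] n))" for n :: nat
  define B where "B n = f' (r (g \<otimes> y [^] n))" for n :: nat
  define s where "s = (\<lambda>h. 1 * f h + 1 * f' h)"
  have s: "phom p H s" unfolding s_def by (rule phom_lincomb[OF f f'])
  have fA: "[f (r (g \<otimes> h)) = A a] (mod int p)" if "h \<in> H" "[f h = int a] (mod int p)" for h a
    unfolding A_def using that xp fx(1)[of a] by (intro H_part_action_H[OF r f H g]) (auto intro: cong_trans cong_sym)
  have fB: "[f' (r (g \<otimes> h)) = B b] (mod int p)" if "h \<in> H" "[f' h = int b] (mod int p)" for h b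
    unfolding B_def using that xp fy(2)[of b] by (intro H_part_action_H[OF r f' H g]) (auto intro: cong_trans cong_sym)
  have AB: "[s (r (g \<otimes> (x [^] a \<otimes> y [^] b))) = A a + B b] (mod int p)" for a b :: nat
    using cong_add[OF fA[OF xy fxy(1)] fB[OF xy fxy(2)]] by (simp add: s_def)
  \<comment> \<open>The value of s at \<open>x^a y^b\<close> is a + b, and the action through s
    respects it; so A a + B b depends on a + b only.\<close>
  have sum: "[A a + B b = A c + B d] (mod int p)" if "a + b = c + d" for a b c d :: nat
  proof -
    have sxy: "[s (x [^] a \<otimes> y [^] b) = int (a + b)] (mod int p)" for a b :: nat
      using cong_add[OF fxy] by (simp add: s_def)
    have "[s (x [^] a \<otimes> y [^] b) = s (x [^] c \<otimes> y [^] d)] (mod int p)"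
      using sxy[of a b] sxy[of c d] that by (metis cong_sym cong_trans)
    then have "[s (r (g \<otimes> (x [^] a \<otimes> y [^] b))) = s (r (g \<otimes> (x [^] c \<otimes> y [^] d)))] (mod int p)"
      by (rule H_part_action_H[OF r s H g xy xy])
    then show ?thesis using AB by (metis cong_sym cong_trans)
  qed
  \<comment> \<open>Comparing pairs with equal sums shows that A and B share one constant
    increment.\<close>
  have step: "[A (Suc n) - A n = A 1 - A 0] (mod int p)" "[B (Suc n) - B n = A 1 - A 0] (mod int p)" for n
  proof -
    have 1: "[A (Suc n) + B 0 = A n + B 1] (mod int p)" by (rule sum) simp
    have 2: "[A 1 + B n = A 0 + B (Suc n)] (mod int p)" by (rule sum) simp
    have 3: "[A 1 + B 0 = A 0 + B 1] (mod int p)" by (rule sum) simp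
    show "[A (Suc n) - A n = A 1 - A 0] (mod int p)"
      using cong_diff[OF 1 3] by (simp add: cong_iff_dvd_diff algebra_simps)
    show "[B (Suc n) - B n = A 1 - A 0] (mod int p)"
      using cong_sym[OF 2] by (simp add: cong_iff_dvd_diff algebra_simps)
  qed
  have lin: "[A n = A 0 + (A 1 - A 0) * int n] (mod int p)" "[B n = B 0 + (A 1 - A 0) * int n] (mod int p)" for n
  proof (induction n)
    case (Suc n)
    { case 1 show ?case using cong_add[OF Suc(1) step(1)[of n]] by (simp add: algebra_simps) }
    { case 2 show ?case using cong_add[OF Suc(2) step(2)[of n]] by (simp add: algebra_simps) }
  qed auto
  have rep: "\<exists>n::nat. [c = int n] (mod int p)" for c :: int
    using p_pos by (intro exI[of _ "nat (c mod int p)"]) (simp add: cong_def)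
  have gc: "g \<otimes> x [^] (0::nat) = g" "g \<otimes> y [^] (0::nat) = g" "g \<otimes> x [^] (1::nat) = g \<otimes> x"
    using g x(1) subgroup.mem_carrier[OF H] by auto
  have A01: "A 0 = f (r g)" "A 1 = f (r (g \<otimes> x))" "B 0 = f' (r g)" unfolding A_def B_def using gc by auto
  obtain a where a: "[f h = int a] (mod int p)" using rep by blast
  obtain b where b: "[f' h = int b] (mod int p)" using rep by blast
  have "[f (r (g \<otimes> h)) = A 0 + (A 1 - A 0) * int a] (mod int p)" using fA[OF h a] lin(1) cong_trans by blast
  also have "[A 0 + (A 1 - A 0) * int a = A 0 + (A 1 - A 0) * f h] (mod int p)"
    using a by (intro cong_add cong_mult cong_refl) (rule cong_sym)
  finally show "[f (r (g \<otimes> h)) = f (r g) + (f (r (g \<otimes> x)) - f (r g)) * f h] (mod int p)" unfolding A01 .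
  have "[f' (r (g \<otimes> h)) = B 0 + (A 1 - A 0) * int b] (mod int p)" using fB[OF h b] lin(2) cong_trans by blast
  also have "[B 0 + (A 1 - A 0) * int b = B 0 + (A 1 - A 0) * f' h] (mod int p)"
    using b by (intro cong_add cong_mult cong_refl) (rule cong_sym)
  finally show "[f' (r (g \<otimes> h)) = f' (r g) + (f (r (g \<otimes> x)) - f (r g)) * f' h] (mod int p)" unfolding A01 .
qed

text \<open>In the coordinate f, the image of 0 under g is f (r g), the translation part of an
  affine map.\<close>

lemma H_part_cocycle:
  assumes H: "subgroup H G" and r: "H_part H r" and f: "phom p H f"
    and lin: "\<And>g h. g \<in> carrier G \<Longrightarrow> h \<in> H \<Longrightarrow> [f (r (g \<otimes> h)) = f (r g) + \<theta> g * f h] (mod int p)"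
  shows "cocycle \<theta> (\<lambda>g. f (r g))"
  unfolding cocycle_def
proof (intro ballI)
  fix g g' assume g: "g \<in> carrier G" "g' \<in> carrier G"
  show "[f (r (g \<otimes> g')) = f (r g) + \<theta> g * f (r g')] (mod int p)"
    using H_part_mult_right[OF r f H g] lin[OF g(1) H_part_mem[OF r g(2)]] by (rule cong_trans)
qed

text \<open>The slope of g is the image of 1 minus the image of 0, with x representing the point 1;
  the cocycle rule then makes slopes multiplicative.\<close>

lemma H_part_character:
  assumes H: "subgroup H G" and r: "H_part H r" and f: "phom p H f"
    and x: "x \<in> H" "[f x = 1] (mod int p)"
    and lin: "\<And>g h. g \<in> carrier G \<Longrightarrow> h \<in> H \<Longrightarrow> [f (r (g \<otimes> h)) = f (r g) + \<theta> g * f h] (mod int p)"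
  shows "character \<theta>"
  unfolding character_def
proof (intro conjI ballI)
  have xc: "x \<in> carrier G" using x(1) subgroup.mem_carrier[OF H] by auto
  have coc: "[f (r (g \<otimes> g')) = f (r g) + \<theta> g * f (r g')] (mod int p)"
    if "g \<in> carrier G" "g' \<in> carrier G" for g g'
    using H_part_cocycle[OF H r f lin] that unfolding cocycle_def by blast
  have tx: "[\<theta> g = f (r (g \<otimes> x)) - f (r g)] (mod int p)" if g: "g \<in> carrier G" for g
  proof -
    have "[f (r g) + \<theta> g * f x = f (r g) + \<theta> g * 1] (mod int p)"
      by (intro cong_add cong_mult cong_refl x(2))
    then have "[f (r (g \<otimes> x)) = f (r g) + \<theta> g] (mod int p)" using cong_trans[OF lin[OF g x(1)]] by simp
    then show ?thesis using cong_sym by (fastforce simp: cong_iff_dvd_diff algebra_simps)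
  qed
  have "[\<theta> \<one> = f (r x) - f (r \<one>)] (mod int p)" using tx[OF one_closed] xc by simp
  also have "[f (r x) - f (r \<one>) = 1 - 0] (mod int p)"
    using cong_trans[OF H_part_self[OF r f x(1)] x(2)]
      cong_trans[OF H_part_self[OF r f subgroup.one_closed[OF H]] phom_one[OF H f]] by (rule cong_diff)
  finally show "[\<theta> \<one> = 1] (mod int p)" by simp
  fix g g' assume g: "g \<in> carrier G" "g' \<in> carrier G"
  have "[\<theta> (g \<otimes> g') = f (r (g \<otimes> (g' \<otimes> x))) - f (r (g \<otimes> g'))] (mod int p)"
    using tx[of "g \<otimes> g'"] g xc by (simp add: m_assoc)
  also have "[f (r (g \<otimes> (g' \<otimes> x))) - f (r (g \<otimes> g'))
    = (f (r g) + \<theta> g * f (r (g' \<otimes> x))) - (f (r g) + \<theta> g * f (r g'))] (mod int p)"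
    using g xc by (intro cong_diff coc) auto
  also have "(f (r g) + \<theta> g * f (r (g' \<otimes> x))) - (f (r g) + \<theta> g * f (r g')) = \<theta> g * (f (r (g' \<otimes> x)) - f (r g'))"
    by (simp add: algebra_simps)
  also have "[\<theta> g * (f (r (g' \<otimes> x)) - f (r g')) = \<theta> g * \<theta> g'] (mod int p)"
    using tx[OF g(2)] by (intro cong_mult cong_refl) (rule cong_sym)
  finally show "[\<theta> (g \<otimes> g') = \<theta> g * \<theta> g'] (mod int p)" .
qed

text \<open>The function \<open>f'\<close> may depend on h. Linearity turns g -> f' (r g) into a
  cocycle that agrees with \<open>f'\<close> on H mod p, so it is nonzero at h.\<close>

lemma detectsI:
  assumes H: "subgroup H G" and r: "H_part H r"
    and ex: "\<And>h f. h \<in> H \<Longrightarrow> phom p H f \<Longrightarrow> \<not> int p dvd f h \<Longrightarrow>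
      \<exists>f'. phom p H f' \<and> \<not> int p dvd f' h \<and>
        (\<forall>g\<in>carrier G. \<forall>h\<in>H. [f' (r (g \<otimes> h)) = f' (r g) + \<theta> g * f' h] (mod int p))"
  shows "detects \<theta> H"
  unfolding detects_def
proof (intro ballI impI allI)
  fix h f assume h: "h \<in> H" and 0: "\<forall>\<delta>. cocycle \<theta> \<delta> \<longrightarrow> int p dvd \<delta> h" and f: "phom p H f"
  show "int p dvd f h"
  proof (rule ccontr)
    assume "\<not> int p dvd f h"
    then obtain f' where f': "phom p H f'" "\<not> int p dvd f' h"
      "\<And>g h. g \<in> carrier G \<Longrightarrow> h \<in> H \<Longrightarrow> [f' (r (g \<otimes> h)) = f' (r g) + \<theta> g * f' h] (mod int p)"
      using ex[OF h f] by blast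
    have "int p dvd f' (r h)" using 0 H_part_cocycle[OF H r f'(1,3)] by blast
    then show False using f'(2) cong_dvd_iff[OF H_part_self[OF r f'(1) h]] by blast
  qed
qed

lemma phom_scale:
  assumes "phom p S f" "\<not> int p dvd f u"
  obtains c where "phom p S (\<lambda>h. c * f h)" "[c * f u = 1] (mod int p)"
proof -
  obtain i :: nat where "[int i * f u = 1] (mod int p)" using cong_solve_mod_p[OF assms(2)] by blast
  moreover have "phom p S (\<lambda>h. int i * f h)" using phom_lincomb[OF assms(1) assms(1), of "int i" 0] by simp
  ultimately show ?thesis using that by blast
qed

text \<open>Rescaled to be dual to u, v, the two homomorphisms define \<open>\<theta>\<close>
  through \<open>H_part_linear\<close>. An h at which both vanish is handled by pairing the first
  with a homomorphism nonzero at h: the shared member forces the same slope.\<close>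

lemma noncyclic_detects:
  assumes H: "subgroup H G" and supp: "M_supplemented H G"
    and f1: "phom p H f1" and f2: "phom p H f2"
    and u: "u \<in> H" "\<not> int p dvd f1 u" "int p dvd f2 u"
    and v: "v \<in> H" "int p dvd f1 v" "\<not> int p dvd f2 v"
  obtains \<theta> where "character \<theta>" "detects \<theta> H"
proof -
  obtain r where r: "H_part H r" using M_supplemented_H_part[OF H supp] by blast
  obtain c1 where c1: "phom p H (\<lambda>h. c1 * f1 h)" "[c1 * f1 u = 1] (mod int p)" using phom_scale[OF f1 u(2)] by blast
  obtain c2 where c2: "phom p H (\<lambda>h. c2 * f2 h)" "[c2 * f2 v = 1] (mod int p)" using phom_scale[OF f2 v(3)] by blast
  define k1 k2 where "k1 = (\<lambda>h. c1 * f1 h)" and "k2 = (\<lambda>h. c2 * f2 h)"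
  have k: "phom p H k1" "phom p H k2" "[k1 u = 1] (mod int p)" "[k2 u = 0] (mod int p)"
    "[k1 v = 0] (mod int p)" "[k2 v = 1] (mod int p)"
    using c1 c2 u(3) v(2) by (auto simp: k1_def k2_def cong_0_iff)
  define \<theta> where "\<theta> g = k1 (r (g \<otimes> u)) - k1 (r g)" for g
  have lin: "[k1 (r (g \<otimes> h)) = k1 (r g) + \<theta> g * k1 h] (mod int p)"
    "[k2 (r (g \<otimes> h)) = k2 (r g) + \<theta> g * k2 h] (mod int p)"
    if "g \<in> carrier G" "h \<in> H" for g h
    unfolding \<theta>_def using H_part_linear[OF H r k(1,2) u(1) k(3,4) v(1) k(5,6) that] by auto
  have ch: "character \<theta>" by (rule H_part_character[OF H r k(1) u(1) k(3) lin(1)])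
  have "detects \<theta> H"
  proof (rule detectsI[OF H r])
    fix h f assume h: "h \<in> H" and f: "phom p H f" "\<not> int p dvd f h"
    show "\<exists>f'. phom p H f' \<and> \<not> int p dvd f' h \<and>
        (\<forall>g\<in>carrier G. \<forall>h\<in>H. [f' (r (g \<otimes> h)) = f' (r g) + \<theta> g * f' h] (mod int p))"
    proof (cases "int p dvd k1 h \<and> int p dvd k2 h")
      case False
      then show ?thesis using k lin by blast
    next
      case True
      obtain c where c: "phom p H (\<lambda>h. c * f h)" "[c * f h = 1] (mod int p)" using phom_scale[OF f] by blast
      define e where "e = (\<lambda>h. c * f h)"
      have e: "phom p H e" "[e h = 1] (mod int p)" using c by (auto simp: e_def)
      \<comment> \<open>As k1 h = 0, correcting u to w = u h^i makes w, h dual to k1, e.\<close>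
      obtain i :: nat where i: "[int i * e h = - e u] (mod int p)"
        using cong_solve_mod_p[of "e h" "- e u"] e(2) cong_dvd_iff[OF e(2)] p_pos by auto
      define w where "w = u \<otimes> h [^] i"
      have hi: "h [^] i \<in> H" using subgroup_nat_pow_closed[OF H h] .
      have w: "w \<in> H" using subgroup.m_closed[OF H u(1) hi] by (simp add: w_def)
      have "[e w = e u + - e u] (mod int p)" unfolding w_def
        by (rule cong_trans[OF phom_mult[OF e(1) u(1) hi] cong_add[OF cong_refl cong_trans[OF phom_pow[OF H e(1) h] i]]])
      then have ew: "[e w = 0] (mod int p)" by simp
      have k1h: "[k1 h = 0] (mod int p)" using True by (simp add: cong_0_iff)
      have "[k1 w = 1 + int i * 0] (mod int p)" unfolding w_def
        by (rule cong_trans[OF phom_mult[OF k(1) u(1) hi] cong_add[OF k(3) cong_trans[OF phom_pow[OF H k(1) h] cong_mult[OF cong_refl k1h]]]])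
      then have k1w: "[k1 w = 1] (mod int p)" by simp
      have "[e (r (g \<otimes> h')) = e (r g) + \<theta> g * e h'] (mod int p)" if g: "g \<in> carrier G" and h': "h' \<in> H" for g h'
      proof -
        \<comment> \<open>The slope attached to the pair (k1, e). It is also the slope of
          \<open>k1\<close> alone, hence congruent to \<open>\<theta> g\<close>.\<close>
        define t where "t = k1 (r (g \<otimes> w)) - k1 (r g)"
        have "[k1 (r (g \<otimes> w)) = k1 (r g) + \<theta> g * 1] (mod int p)"
          by (rule cong_trans[OF lin(1)[OF g w] cong_add[OF cong_refl cong_mult[OF cong_refl k1w]]])
        then have "[k1 (r (g \<otimes> w)) - k1 (r g) = k1 (r g) + \<theta> g * 1 - k1 (r g)] (mod int p)"
          by (rule cong_diff[OF _ cong_refl])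
        then have t: "[t = \<theta> g] (mod int p)" by (simp add: t_def)
        have "[e (r (g \<otimes> h')) = e (r g) + t * e h'] (mod int p)"
          unfolding t_def by (rule H_part_linear(2)[OF H r k(1) e(1) w k1w ew h k1h e(2) g h'])
        also have "[e (r g) + t * e h' = e (r g) + \<theta> g * e h'] (mod int p)"
          by (rule cong_add[OF cong_refl cong_mult[OF t cong_refl]])
        finally show ?thesis .
      qed
      moreover have "\<not> int p dvd e h" using cong_dvd_iff[OF e(2)] p_pos by simp
      ultimately show ?thesis using e(1) by blast
    qed
  qed
  then show ?thesis using that ch by blast
qed

text \<open>Every permutation of two points is a translation, so slope 1 serves for all f.\<close>

lemma two_detects:
  assumes H: "subgroup H G" and supp: "M_supplemented H G" and p2: "p = 2"
  shows "detects (\<lambda>_. 1) H"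
proof -
  obtain r where r: "H_part H r" using M_supplemented_H_part[OF H supp] by blast
  show ?thesis
  proof (rule detectsI[OF H r])
    fix h f assume h: "h \<in> H" and f: "phom p H f" "\<not> int p dvd f h"
    have "[f (r (g \<otimes> h')) = f (r g) + 1 * f h'] (mod int p)" if g: "g \<in> carrier G" and h': "h' \<in> H" for g h'
    proof -
      have hc: "h' \<in> carrier G" using h' subgroup.mem_carrier[OF H] by auto
      \<comment> \<open>The action is injective, by applying the inverse of g. With two residues
        only, this already determines the image.\<close>
      have iff: "[f (r (g \<otimes> h')) = f (r (g \<otimes> \<one>))] (mod int p) \<longleftrightarrow> [f (r h') = f (r \<one>)] (mod int p)"
      proof
        show "[f (r h') = f (r \<one>)] (mod int p) \<Longrightarrow> [f (r (g \<otimes> h')) = f (r (g \<otimes> \<one>))] (mod int p)"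
          using H_part_action[OF r f(1) g hc one_closed] .
        assume "[f (r (g \<otimes> h')) = f (r (g \<otimes> \<one>))] (mod int p)"
        then have "[f (r (inv g \<otimes> (g \<otimes> h'))) = f (r (inv g \<otimes> (g \<otimes> \<one>)))] (mod int p)"
          using H_part_action[OF r f(1), of "inv g" "g \<otimes> h'" "g \<otimes> \<one>"] g hc by simp
        then show "[f (r h') = f (r \<one>)] (mod int p)" using g hc by (simp add: inv_mult_cancel_left)
      qed
      have "[f (r \<one>) = 0] (mod int p)"
        using H_part_self[OF r f(1) subgroup.one_closed[OF H]] phom_one[OF H f(1)] by (rule cong_trans)
      moreover have "[f (r h') = f h'] (mod int p)" using H_part_self[OF r f(1) h'] .
      ultimately show ?thesis using iff g p2 by (auto simp: cong_iff_dvd_diff) 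
    qed
    then show "\<exists>f'. phom p H f' \<and> \<not> int p dvd f' h \<and>
        (\<forall>g\<in>carrier G. \<forall>h\<in>H. [f' (r (g \<otimes> h)) = f' (r g) + 1 * f' h] (mod int p))"
      using f by blast
  qed
qed

end

section \<open>Cyclic subgroups\<close>

context prime_group
begin

lemma index_in_subgroup:
  assumes P: "subgroup P G" and L: "subgroup L G" "P \<subseteq> L" and np: "\<not> p dvd order G div card P"
  shows "\<not> p dvd card L div card P"
proof -
  obtain a where a: "card L = card P * a" using card_subgroup_dvd[OF fin P L] by auto
  obtain b where b: "order G = card L * b"
    using card_subgroup_dvd[OF fin L(1) subgroup_self subgroup.subset[OF L(1)]] by (auto simp: order_def)
  have "card P > 0"
    using finite_subset[OF subgroup.subset[OF P] fin] subgroup.one_closed[OF P] by (auto simp: card_gt_0_iff)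
  then have "card L div card P = a" "order G div card P = a * b" using a b by (simp_all add: mult.assoc)
  then show ?thesis using np dvd_mult2 by metis
qed

lemma p_element_conj_in:
  assumes P: "subgroup P G" "card P = p ^ n" "\<not> p dvd order G div card P"
    and L: "subgroup L G" "P \<subseteq> L" and w: "w \<in> L"
  obtains b e where "b \<in> L" "[e = 1] (mod p)" "b \<otimes> w [^] (e::nat) \<otimes> inv b \<in> P"
proof -
  interpret L: group "G\<lparr>carrier := L\<rparr>" by (rule subgroup_imp_group[OF L(1)])
  interpret L: prime_group "G\<lparr>carrier := L\<rparr>" p
    using finite_subset[OF subgroup.subset[OF L(1)] fin] prime_p by unfold_locales auto
  have "subgroup P (G\<lparr>carrier := L\<rparr>)" by (rule subgroup_incl[OF P(1) L])
  then obtain b e where b: "b \<in> L" "[e = 1] (mod p)"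
    "b \<otimes> w [^]\<^bsub>G\<lparr>carrier := L\<rparr>\<^esub> (e::nat) \<otimes> inv\<^bsub>G\<lparr>carrier := L\<rparr>\<^esub> b \<in> P"
    using L.p_element_conj[OF _ P(2), of w] index_in_subgroup[OF P(1) L P(3)] w by (auto simp: order_def)
  then show ?thesis
    using that[of b e] m_inv_consistent[OF L(1) b(1)] nat_pow_consistent[of w e L] by metis
qed

text \<open>The discrete logarithm to base x, well defined modulo the order of x.\<close>

lemma cyclic_log:
  assumes x: "x \<in> carrier G"
  obtains lg where "\<And>i::nat. [lg (x [^] i) = int i] (mod int (ord x))"
    "\<And>q. int q dvd int (ord x) \<Longrightarrow> phom q (generate G {x}) lg"
proof -
  have powx: "[i = j] (mod ord x)" if "x [^] i = x [^] j" for i j :: nat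
  proof -
    have "x [^] int i = x [^] int j" using that by (simp add: int_pow_int)
    then have "int (ord x) dvd int j - int i" using int_pow_eq[OF x, of "int i" "int j"] by simp
    then have "[int j = int i] (mod int (ord x))" by (simp add: cong_iff_dvd_diff)
    then show ?thesis by (metis cong_int_iff cong_sym)
  qed
  define lg where "lg y = int (SOME i::nat. y = x [^] i)" for y
  have lg: "[lg (x [^] i) = int i] (mod int (ord x))" for i :: nat
  proof -
    have "x [^] i = x [^] (SOME j::nat. x [^] i = x [^] j)" by (rule someI[of "\<lambda>j. x [^] i = x [^] j" i]) simp
    then show ?thesis unfolding lg_def using powx by (metis cong_int_iff cong_sym)
  qed
  have "phom q (generate G {x}) lg" if q: "int q dvd int (ord x)" for q
    unfolding phom_def
  proof (intro ballI)
    fix a b assume "a \<in> generate G {x}" "b \<in> generate G {x}"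
    then obtain i j where ij: "a = x [^] (i::nat)" "b = x [^] (j::nat)"
      using generate_pow_on_finite_carrier[OF fin x] by auto
    have "[lg (x [^] (i + j)) = int i + int j] (mod int (ord x))" using lg[of "i + j"] by simp
    then have "[lg (a \<otimes> b) = lg a + lg b] (mod int (ord x))"
      using cong_add[OF lg[of i] lg[of j]] ij x by (simp add: nat_pow_mult) (metis cong_sym cong_trans)
    then show "[lg (a \<otimes> b) = lg a + lg b] (mod int q)" using q cong_dvd_modulus by blast
  qed
  then show ?thesis using that lg by blast
qed

text \<open>Here \<open>G\<close> acts on \<open>\<int>/p\<close> with kernel \<open>N\<close>, \<open>x\<close> acting as the translation by 1, and \<open>P \<inter> N = \<langle>y\<rangle>\<close> for \<open>y = x\<^sup>p \<noteq> 1\<close>.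
  As \<open>y\<close> is central in \<open>C = C\<^sub>G(y)\<close>, the transfer \<open>\<psi> : C \<rightarrow> P\<close> is injective on \<open>P\<close>, so \<open>C = RP\<close> with \<open>R = ker \<psi>\<close>.
  Moreover \<open>R \<subseteq> N\<close>: otherwise \<open>x\<^sup>-\<^sup>i r\<close> would fix a point for some \<open>r \<in> R\<close> and \<open>i\<close> prime to \<open>p\<close>, although its
  \<open>p\<close>-part is conjugate in \<open>C\<close> to a nontrivial translation. So the normalizer of \<open>\<langle>y\<rangle>\<close> normalizes the
  group of translations, and by the Frattini argument it acts on \<open>\<int>/p\<close> as all of \<open>G\<close> does.\<close>

lemma cyclic_sylow_detects:
  assumes P: "subgroup P G" "card P = p ^ k" "\<not> p dvd order G div card P" and k: "2 \<le> k"
    and supp: "M_supplemented P G"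
    and x: "x \<in> P" and gen: "\<And>y. y \<in> P \<Longrightarrow> \<exists>i::nat. y = x [^] i"
  obtains \<theta> where "character \<theta>" "detects \<theta> P"
proof -
  obtain r where r: "H_part P r" using M_supplemented_H_part[OF P(1) supp] by blast
  have Pc: "\<And>k. k \<in> P \<Longrightarrow> k \<in> carrier G" using subgroup.mem_carrier[OF P(1)] .
  have xc: "x \<in> carrier G" using x Pc by auto
  have xp: "x [^] (i::nat) \<in> P" for i using subgroup_nat_pow_closed[OF P(1) x] .
  have PX: "generate G {x} = P"
    unfolding generate_pow_on_finite_carrier[OF fin xc] using gen xp by blast
  have ordx: "ord x = p ^ k" using generate_pow_card[OF xc] P(2) PX by simp
  obtain lg where lg: "\<And>i::nat. [lg (x [^] i) = int i] (mod int (ord x))"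
    and lgh: "\<And>q. int q dvd int (ord x) \<Longrightarrow> phom q (generate G {x}) lg"
    using cyclic_log[OF xc] by blast
  have phk: "phom (p ^ k) P lg" using lgh[of "p ^ k"] unfolding ordx PX by simp
  note lg = lg[unfolded ordx]
  have pk: "int p dvd int (p ^ k)" using k by (simp add: dvd_power)
  have lgp: "[lg (x [^] i) = int i] (mod int p)" for i :: nat using lg pk cong_dvd_modulus by blast
  have ph: "phom p P lg" using phk unfolding phom_def using pk cong_dvd_modulus by blast
  \<comment> \<open>F g is the image of the point 0 under g, and x acts as z -> z + 1
    (\<open>Fx\<close>).\<close>
  define F where "F g = lg (r g)" for g
  have FP: "[F (x [^] i) = int i] (mod int p)" for i :: nat
    unfolding F_def using H_part_self[OF r ph xp] lgp cong_trans by blast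
  have Fx: "[F (x [^] i \<otimes> g) = int i + F g] (mod int p)" if "g \<in> carrier G" for i :: nat and g
    unfolding F_def by (rule cong_trans[OF H_part_left_mult[OF r ph xp that] cong_add[OF lgp cong_refl]])
  have Fa: "[F (g \<otimes> a) = F (g \<otimes> b)] (mod int p)"
    if "g \<in> carrier G" "a \<in> carrier G" "b \<in> carrier G" "[F a = F b] (mod int p)" for g a b
    using H_part_action[OF r ph that(1-3)] that(4) unfolding F_def .
  have F1: "[F \<one> = 0] (mod int p)" using FP[of 0] by simp
  have Frep: "\<exists>i::nat. [F g = F (x [^] i)] (mod int p)" for g
  proof -
    have "[F g = int (nat (F g mod int p))] (mod int p)" using p_pos by (simp add: cong_def)
    then show ?thesis using FP[of "nat (F g mod int p)"] by (metis cong_sym cong_trans)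
  qed

  \<comment> \<open>The kernel of the action\<close>
  define N where "N = {n \<in> carrier G. \<forall>g\<in>carrier G. [F (n \<otimes> g) = F g] (mod int p)}"
  have N: "subgroup N G"
  proof (rule subgroup_finiteI[OF fin])
    show "N \<noteq> {}" by (auto simp: N_def intro: exI[of _ \<one>])
    fix a b assume ab: "a \<in> N" "b \<in> N"
    have "[F (a \<otimes> b \<otimes> g) = F g] (mod int p)" if g: "g \<in> carrier G" for g
    proof -
      have 1: "[F (a \<otimes> (b \<otimes> g)) = F (b \<otimes> g)] (mod int p)" and 2: "[F (b \<otimes> g) = F g] (mod int p)"
        using ab g by (auto simp: N_def)
      show ?thesis using cong_trans[OF 1 2] ab g by (simp add: N_def m_assoc)
    qed
    then show "a \<otimes> b \<in> N" using ab by (auto simp: N_def)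
  qed (auto simp: N_def)
  have Nc: "\<And>n. n \<in> N \<Longrightarrow> n \<in> carrier G" by (auto simp: N_def)
  have Nn: "g \<otimes> n \<otimes> inv g \<in> N" if g: "g \<in> carrier G" and n: "n \<in> N" for g n
  proof -
    have "[F (g \<otimes> n \<otimes> inv g \<otimes> h) = F h] (mod int p)" if h: "h \<in> carrier G" for h
    proof -
      have "[F (n \<otimes> (inv g \<otimes> h)) = F (inv g \<otimes> h)] (mod int p)" using n g h by (auto simp: N_def)
      then have "[F (g \<otimes> (n \<otimes> (inv g \<otimes> h))) = F (g \<otimes> (inv g \<otimes> h))] (mod int p)"
        using n g h Nc by (intro Fa) auto
      then show ?thesis using n g h Nc by (simp add: group_word_simps)
    qed
    moreover have "g \<otimes> n \<otimes> inv g \<in> carrier G" using n g Nc by simp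
    ultimately show ?thesis unfolding N_def by blast
  qed
  define y where "y = x [^] p"
  have yP: "y \<in> P" "y \<in> carrier G" using xp xc by (auto simp: y_def)
  have yi: "y [^] i = x [^] (p * i)" for i :: nat using xc by (simp add: y_def nat_pow_pow)
  define Q where "Q = {y [^] (i::nat) | i. True}"
  have Q: "subgroup Q G"
  proof (rule subgroup_finiteI[OF fin])
    fix a b assume "a \<in> Q" "b \<in> Q"
    then show "a \<otimes> b \<in> Q" using yP(2) by (auto simp: Q_def nat_pow_mult)
  qed (use yP in \<open>auto simp: Q_def\<close>)
  have QP: "Q \<subseteq> P" using subgroup_nat_pow_closed[OF P(1) yP(1)] by (auto simp: Q_def)
  have PNQ: "P \<inter> N \<subseteq> Q"
  proof
    fix a assume a: "a \<in> P \<inter> N"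
    then obtain i where i: "a = x [^] (i::nat)" using gen by blast
    have "[F (a \<otimes> \<one>) = F \<one>] (mod int p)" using a one_closed unfolding N_def by blast
    then have "[int i = 0] (mod int p)" using FP[of i] F1 i xc by simp (metis cong_sym cong_trans)
    then have "p dvd i" by (simp add: cong_0_iff int_dvd_int_iff)
    then show "a \<in> Q" using i yi by (auto simp: Q_def)
  qed
  have yN: "y \<in> N"
  proof -
    have "[F (y \<otimes> g) = F g] (mod int p)" if "g \<in> carrier G" for g
    proof -
      have "[F (y \<otimes> g) = int p + F g] (mod int p)" unfolding y_def by (rule Fx[OF that])
      also have "[int p + F g = 0 + F g] (mod int p)" by (rule cong_add) (simp_all add: cong_0_iff)
      finally show ?thesis by simp
    qed
    then show ?thesis using yP by (simp add: N_def)
  qed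
  have Pcomm: "a \<otimes> b = b \<otimes> a" if ab: "a \<in> P" "b \<in> P" for a b
  proof -
    obtain i j where "a = x [^] (i::nat)" "b = x [^] (j::nat)" using gen[OF ab(1)] gen[OF ab(2)] by blast
    then show ?thesis using xc by (simp add: nat_pow_mult add.commute)
  qed

  \<comment> \<open>Transfer from the centralizer of y\<close>
  define C where "C = {c \<in> carrier G. c \<otimes> y = y \<otimes> c}"
  have Cc: "\<And>c. c \<in> C \<Longrightarrow> c \<in> carrier G" by (simp add: C_def)
  have C: "subgroup C G"
  proof (rule subgroup_finiteI[OF fin])
    fix a b assume "a \<in> C" "b \<in> C"
    then have "a \<in> carrier G" "b \<in> carrier G" "a \<otimes> y = y \<otimes> a" "b \<otimes> y = y \<otimes> b" by (auto simp: C_def)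
    then have "a \<otimes> b \<otimes> y = y \<otimes> (a \<otimes> b)" using yP(2) by (metis m_assoc)
    then show "a \<otimes> b \<in> C" using \<open>a \<in> carrier G\<close> \<open>b \<in> carrier G\<close> by (simp add: C_def)
  qed (use yP in \<open>auto simp: C_def\<close>)
  have PC: "P \<subseteq> C" using Pcomm yP Pc by (auto simp: C_def)
  have xC: "x \<in> C" "y \<in> C" using PC x yP by auto
  define n where "n = card C div card P"
  have np: "\<not> p dvd n" unfolding n_def by (rule index_in_subgroup[OF P(1) C PC P(3)])
  \<comment> \<open>The conjugating group is trivial here, so only pairs (c, 1) occur; the modulus
    \<open>p^k\<close> identifies the cyclic P with its logarithms.\<close>
  obtain \<psi> where \<psi>: "phom (p ^ k) C \<psi>" "[\<psi> y = int n * lg y] (mod int (p ^ k))"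
  proof (rule transfer_hom[OF fin P(1) C PC triv_subgroup, where q = "p ^ k" and f = lg], goal_cases)
    case (5 T)
    have "phom (p ^ k) C (\<lambda>c. T c \<one>)" unfolding phom_def
    proof (intro ballI)
      fix a b assume "a \<in> C" "b \<in> C"
      then show "[T (a \<otimes> b) \<one> = T a \<one> + T b \<one>] (mod int (p ^ k))"
        using 5(2)[of \<one> \<one> a b] Cc by simp
    qed
    moreover have "[T y \<one> = int n * lg y] (mod int (p ^ k))"
      using 5(4)[OF yP(1)] by (simp add: n_def C_def)
    ultimately show ?case by (rule 5(1))
  qed (use Pc Cc phk in auto)
  define R where "R = {c \<in> C. int (p ^ k) dvd \<psi> c}"
  have R: "subgroup R G" unfolding R_def by (rule phom_kernel_subgroup[OF fin C \<psi>(1)])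
  have \<psi>x: "\<not> int p dvd \<psi> x"
  proof
    assume a: "int p dvd \<psi> x"
    \<comment> \<open>Here k at least 2 enters: p \<open>\<psi> x\<close> = n p holds modulo p^2, so
      p dividing \<open>\<psi> x\<close> would make p divide the index n.\<close>
    have "[int p * \<psi> x = \<psi> y] (mod int (p ^ k))"
      unfolding y_def using phom_pow[OF C \<psi>(1) xC(1)] by (rule cong_sym)
    also have "[\<psi> y = int n * lg y] (mod int (p ^ k))" by (rule \<psi>(2))
    also have "[int n * lg y = int n * int p] (mod int (p ^ k))"
      unfolding y_def by (rule cong_mult[OF cong_refl lg])
    finally have "[int p * \<psi> x = int n * int p] (mod int (p ^ k))" .
    moreover have "int (p ^ 2) dvd int (p ^ k)" using k by (simp add: le_imp_power_dvd)
    ultimately have "[int p * \<psi> x = int n * int p] (mod int (p ^ 2))" using cong_dvd_modulus by blast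
    moreover have "int (p ^ 2) dvd int p * \<psi> x" using a by (simp add: power2_eq_square mult_dvd_mono)
    ultimately have "int (p ^ 2) dvd int n * int p" by (simp add: cong_dvd_iff)
    then have "int p * int p dvd int p * int n" by (simp add: power2_eq_square mult.commute)
    then have "int p dvd int n" using p_pos by (simp only: dvd_mult_cancel_left) simp
    then show False using np by (simp add: int_dvd_int_iff)
  qed
  have CR: "\<exists>i::nat. c \<otimes> inv (x [^] i) \<in> R" if c: "c \<in> C" for c
  proof -
    have "coprime (\<psi> x) (int p)" using \<psi>x prime_int_p by (metis coprime_commute prime_imp_coprime)
    then have "coprime (\<psi> x) (int (p ^ k))" by simp
    then obtain s where s: "[\<psi> x * s = 1] (mod int (p ^ k))" using cong_solve_coprime_int by blast
    define i where "i = nat ((s * \<psi> c) mod int (p ^ k))"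
    have "int i = (s * \<psi> c) mod int (p ^ k)" using p_pos by (simp add: i_def)
    then have "[int i = s * \<psi> c] (mod int (p ^ k))" by (simp add: cong_def)
    then have "[int i * \<psi> x = (s * \<psi> c) * \<psi> x] (mod int (p ^ k))" by (rule cong_mult[OF _ cong_refl])
    also have "(s * \<psi> c) * \<psi> x = (\<psi> x * s) * \<psi> c" by simp
    also have "[(\<psi> x * s) * \<psi> c = 1 * \<psi> c] (mod int (p ^ k))" by (rule cong_mult[OF s cong_refl])
    finally have i: "[int i * \<psi> x = \<psi> c] (mod int (p ^ k))" by simp
    have xi: "x [^] i \<in> C" "inv (x [^] i) \<in> C"
      using subgroup_nat_pow_closed[OF C xC(1)] subgroup.m_inv_closed[OF C] by auto
    have "[\<psi> (c \<otimes> inv (x [^] i)) = \<psi> c + \<psi> (inv (x [^] i))] (mod int (p ^ k))" by (rule phom_mult[OF \<psi>(1) c xi(2)])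
    also have "[\<psi> c + \<psi> (inv (x [^] i)) = \<psi> c + - \<psi> (x [^] i)] (mod int (p ^ k))"
      by (rule cong_add[OF cong_refl phom_inv[OF C \<psi>(1) xi(1)]])
    also have "[\<psi> c + - \<psi> (x [^] i) = \<psi> c + - \<psi> c] (mod int (p ^ k))"
      using cong_trans[OF phom_pow[OF C \<psi>(1) xC(1)] i] by (intro cong_add cong_refl) (simp add: cong_minus_minus_iff)
    finally show ?thesis using subgroup.m_closed[OF C c xi(2)] by (auto simp: R_def cong_0_iff)
  qed
  have RF0: "[F a = 0] (mod int p)" if a: "a \<in> R" for a
  proof (rule ccontr)
    assume n0: "\<not> [F a = 0] (mod int p)"
    have aC: "a \<in> C" "a \<in> carrier G" "int (p ^ k) dvd \<psi> a" using a Cc by (auto simp: R_def)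
    obtain i where i: "[F a = F (x [^] (i::nat))] (mod int p)" using Frep by blast
    have Fi: "[F a = int i] (mod int p)" using i FP cong_trans by blast
    have pi: "\<not> p dvd i" using n0 Fi by (metis cong_0_iff cong_trans int_dvd_int_iff)
    have xi: "x [^] i \<in> C" "inv (x [^] i) \<in> C" "x [^] i \<in> carrier G"
      using subgroup_nat_pow_closed[OF C xC(1)] subgroup.m_inv_closed[OF C] Cc by auto
    \<comment> \<open>t and its powers fix the point 0, but \<open>\<psi> t\<close> is nonzero mod
      p. Some conjugate of t^e in P is an x^j with a fixed point, so p divides j, and comparing
      values of \<open>\<psi>\<close> gives a contradiction.\<close>
    define t where "t = inv (x [^] i) \<otimes> a"
    have t: "t \<in> C" "t \<in> carrier G" using subgroup.m_closed[OF C xi(2) aC(1)] Cc by (auto simp: t_def)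
    have Ft: "[F t = F \<one>] (mod int p)"
      using Fa[of "inv (x [^] i)" a "x [^] i"] i xi aC unfolding t_def by simp
    have Ftp: "[F (t [^] e) = F \<one>] (mod int p)" for e :: nat
    proof (induction e)
      case (Suc e)
      have "[F (t [^] e \<otimes> t) = F (t [^] e \<otimes> \<one>)] (mod int p)" by (rule Fa[OF _ t(2) one_closed Ft]) (use t in simp)
      then show ?case using Suc t by simp (rule cong_trans)
    qed simp
    have "[\<psi> t = \<psi> (inv (x [^] i)) + \<psi> a] (mod int (p ^ k))" unfolding t_def by (rule phom_mult[OF \<psi>(1) xi(2) aC(1)])
    also have "[\<psi> (inv (x [^] i)) + \<psi> a = - \<psi> (x [^] i) + 0] (mod int (p ^ k))"
      by (rule cong_add[OF phom_inv[OF C \<psi>(1) xi(1)]]) (use aC(3) in \<open>simp add: cong_0_iff\<close>)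
    also have "[- \<psi> (x [^] i) + 0 = - (int i * \<psi> x) + 0] (mod int (p ^ k))"
      using phom_pow[OF C \<psi>(1) xC(1), of i] by (simp add: cong_minus_minus_iff)
    finally have "[\<psi> t = - (int i * \<psi> x) + 0] (mod int p)" using pk cong_dvd_modulus by blast
    then have pt: "\<not> int p dvd \<psi> t"
      using pi \<psi>x prime_int_p by (simp add: cong_dvd_iff prime_dvd_mult_iff int_dvd_int_iff)
    obtain b e where b: "b \<in> C" "[e = 1] (mod p)" "b \<otimes> t [^] (e::nat) \<otimes> inv b \<in> P"
      using p_element_conj_in[OF P C PC t(1)] by blast
    obtain j where j: "b \<otimes> t [^] e \<otimes> inv b = x [^] (j::nat)" using gen[OF b(3)] by blast
    have te: "t [^] e \<in> C" "t [^] e \<in> carrier G" using subgroup_nat_pow_closed[OF C t(1)] Cc by auto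
    have bc: "b \<in> carrier G" using b Cc by auto
    have bt: "b \<otimes> t [^] e = x [^] j \<otimes> b" using j bc te by (metis inv_closed m_assoc m_closed l_inv r_one)
    have "[F (b \<otimes> t [^] e) = F (b \<otimes> \<one>)] (mod int p)" by (rule Fa[OF bc te(2) one_closed Ftp])
    then have "[F (x [^] j \<otimes> b) = F b] (mod int p)" using bt bc by simp
    then have "[int j + F b = 0 + F b] (mod int p)" using Fx[OF bc, of j] by (metis add_0 cong_sym cong_trans)
    then have "[int j = 0] (mod int p)" by (simp only: cong_add_rcancel)
    then have "int p dvd \<psi> (x [^] j)"
      using cong_dvd_modulus[OF phom_pow[OF C \<psi>(1) xC(1), of j] pk] by (simp add: cong_dvd_iff cong_0_iff)
    moreover have "[\<psi> (x [^] j) = \<psi> (t [^] e)] (mod int p)"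
      using cong_dvd_modulus[OF phom_conj[OF C \<psi>(1) b(1) te(1)] pk] j by simp
    moreover have "[\<psi> (t [^] e) = int e * \<psi> t] (mod int p)"
      using cong_dvd_modulus[OF phom_pow[OF C \<psi>(1) t(1)] pk] .
    ultimately have "int p dvd int e * \<psi> t" using cong_dvd_iff cong_trans by metis
    then have "p dvd e" using pt prime_int_p by (simp add: prime_dvd_mult_iff int_dvd_int_iff)
    then show False using b(2) p_pos cong_dvd_iff by (metis nat_dvd_1_iff_1 less_irrefl)
  qed
  have RN: "R \<subseteq> N"
  proof
    fix a assume a: "a \<in> R"
    then have aC: "a \<in> C" "a \<in> carrier G" using Cc by (auto simp: R_def)
    have "[F (a \<otimes> g) = F g] (mod int p)" if g: "g \<in> carrier G" for g
    proof -
      obtain i where i: "[F g = F (x [^] (i::nat))] (mod int p)" using Frep by blast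
      have xi: "x [^] i \<in> C" "inv (x [^] i) \<in> C" "x [^] i \<in> carrier G"
        using subgroup_nat_pow_closed[OF C xC(1)] subgroup.m_inv_closed[OF C] Cc by auto
      \<comment> \<open>Conjugation by x^i moves the point i to 0, and R is invariant under it; so
        \<open>RF0\<close> settles all points.\<close>
      define a' where "a' = inv (x [^] i) \<otimes> a \<otimes> inv (inv (x [^] i))"
      have a'C: "a' \<in> C" using xi aC subgroup.m_closed[OF C] by (simp add: a'_def)
      have "[\<psi> a' = \<psi> a] (mod int (p ^ k))" unfolding a'_def by (rule phom_conj[OF C \<psi>(1) xi(2) aC(1)])
      then have a'R: "a' \<in> R" using a a'C by (simp add: R_def cong_dvd_iff)
      have "[F (a \<otimes> g) = F (a \<otimes> x [^] i)] (mod int p)" by (rule Fa[OF aC(2) g xi(3) i])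
      also have "a \<otimes> x [^] i = x [^] i \<otimes> a'" using aC xi by (simp add: a'_def group_word_simps)
      also have "[F (x [^] i \<otimes> a') = int i + F a'] (mod int p)" using Fx a'C Cc by auto
      also have "[int i + F a' = int i + 0] (mod int p)" by (rule cong_add[OF cong_refl RF0[OF a'R]])
      also have "[int i + 0 = F g] (mod int p)" using cong_trans[OF i FP] by (simp add: cong_sym)
      finally show ?thesis .
    qed
    then show "a \<in> N" using aC by (simp add: N_def)
  qed

  \<comment> \<open>The Frattini argument in PN\<close>
  define L where "L = {z \<otimes> n | z n. z \<in> P \<and> n \<in> N}"
  have L: "subgroup L G"
  proof (rule subgroup_finiteI[OF fin])
    show "L \<subseteq> carrier G" using Pc Nc by (auto simp: L_def)
    show "L \<noteq> {}" using x yN by (auto simp: L_def)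
    fix a b assume "a \<in> L" "b \<in> L"
    then obtain z m z' m' where h: "z \<in> P" "m \<in> N" "a = z \<otimes> m" "z' \<in> P" "m' \<in> N" "b = z' \<otimes> m'"
      by (auto simp: L_def)
    have c: "z \<in> carrier G" "z' \<in> carrier G" "m \<in> carrier G" "m' \<in> carrier G" using h Pc Nc by auto
    have "a \<otimes> b = (z \<otimes> z') \<otimes> ((inv z' \<otimes> m \<otimes> inv (inv z')) \<otimes> m')"
      using h c by (simp add: group_word_simps)
    moreover have "(inv z' \<otimes> m \<otimes> inv (inv z')) \<otimes> m' \<in> N"
      using Nn[of "inv z'" m] h c subgroup.m_closed[OF N] by blast
    ultimately show "a \<otimes> b \<in> L" using subgroup.m_closed[OF P(1) h(1,4)] unfolding L_def by blast
  qed
  have PL: "P \<subseteq> L" "N \<subseteq> L"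
  proof -
    show "P \<subseteq> L"
    proof
      fix z assume "z \<in> P"
      then have "z = z \<otimes> \<one>" "z \<in> P" using Pc by auto
      then show "z \<in> L" using subgroup.one_closed[OF N] unfolding L_def by blast
    qed
    show "N \<subseteq> L"
    proof
      fix z assume "z \<in> N"
      then have "z = \<one> \<otimes> z" "z \<in> N" using Nc by auto
      then show "z \<in> L" using subgroup.one_closed[OF P(1)] unfolding L_def by blast
    qed
  qed
  have frattini: "\<exists>m\<in>N. m \<otimes> g \<otimes> y \<otimes> inv (m \<otimes> g) \<in> Q" if g: "g \<in> carrier G" for g
  proof -
    define w where "w = g \<otimes> y \<otimes> inv g"
    have w: "w \<in> N" "w \<in> carrier G" using Nn[OF g yN] Nc by (auto simp: w_def)
    obtain b e where b: "b \<in> L" "[e = 1] (mod p)" "b \<otimes> w [^] (e::nat) \<otimes> inv b \<in> P"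
      using p_element_conj_in[OF P L PL(1), of w] w PL by blast
    \<comment> \<open>The conjugate v of w^e lies in the abelian group P, so the factor z commutes
      with it and only m in N matters.\<close>
    obtain z m where zm: "z \<in> P" "m \<in> N" "b = z \<otimes> m" using b(1) by (auto simp: L_def)
    have c: "z \<in> carrier G" "m \<in> carrier G" "b \<in> carrier G" using zm Pc Nc by auto
    have "b \<otimes> w [^] e \<otimes> inv b \<in> N" using Nn[OF c(3)] subgroup_nat_pow_closed[OF N w(1)] by blast
    then have "b \<otimes> w [^] e \<otimes> inv b \<in> Q" using b(3) PNQ by blast
    then obtain v where v: "v \<in> Q" "b \<otimes> w [^] e \<otimes> inv b = v" by blast
    have vc: "v \<in> P" "v \<in> carrier G" using v QP Pc by auto
    \<comment> \<open>Inverting e modulo \<open>p^k\<close>, a multiple of the order of y, leads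
      back from y^e to y.\<close>
    have "coprime e (p ^ k)" using b(2) by (metis cong_imp_coprime cong_sym coprime_1_left coprime_power_right_iff)
    then obtain e' where e': "[e * e' = Suc 0] (mod p ^ k)" using cong_solve_coprime_nat by blast
    define h where "h = m \<otimes> g"
    have hc: "h \<in> carrier G" using c g by (simp add: h_def)
    have gpow: "w [^] i = g \<otimes> y [^] i \<otimes> inv g" for i :: nat
      unfolding w_def by (rule conj_nat_pow[OF g yP(2)])
    have "m \<otimes> w [^] e \<otimes> inv m = inv z \<otimes> v \<otimes> z"
      using v(2) c w zm(3) vc by (simp add: group_word_simps flip: v(2))
    also have "inv z \<otimes> v \<otimes> z = v" using Pcomm[OF vc(1) zm(1)] c vc by (simp add: group_word_simps)
    finally have hy: "h \<otimes> y [^] e \<otimes> inv h = v"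
      using c g yP unfolding h_def gpow by (simp add: group_word_simps)
    have "x [^] (p * (e * e')) = x [^] (p * 1)"
    proof -
      have "[p * (e * e') = p * 1] (mod p ^ k)" using e' by (intro cong_mult cong_refl) simp
      then have "int (p ^ k) dvd int (p * 1) - int (p * (e * e'))"
        by (metis cong_iff_dvd_diff cong_int_iff cong_sym)
      then show ?thesis using int_pow_eq[OF xc, of "int (p * (e * e'))" "int (p * 1)"] ordx by (simp only: int_pow_int)
    qed
    then have "y = y [^] (e * e')" using yi[of "e * e'"] xc by (simp add: y_def)
    then have "h \<otimes> y \<otimes> inv h = (h \<otimes> y [^] e \<otimes> inv h) [^] e'"
      using conj_nat_pow[OF hc, of "y [^] e" e'] yP by (simp add: nat_pow_pow)
    also have "\<dots> \<in> Q" unfolding hy by (rule subgroup_nat_pow_closed[OF Q v(1)])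
    finally show ?thesis using zm(2) unfolding h_def by blast
  qed
  have "\<exists>i::int. \<forall>h\<in>carrier G. [F (g \<otimes> x \<otimes> h) = i + F (g \<otimes> h)] (mod int p)" if g: "g \<in> carrier G" for g
  proof -
    obtain n where n: "n \<in> N" "n \<otimes> g \<otimes> y \<otimes> inv (n \<otimes> g) \<in> Q" using frattini[OF g] by blast
    define m where "m = n \<otimes> g"
    have mc: "m \<in> carrier G" "n \<in> carrier G" using n g Nc by (auto simp: m_def)
    have finQ: "finite Q" "Q \<subseteq> carrier G" using subgroup.subset[OF Q] fin finite_subset by auto
    have mQ: "inv (inv m) \<otimes> a \<otimes> inv m \<in> Q" if "a \<in> Q" for a
    proof -
      obtain i where "a = y [^] (i::nat)" using \<open>a \<in> Q\<close> by (auto simp: Q_def)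
      then have "m \<otimes> a \<otimes> inv m = (m \<otimes> y \<otimes> inv m) [^] i" using conj_nat_pow[OF mc(1)] yP by simp
      then show ?thesis using n(2) subgroup_nat_pow_closed[OF Q] mc by (simp add: m_def)
    qed
    have yQ: "y \<in> Q" using yP yi[of 1] by (auto simp: Q_def intro: exI[of _ 1])
    have y': "inv m \<otimes> y \<otimes> m \<in> Q" using conj_stable_finite[OF finQ _ mQ yQ] mc by simp
    define y2 where "y2 = inv m \<otimes> y \<otimes> m"
    have y2: "y2 \<in> P" "y2 \<in> carrier G" "y = m \<otimes> y2 \<otimes> inv m"
      using y' QP Pc mc yP by (auto simp: y2_def group_word_simps)
    \<comment> \<open>m normalizes Q, so y is the conjugate by m of some \<open>y2\<close> in P,
      which commutes with x. Then \<open>CR\<close> writes the conjugate of x as s x^i with s acting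
      trivially, and i is the slope of g.\<close>
    have "m \<otimes> x \<otimes> inv m \<in> C"
    proof -
      have "(m \<otimes> x \<otimes> inv m) \<otimes> (m \<otimes> y2 \<otimes> inv m) = m \<otimes> (x \<otimes> y2) \<otimes> inv m"
        using mc xc y2(2) by (simp add: group_word_simps)
      also have "x \<otimes> y2 = y2 \<otimes> x" by (rule Pcomm[OF x y2(1)])
      also have "m \<otimes> (y2 \<otimes> x) \<otimes> inv m = (m \<otimes> y2 \<otimes> inv m) \<otimes> (m \<otimes> x \<otimes> inv m)"
        using mc xc y2(2) by (simp add: group_word_simps)
      finally show ?thesis using mc xc y2(3) by (simp add: C_def)
    qed
    then obtain i where i: "m \<otimes> x \<otimes> inv m \<otimes> inv (x [^] (i::nat)) \<in> R" using CR by blast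
    define s where "s = m \<otimes> x \<otimes> inv m \<otimes> inv (x [^] i)"
    have s: "s \<in> N" "s \<in> carrier G" using i RN Nc by (auto simp: s_def)
    have ms: "m \<otimes> x \<otimes> inv m = s \<otimes> x [^] i" using mc xc by (simp add: s_def group_word_simps)
    have "[F (g \<otimes> x \<otimes> h) = int i + F (g \<otimes> h)] (mod int p)" if h: "h \<in> carrier G" for h
    proof -
      have "[F (g \<otimes> x \<otimes> h) = F (n \<otimes> (g \<otimes> x \<otimes> h))] (mod int p)"
        using n(1) g xc h by (auto simp: N_def intro: cong_sym)
      also have "n \<otimes> (g \<otimes> x \<otimes> h) = (m \<otimes> x \<otimes> inv m) \<otimes> (m \<otimes> h)"
        using g xc h mc by (simp add: m_def group_word_simps)
      also have "\<dots> = s \<otimes> (x [^] i \<otimes> (m \<otimes> h))" using ms s mc h xc by (simp add: m_assoc)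
      also have "[F (s \<otimes> (x [^] i \<otimes> (m \<otimes> h))) = F (x [^] i \<otimes> (m \<otimes> h))] (mod int p)"
        using s mc h xc by (auto simp: N_def)
      also have "[F (x [^] i \<otimes> (m \<otimes> h)) = int i + F (m \<otimes> h)] (mod int p)" using Fx mc h by simp
      also have "m \<otimes> h = n \<otimes> (g \<otimes> h)" using g h mc by (simp add: m_def m_assoc)
      also have "[int i + F (n \<otimes> (g \<otimes> h)) = int i + F (g \<otimes> h)] (mod int p)"
        using n(1) g h by (intro cong_add cong_refl) (auto simp: N_def)
      finally show ?thesis .
    qed
    then show ?thesis by blast
  qed
  then obtain \<theta> :: "'a \<Rightarrow> int" where
    \<theta>: "\<And>g h. g \<in> carrier G \<Longrightarrow> h \<in> carrier G \<Longrightarrow> [F (g \<otimes> x \<otimes> h) = \<theta> g + F (g \<otimes> h)] (mod int p)"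
    by metis
  have \<theta>i: "[F (g \<otimes> x [^] i) = F g + \<theta> g * int i] (mod int p)" if g: "g \<in> carrier G" for g and i :: nat
  proof (induction i)
    case (Suc i)
    have "g \<otimes> x [^] Suc i = g \<otimes> x \<otimes> x [^] i" using g xc by (metis m_assoc nat_pow_Suc2 nat_pow_closed)
    then have "[F (g \<otimes> x [^] Suc i) = \<theta> g + F (g \<otimes> x [^] i)] (mod int p)" using \<theta>[OF g, of "x [^] i"] xc by simp
    also have "[\<theta> g + F (g \<otimes> x [^] i) = \<theta> g + (F g + \<theta> g * int i)] (mod int p)" by (rule cong_add[OF cong_refl Suc])
    finally show ?case by (simp add: algebra_simps)
  qed (use g in simp)
  have lin: "[lg (r (g \<otimes> h)) = lg (r g) + \<theta> g * lg h] (mod int p)" if g: "g \<in> carrier G" and h: "h \<in> P" for g h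
  proof -
    obtain i where i: "h = x [^] (i::nat)" using gen h by blast
    have "[F g + \<theta> g * int i = F g + \<theta> g * lg h] (mod int p)"
      unfolding i by (intro cong_add cong_mult cong_refl cong_sym[OF lgp])
    then show ?thesis using \<theta>i[OF g, of i] unfolding F_def i by (metis cong_trans)
  qed
  have lgx: "[lg x = 1] (mod int p)" using lgp[of 1] xc by simp
  have "character \<theta>" by (rule H_part_character[OF P(1) r ph x lgx lin])
  moreover have "detects \<theta> P"
  proof (rule detectsI[OF P(1) r])
    fix h f assume h: "h \<in> P" and f: "phom p P f" "\<not> int p dvd f h"
    obtain i where i: "h = x [^] (i::nat)" using gen h by blast
    have "\<not> p dvd i"
    proof
      assume "p dvd i"
      then have "int p dvd int i * f x" by (simp add: int_dvd_int_iff)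
      then show False using f(2) cong_dvd_iff[OF phom_pow[OF P(1) f(1) x, of i]] i by simp
    qed
    then have "\<not> int p dvd lg h" using cong_dvd_iff[OF lgp[of i]] i by (simp add: int_dvd_int_iff)
    then show "\<exists>f'. phom p P f' \<and> \<not> int p dvd f' h \<and>
        (\<forall>g\<in>carrier G. \<forall>h\<in>P. [f' (r (g \<otimes> h)) = f' (r g) + \<theta> g * f' h] (mod int p))"
      using ph lin by blast
  qed
  ultimately show ?thesis using that by blast
qed

section \<open>Cyclic subgroups of order p^k, p odd\<close>

lemma cocycle_phom_p_subgroup:
  assumes "subgroup P G" "card P = p ^ n" "character \<theta>" "cocycle \<theta> \<delta>"
  shows "phom p P \<delta>"
  using cocycle_phom[OF assms(4) subgroup.subset[OF assms(1)]] character_p_subgroup[OF assms(3,1,2)] by blast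

text \<open>To first order r^i is 1 + i (r - 1) modulo p^2. The correction to p is (r - 1) p (p - 1)
  / 2, and for odd p both r - 1 and p (p - 1) / 2 are divisible by p.\<close>

lemma geometric_sum_cong:
  assumes p2: "p \<noteq> 2" and r: "[r = 1] (mod int p)"
  shows "[(\<Sum>i<p. r ^ i) = int p] (mod (int p)\<^sup>2)"
proof -
  have pr: "int p dvd r - 1" using r by (simp add: cong_iff_dvd_diff)
  have r2: "(int p)\<^sup>2 dvd (r - 1) * (r - 1)" using mult_dvd_mono[OF pr pr] by (simp add: power2_eq_square)
  have pw: "[r ^ i = 1 + int i * (r - 1)] (mod (int p)\<^sup>2)" for i
  proof (induction i)
    case (Suc i)
    have "[r ^ i * r = (1 + int i * (r - 1)) * r] (mod (int p)\<^sup>2)" by (rule cong_mult[OF Suc cong_refl])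
    moreover have "(1 + int i * (r - 1)) * r = 1 + int (Suc i) * (r - 1) + int i * ((r - 1) * (r - 1))"
      by (simp add: algebra_simps)
    moreover have "[1 + int (Suc i) * (r - 1) + int i * ((r - 1) * (r - 1)) = 1 + int (Suc i) * (r - 1) + 0] (mod (int p)\<^sup>2)"
      using r2 by (intro cong_add cong_refl) (simp add: cong_0_iff)
    ultimately show ?case by (simp add: mult.commute) (metis cong_trans)
  qed simp
  have "[(\<Sum>i<p. r ^ i) = (\<Sum>i<p. 1 + int i * (r - 1))] (mod (int p)\<^sup>2)" by (rule cong_sum) (rule pw)
  also have "(\<Sum>i<p. 1 + int i * (r - 1)) = int p + (\<Sum>i<p. int i) * (r - 1)"
    by (simp add: sum.distrib sum_distrib_right)
  also have "[\<dots> = int p + 0] (mod (int p)\<^sup>2)"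
  proof (rule cong_add[OF cong_refl])
    have "2 * (\<Sum>i<n. int i) = int n * (int n - 1)" for n by (induction n) (auto simp: algebra_simps)
    then have "int p dvd 2 * (\<Sum>i<p. int i)" by simp
    moreover have "\<not> int p dvd 2"
    proof
      assume "int p dvd 2"
      then have "p dvd 2" by (metis int_dvd_int_iff of_nat_numeral)
      then show False using p2 prime_p primes_dvd_imp_eq two_is_prime_nat by blast
    qed
    ultimately have "int p dvd (\<Sum>i<p. int i)" using prime_int_p by (metis prime_dvd_mult_iff)
    then show "[(\<Sum>i<p. int i) * (r - 1) = 0] (mod (int p)\<^sup>2)"
      using mult_dvd_mono[OF _ pr] by (simp add: cong_0_iff power2_eq_square)
  qed
  finally show ?thesis by simp
qed

text \<open>If \<open>y \<in> P - \<langle>x\<rangle>\<close> normalizes \<open>\<langle>x\<rangle>\<close> and \<open>y\<^sup>p \<in> \<langle>x\<rangle>\<close>, some \<open>b = x\<^sup>j y\<close> has \<open>b\<^sup>p \<in> \<langle>x\<^bsup>p^2\<^esup>\<rangle>\<close>. Then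
  \<open>J = \<langle>x\<^sup>p, b\<rangle>\<close> has order \<open>p\<^sup>k\<close> and is not cyclic, and \<open>x\<^sup>p\<close> lies outside its Frattini subgroup but is killed by
  every homomorphism \<open>P \<rightarrow> \<int>/p\<close>.\<close>

lemma odd_cyclic_sylow:
  assumes P: "subgroup P G" "card P = p ^ n" and k: "2 \<le> k" and p2: "p \<noteq> 2"
    and M: "M_class (p ^ k) G"
    and x: "x \<in> P" "ord x = p ^ k"
  shows "P = generate G {x}"
proof (rule ccontr)
  assume ne: "P \<noteq> generate G {x}"
  let ?H = "generate G {x}"
  have Pc: "\<And>y. y \<in> P \<Longrightarrow> y \<in> carrier G" using subgroup.mem_carrier[OF P(1)] .
  have xc: "x \<in> carrier G" using x Pc by auto
  have gen: "generate G {a} = {a [^] (i::nat) | i. True}" if "a \<in> carrier G" for a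
    using generate_pow_on_finite_carrier[OF fin that] by auto
  have H: "subgroup ?H G" "card ?H = p ^ k"
    using generate_is_subgroup[of "{x}"] generate_pow_card[OF xc] xc x(2) by auto
  have HP: "?H \<subset> P" using ne generate_subgroup_incl[of "{x}" P] x(1) P(1) by auto
  have pk: "int p dvd int (ord x)" using k x(2) by (simp add: dvd_power)
  obtain y where y: "y \<in> P" "y \<notin> ?H" "y [^] p \<in> ?H" and yn: "\<And>m. m \<in> ?H \<Longrightarrow> y \<otimes> m \<otimes> inv y \<in> ?H"
    using p_group_growth[OF P H(1) HP] by blast
  have yc: "y \<in> carrier G" using y Pc by auto
  have xH: "x \<in> ?H" by (simp add: generate.incl)
  obtain s where s: "y [^] p = x [^] (s::nat)" using y(3) gen[OF xc] by auto
  obtain r where r: "y \<otimes> x \<otimes> inv y = x [^] (r::nat)" using yn[OF xH] gen[OF xc] by auto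
  obtain lg where lg: "\<And>i::nat. [lg (x [^] i) = int i] (mod int (ord x))"
    and lgh: "\<And>q. int q dvd int (ord x) \<Longrightarrow> phom q ?H lg" using cyclic_log[OF xc] by blast
  have lgp: "[lg (x [^] i) = int i] (mod int p)" for i :: nat using lg pk cong_dvd_modulus by blast
  have ph: "phom p ?H lg" by (rule lgh[OF pk])
  have conjx: "y \<otimes> x [^] i \<otimes> inv y = x [^] (r * i)" for i :: nat
  proof (induction i)
    case (Suc i)
    have "y \<otimes> x [^] Suc i \<otimes> inv y = (y \<otimes> x [^] i \<otimes> inv y) \<otimes> (y \<otimes> x \<otimes> inv y)"
      using xc yc by (simp add: group_word_simps)
    also have "\<dots> = x [^] (r * i) \<otimes> x [^] r" unfolding Suc r ..
    also have "\<dots> = x [^] (r * Suc i)" using xc by (simp add: nat_pow_mult add.commute)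
    finally show ?case .
  qed (use yc in simp)
  have conjy: "y [^] m \<otimes> x [^] i = x [^] (r ^ m * i) \<otimes> y [^] m" for m i :: nat
  proof (induction m arbitrary: i)
    case (Suc m)
    have "y \<otimes> x [^] i = x [^] (r * i) \<otimes> y" using conjx[of i] xc yc by (metis inv_closed inv_solve_right' m_closed nat_pow_closed)
    then have "y [^] Suc m \<otimes> x [^] i = y [^] m \<otimes> x [^] (r * i) \<otimes> y" using xc yc by (simp add: m_assoc)
    also have "\<dots> = x [^] (r ^ m * (r * i)) \<otimes> y [^] m \<otimes> y" unfolding Suc ..
    finally show ?case using xc yc by (simp add: m_assoc mult.assoc mult.left_commute)
  qed (use xc in simp)
  \<comment> \<open>Otherwise x is a power of y, so y commutes with x and acts as a translation on
    the p points attached to \<open>?H\<close>. Then y^p fixes the point 0, whereas x^s moves it to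
    s.\<close>
  have ps: "p dvd s"
  proof (rule ccontr)
    assume ns: "\<not> p dvd s"
    have comm: "y \<otimes> x = x \<otimes> y"
    proof -
      have "coprime s (p ^ k)" using ns prime_p by (metis coprime_commute coprime_power_right_iff prime_imp_coprime)
      then obtain s' where s': "[s * s' = Suc 0] (mod p ^ k)" using cong_solve_coprime_nat by blast
      have "x [^] (s * s') = x [^] (1::nat)"
      proof -
        have "int (p ^ k) dvd int 1 - int (s * s')"
          using s' by (metis One_nat_def cong_iff_dvd_diff cong_int_iff cong_sym)
        then show ?thesis using int_pow_eq[OF xc, of "int (s * s')" "int 1"] x(2) by (simp only: int_pow_int)
      qed
      then have "x = (y [^] p) [^] s'" using xc s by (simp add: nat_pow_pow)
      then have "x = y [^] (p * s')" using yc by (simp add: nat_pow_pow)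
      moreover have "y \<otimes> y [^] (p * s') = y [^] (p * s') \<otimes> y"
        using yc by (metis nat_pow_Suc nat_pow_Suc2)
      ultimately show ?thesis by simp
    qed
    have commi: "y \<otimes> x [^] i = x [^] i \<otimes> y" for i :: nat
    proof (induction i)
      case (Suc i)
      have "y \<otimes> x [^] Suc i = (y \<otimes> x [^] i) \<otimes> x" using xc yc by (simp add: m_assoc)
      also have "\<dots> = x [^] i \<otimes> (y \<otimes> x)" unfolding Suc using xc yc by (simp add: m_assoc)
      finally show ?case unfolding comm using xc yc by (simp add: m_assoc)
    qed (use yc in simp)
    have "M_supplemented ?H G" using M H unfolding M_class_def by blast
    then obtain q where q: "H_part ?H q" using M_supplemented_H_part[OF H(1)] by blast
    define F where "F g = lg (q g)" for g
    have xi: "x [^] (i::nat) \<in> ?H" for i using subgroup_nat_pow_closed[OF H(1) xH] .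
    have FP: "[F (x [^] i) = int i] (mod int p)" for i :: nat
      unfolding F_def using H_part_self[OF q ph xi] lgp cong_trans by blast
    have Fy: "[F (y \<otimes> h) = F y + F h] (mod int p)" if h: "h \<in> carrier G" for h
    proof -
      have "[F h = int (nat (F h mod int p))] (mod int p)" using p_pos by (simp add: cong_def)
      then obtain i :: nat where i: "[F h = int i] (mod int p)" by blast
      have "[lg (q h) = lg (q (x [^] i))] (mod int p)" using cong_trans[OF i cong_sym[OF FP]] unfolding F_def .
      then have "[lg (q (y \<otimes> h)) = lg (q (y \<otimes> x [^] i))] (mod int p)"
        using H_part_action[OF q ph yc h, of "x [^] i"] xc by simp
      also have "y \<otimes> x [^] i = x [^] i \<otimes> y" by (rule commi)
      also have "[lg (q (x [^] i \<otimes> y)) = lg (x [^] i) + lg (q y)] (mod int p)" by (rule H_part_left_mult[OF q ph xi yc])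
      also have "[lg (x [^] i) + lg (q y) = F h + lg (q y)] (mod int p)"
        by (rule cong_add[OF cong_trans[OF lgp cong_sym[OF i]] cong_refl])
      finally show ?thesis unfolding F_def by (simp add: add.commute)
    qed
    have "[F (y [^] m) = int m * F y] (mod int p)" for m :: nat
    proof (induction m)
      case 0
      then show ?case using FP[of 0] by simp
    next
      case (Suc m)
      have "y [^] Suc m = y \<otimes> y [^] m" using yc by (metis nat_pow_Suc2)
      then have "[F (y [^] Suc m) = F y + F (y [^] m)] (mod int p)" using Fy[of "y [^] m"] yc by simp
      also have "[F y + F (y [^] m) = F y + int m * F y] (mod int p)" by (rule cong_add[OF cong_refl Suc])
      finally show ?case by (simp add: algebra_simps)
    qed
    from this[of p] have "int p dvd F (y [^] p)" by (simp add: cong_dvd_iff)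
    then have "int p dvd int s" using cong_dvd_iff[OF FP[of s]] s by simp
    then show False using ns by (simp add: int_dvd_int_iff)
  qed
  \<comment> \<open>y^p = x^s commutes with x, so r^p is 1 mod p; and r^p is r mod p by
    Fermat.\<close>
  have r1: "[int r = 1] (mod int p)"
  proof -
    have "x [^] (r ^ p * 1) \<otimes> y [^] p = x \<otimes> y [^] p"
      using conjy[of p 1] s xc by (simp add: nat_pow_mult add.commute) (metis nat_pow_Suc nat_pow_Suc2)
    then have "x [^] (r ^ p) = x [^] (1::nat)" using xc yc by simp
    then have "[int (r ^ p) = int 1] (mod int p)" using lgp[of "r ^ p"] lgp[of 1] by (metis cong_sym cong_trans)
    then show ?thesis using fermat_int_power[of "int r" 1] by (simp add: cong_sym) (metis cong_sym cong_trans)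
  qed
  obtain t where t: "s = p * t" using ps by auto
  \<comment> \<open>A nonnegative stand-in for -t: as S is p modulo p^2, j S + s becomes p t (p - 1)
    + p t = t p^2.\<close>
  define j where "j = t * (p - 1)"
  define S where "S = (\<Sum>i<p. r ^ i)"
  define b where "b = x [^] j \<otimes> y"
  have bc: "b \<in> carrier G" "b \<in> P"
    using xc yc subgroup.m_closed[OF P(1) _ y(1)] subgroup_nat_pow_closed[OF P(1) x(1)] by (auto simp: b_def)
  have bpow: "b [^] m = x [^] (j * (\<Sum>i<m. r ^ i)) \<otimes> y [^] m" for m :: nat
  proof (induction m)
    case (Suc m)
    have "b [^] Suc m = x [^] (j * (\<Sum>i<m. r ^ i)) \<otimes> (y [^] m \<otimes> x [^] j) \<otimes> y"
      unfolding nat_pow_Suc Suc by (simp add: b_def xc yc m_assoc)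
    also have "\<dots> = (x [^] (j * (\<Sum>i<m. r ^ i)) \<otimes> x [^] (r ^ m * j)) \<otimes> (y [^] m \<otimes> y)"
      unfolding conjy using xc yc by (simp add: m_assoc)
    also have "x [^] (j * (\<Sum>i<m. r ^ i)) \<otimes> x [^] (r ^ m * j) = x [^] (j * (\<Sum>i<Suc m. r ^ i))"
      using xc by (simp add: nat_pow_mult algebra_simps)
    finally show ?case by simp
  qed simp
  have bp: "b [^] p = x [^] (j * S + s)"
    unfolding bpow s S_def using xc by (simp add: nat_pow_mult)
  have p2d: "p\<^sup>2 dvd j * S + s"
  proof -
    have "[int S = int p] (mod (int p)\<^sup>2)" unfolding S_def using geometric_sum_cong[OF p2 r1] by simp
    then have "[int j * int S + int s = int j * int p + int s] (mod (int p)\<^sup>2)" by (intro cong_add cong_mult cong_refl)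
    also have "int j * int p + int s = int t * (int p)\<^sup>2"
      using p_pos by (simp add: j_def t power2_eq_square of_nat_diff algebra_simps)
    finally have "(int p)\<^sup>2 dvd int (j * S + s)" by (simp add: cong_dvd_iff)
    then show ?thesis by (metis int_dvd_int_iff of_nat_power)
  qed
  have conjb: "b \<otimes> x [^] i \<otimes> inv b = x [^] (r * i)" for i :: nat
  proof -
    have "b \<otimes> x [^] i \<otimes> inv b = x [^] j \<otimes> (y \<otimes> x [^] i \<otimes> inv y) \<otimes> inv (x [^] j)"
      using xc yc by (simp add: b_def group_word_simps)
    also have "\<dots> = x [^] (r * i) \<otimes> x [^] j \<otimes> inv (x [^] j)"
      unfolding conjx using xc by (simp add: nat_pow_mult add.commute)
    finally show ?thesis using xc by (simp add: m_assoc)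
  qed
  define A where "A e = generate G {x [^] (e::nat)}" for e
  have A: "A e = {x [^] (e * i) | i::nat. True}" for e
    unfolding A_def using gen[of "x [^] e"] xc by (simp add: nat_pow_pow)
  have AG: "subgroup (A e) G" for e using generate_is_subgroup[of "{x [^] e}"] xc by (simp add: A_def)
  have AH: "A e \<subseteq> ?H" for e using A gen[OF xc] by auto
  have cA: "card (A (p ^ m)) = p ^ (k - m)" if "m \<le> k" for m
  proof -
    have "ord (x [^] (p ^ m)) = ord x div p ^ m"
      by (rule ord_pow) (use xc x(2) that p_pos in \<open>auto simp: le_imp_power_dvd\<close>)
    also have "\<dots> = p ^ (k - m)" using that p_pos x(2) by (simp add: power_diff)
    finally show ?thesis unfolding A_def using generate_pow_card[of "x [^] (p ^ m)"] xc by simp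
  qed
  have bH: "b \<notin> ?H"
  proof
    assume "b \<in> ?H"
    moreover have "inv (x [^] j) \<in> ?H" using subgroup.m_inv_closed[OF H(1)] subgroup_nat_pow_closed[OF H(1) xH] by blast
    ultimately have "inv (x [^] j) \<otimes> b \<in> ?H" using subgroup.m_closed[OF H(1)] by blast
    then show False using y(2) xc yc by (simp add: b_def inv_mult_cancel_left)
  qed
  have bA: "b \<otimes> m \<otimes> inv b \<in> A e" if m: "m \<in> A e" for m e
  proof -
    obtain i where "m = x [^] (e * i)" using m A by auto
    then have "b \<otimes> m \<otimes> inv b = x [^] (e * (r * i))" using conjb[of "e * i"] by (simp add: mult.left_commute)
    then show ?thesis using A by blast
  qed
  have A2: "b [^] p \<in> A (p\<^sup>2)"
  proof -
    obtain i where "j * S + s = p\<^sup>2 * i" using p2d by (rule dvdE)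
    then show ?thesis using bp A by auto
  qed
  have A21: "A (p\<^sup>2) \<subseteq> A (p ^ 1)"
  proof
    fix a assume "a \<in> A (p\<^sup>2)"
    then obtain i where "a = x [^] (p\<^sup>2 * i)" using A by auto
    then have "a = x [^] (p ^ 1 * (p * i))" by (simp add: power2_eq_square mult.assoc)
    then show "a \<in> A (p ^ 1)" using A by blast
  qed
  let ?J = "\<lambda>e. {m \<otimes> b [^] (i::nat) | m i. m \<in> A e}"
  obtain f2 where J: "subgroup (?J (p ^ 1)) G" "A (p ^ 1) \<subseteq> ?J (p ^ 1)" "b \<in> ?J (p ^ 1)"
    "card (?J (p ^ 1)) = p * card (A (p ^ 1))" "phom p (?J (p ^ 1)) f2"
    "\<And>m i. m \<in> A (p ^ 1) \<Longrightarrow> [f2 (m \<otimes> b [^] i) = int i] (mod int p)"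
    "\<And>c. c \<in> ?J (p ^ 1) \<Longrightarrow> int p dvd f2 c \<longleftrightarrow> c \<in> A (p ^ 1)"
    using cyclic_extension[OF AG[of "p ^ 1"] bc(1) _ _ bA] bH AH A2 A21 by blast
  obtain f0 where B: "subgroup (?J (p\<^sup>2)) G" "A (p\<^sup>2) \<subseteq> ?J (p\<^sup>2)" "b \<in> ?J (p\<^sup>2)"
    "card (?J (p\<^sup>2)) = p * card (A (p\<^sup>2))" "phom p (?J (p\<^sup>2)) f0"
    "\<And>m i. m \<in> A (p\<^sup>2) \<Longrightarrow> [f0 (m \<otimes> b [^] i) = int i] (mod int p)"
    "\<And>c. c \<in> ?J (p\<^sup>2) \<Longrightarrow> int p dvd f0 c \<longleftrightarrow> c \<in> A (p\<^sup>2)"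
    using cyclic_extension[OF AG[of "p\<^sup>2"] bc(1) _ A2 bA] bH AH by blast
  let ?JJ = "?J (p ^ 1)"
  have cJ: "card ?JJ = p ^ k" using J(4) cA[of 1] k by (simp flip: power_Suc)
  have cB: "card (?J (p\<^sup>2)) = p ^ (k - 1)"
    using B(4) cA[of 2] k by (simp flip: power_Suc) (metis Suc_diff_le diff_Suc_Suc numeral_2_eq_2)
  have BJ: "?J (p\<^sup>2) \<subset> ?JJ"
  proof
    show "?J (p\<^sup>2) \<subseteq> ?JJ" using A21 by blast
    have "p ^ (k - 1) \<noteq> p ^ k" using p_pos k by simp
    then show "?J (p\<^sup>2) \<noteq> ?JJ" using cJ cB by metis
  qed
  \<comment> \<open>\<open>f1\<close> kills b, so it is nonzero at the other generator x^p, while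
    \<open>f2\<close> kills x^p but not b.\<close>
  obtain f1 w where f1: "phom p ?JJ f1" "\<And>s. s \<in> ?J (p\<^sup>2) \<Longrightarrow> int p dvd f1 s" "w \<in> ?JJ" "\<not> int p dvd f1 w"
    using p_group_phom[OF J(1) cJ B(1) BJ] by blast
  have xpA: "x [^] p \<in> A (p ^ 1)" using A[of "p ^ 1"] by (auto intro: exI[of _ 1])
  have xpJ: "x [^] p \<in> ?JJ" using xpA J(2) by blast
  have f1x: "\<not> int p dvd f1 (x [^] p)"
  proof
    assume a: "int p dvd f1 (x [^] p)"
    obtain m i where m: "m \<in> A (p ^ 1)" "w = m \<otimes> b [^] (i::nat)" using f1(3) by blast
    obtain l where l: "m = x [^] (p ^ 1 * l)" using m(1) A by auto
    have "m = (x [^] p) [^] l" using l xc by (simp add: nat_pow_pow)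
    then have "int p dvd f1 m" using cong_dvd_iff[OF phom_pow[OF J(1) f1(1) xpJ, of l]] a by simp
    moreover have "int p dvd f1 (b [^] i)"
      using cong_dvd_iff[OF phom_pow[OF J(1) f1(1) J(3), of i]] f1(2)[OF B(3)] by simp
    moreover have "[f1 w = f1 m + f1 (b [^] i)] (mod int p)"
      unfolding m(2) using m(1) J(2) subgroup_nat_pow_closed[OF J(1) J(3)] by (intro phom_mult[OF f1(1)]) auto
    ultimately show False using f1(4) by (simp add: cong_dvd_iff)
  qed
  have "M_supplemented ?JJ G" using M J(1) cJ unfolding M_class_def by blast
  then obtain \<theta> where \<theta>: "character \<theta>" "detects \<theta> ?JJ"
  proof (rule noncyclic_detects[OF J(1) _ f1(1) J(5) xpJ f1x _ J(3)])
    show "int p dvd f2 (x [^] p)" using J(7)[OF xpJ] xpA by simp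
    show "int p dvd f1 b" using f1(2)[OF B(3)] .
    show "\<not> int p dvd f2 b" using J(7)[OF J(3)] bH AH by blast
  qed
  \<comment> \<open>x^p is a p-th power in P, though not in J, so cocycles cannot see it while
    \<open>f1\<close> does.\<close>
  have "int p dvd \<delta> (x [^] p)" if "cocycle \<theta> \<delta>" for \<delta>
    using cong_dvd_iff[OF phom_pow[OF P(1) cocycle_phom_p_subgroup[OF P \<theta>(1) that] x(1), of p]] by simp
  then have "int p dvd f1 (x [^] p)" using \<theta>(2) xpJ f1(1) unfolding detects_def by blast
  then show False using f1x by simp
qed

end

section \<open>A character for the Sylow subgroup\<close>

context prime_group
begin

lemma character_kernel_subgroup:
  assumes "character \<theta>" shows "subgroup {z \<in> carrier G. [\<theta> z = 1] (mod int p)} G"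
proof (rule subgroup_finiteI[OF fin])
  show "{z \<in> carrier G. [\<theta> z = 1] (mod int p)} \<noteq> {}" using assms by (auto simp: character_def)
  fix x y assume xy: "x \<in> {z \<in> carrier G. [\<theta> z = 1] (mod int p)}" "y \<in> {z \<in> carrier G. [\<theta> z = 1] (mod int p)}"
  have "[\<theta> (x \<otimes> y) = \<theta> x * \<theta> y] (mod int p)" using assms xy by (simp add: character_def)
  also have "[\<theta> x * \<theta> y = 1 * 1] (mod int p)" using xy by (intro cong_mult) auto
  finally show "x \<otimes> y \<in> {z \<in> carrier G. [\<theta> z = 1] (mod int p)}" using xy by simp
qed auto

lemma character_conj:
  assumes "character \<theta>" "g \<in> carrier G" "u \<in> carrier G" "[\<theta> u = 1] (mod int p)"
  shows "[\<theta> (g \<otimes> u \<otimes> inv g) = 1] (mod int p)"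
proof -
  have m: "\<And>x y. x \<in> carrier G \<Longrightarrow> y \<in> carrier G \<Longrightarrow> [\<theta> (x \<otimes> y) = \<theta> x * \<theta> y] (mod int p)"
    using assms(1) by (simp add: character_def)
  have "[\<theta> (g \<otimes> u \<otimes> inv g) = \<theta> (g \<otimes> u) * \<theta> (inv g)] (mod int p)" using m assms by simp
  also have "[\<theta> (g \<otimes> u) * \<theta> (inv g) = (\<theta> g * \<theta> u) * \<theta> (inv g)] (mod int p)"
    using m assms by (intro cong_mult cong_refl) auto
  also have "[(\<theta> g * \<theta> u) * \<theta> (inv g) = (\<theta> g * 1) * \<theta> (inv g)] (mod int p)"
    by (intro cong_mult cong_refl assms(4))
  also have "[(\<theta> g * 1) * \<theta> (inv g) = 1] (mod int p)" using character_inv[OF assms(1,2)] by simp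
  finally show ?thesis .
qed

text \<open>If x has order at most 2^k, it lies in some H of order 2^k, where
  \<open>two_detects\<close> applies. A larger order is impossible: \<open><x>\<close> has a
  subgroup of order 2^k generated by a square h, at which all homomorphisms on G vanish, although
  the logarithm of h in \<open><h>\<close> is 1.\<close>

lemma two_detects_sylow:
  assumes P: "subgroup P G" "card P = p ^ n" and kn: "1 \<le> k" "k \<le> n" and M: "M_class (p ^ k) G" and p2: "p = 2"
  shows "detects (\<lambda>_. 1) P"
  unfolding detects_def
proof (intro ballI impI allI)
  fix x f assume x: "x \<in> P" and 0: "\<forall>\<delta>. cocycle (\<lambda>_. 1) \<delta> \<longrightarrow> int p dvd \<delta> x" and f: "phom p P f"
  have xc: "x \<in> carrier G" using x subgroup.mem_carrier[OF P(1)] by auto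
  have det: "detects (\<lambda>_. 1) H" if "subgroup H G" "card H = p ^ k" for H
    using two_detects[OF that(1) _ p2] M that unfolding M_class_def by blast
  have X: "subgroup (generate G {x}) G" "generate G {x} \<subseteq> P" "card (generate G {x}) = ord x"
    using generate_is_subgroup[of "{x}"] generate_subgroup_incl[of "{x}" P] generate_pow_card[OF xc] xc x P(1) by auto
  have "card (generate G {x}) dvd p ^ n" using card_subgroup_dvd[OF fin X(1) P(1) X(2)] P(2) by simp
  then obtain a where a: "ord x = p ^ a" using X(3) prime_p divides_primepow_nat by metis
  show "int p dvd f x"
  proof (cases "a \<le> k")
    case True
    then have "card (generate G {x}) \<le> p ^ k" using X(3) a p_pos by (simp add: power_increasing)
    then obtain H where H: "subgroup H G" "generate G {x} \<subseteq> H" "H \<subseteq> P" "card H = p ^ k"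
      using subgroup_between[OF P X(1,2) _ kn(2)] by blast
    have "x \<in> H" using H(2) generate.incl[of x "{x}" G] by blast
    then show ?thesis using det[OF H(1,4)] 0 phom_subset[OF f H(3)] unfolding detects_def by blast
  next
    case False
    define h where "h = x [^] (p ^ (a - k))"
    have hc: "h \<in> carrier G" using xc by (simp add: h_def)
    have "ord h = ord x div p ^ (a - k)"
      unfolding h_def by (rule ord_pow) (use xc a p_pos in \<open>auto simp: le_imp_power_dvd\<close>)
    also have "\<dots> = p ^ (a - (a - k))" using a p_pos by (simp add: power_diff)
    finally have oh: "ord h = p ^ k" using False by simp
    have H: "subgroup (generate G {h}) G" "card (generate G {h}) = p ^ k"
      using generate_is_subgroup[of "{h}"] generate_pow_card[OF hc] hc oh by auto
    have hH: "h \<in> generate G {h}" by (simp add: generate.incl)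
    obtain lg where lg: "\<And>i::nat. [lg (h [^] i) = int i] (mod int (ord h))"
      and lgh: "\<And>q. int q dvd int (ord h) \<Longrightarrow> phom q (generate G {h}) lg" using cyclic_log[OF hc] by blast
    have pk: "int p dvd int (ord h)" using oh kn by (simp add: dvd_power)
    have "int p dvd \<delta> h" if d: "cocycle (\<lambda>_. 1) \<delta>" for \<delta>
    proof -
      have "phom p P \<delta>" using cocycle_phom[OF d subgroup.subset[OF P(1)]] by simp
      then show ?thesis using cong_dvd_iff[OF phom_pow[OF P(1) _ x]] 0 d unfolding h_def by fastforce
    qed
    then have "int p dvd lg h" using det[OF H] hH lgh[OF pk] unfolding detects_def by blast
    moreover have "[lg h = 1] (mod int p)" using cong_dvd_modulus[OF lg[of 1] pk] hc by simp
    ultimately show ?thesis using p_pos by (simp add: cong_dvd_iff)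
  qed
qed

text \<open>As u does not generate H, some \<open>f2\<close> kills u but not v; subtracting a
  multiple of \<open>f2\<close> makes \<open>f0\<close> vanish at v.\<close>

lemma noncyclic_two_phoms:
  assumes H: "subgroup H G" "card H = p ^ k" "1 \<le> k" and nc: "\<And>x. x \<in> H \<Longrightarrow> ord x \<noteq> p ^ k"
  obtains f1 f2 u v where "phom p H f1" "phom p H f2" "u \<in> H" "\<not> int p dvd f1 u" "int p dvd f2 u"
    "v \<in> H" "int p dvd f1 v" "\<not> int p dvd f2 v"
proof -
  have Hc: "\<And>h. h \<in> H \<Longrightarrow> h \<in> carrier G" using subgroup.mem_carrier[OF H(1)] .
  have "card H \<noteq> 1" using H(2,3) p_pos one_less_power[of p k] by simp
  then have "H \<noteq> {\<one>}" by auto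
  then have triv: "{\<one>} \<subset> H" using subgroup.one_closed[OF H(1)] by auto
  obtain f0 u where f0: "phom p H f0" "u \<in> H" "\<not> int p dvd f0 u"
    using p_group_phom[OF H(1,2) triv_subgroup triv] by blast
  let ?U = "generate G {u}"
  have U: "subgroup ?U G" "?U \<subseteq> H" "card ?U = ord u"
    using generate_is_subgroup[of "{u}"] generate_subgroup_incl[of "{u}" H] generate_pow_card[of u] Hc f0 H(1) by auto
  then have "?U \<subset> H" using nc[OF f0(2)] H(2) by auto
  then obtain f2 v where f2: "phom p H f2" "\<And>s. s \<in> ?U \<Longrightarrow> int p dvd f2 s" "v \<in> H" "\<not> int p dvd f2 v"
    using p_group_phom[OF H(1,2) U(1)] by blast
  have f2u: "int p dvd f2 u" using f2(2) generate.incl[of u "{u}" G] by simp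
  obtain c :: nat where c: "[int c * f2 v = - f0 v] (mod int p)" using cong_solve_mod_p[OF f2(4)] by blast
  have f1: "phom p H (\<lambda>x. 1 * f0 x + int c * f2 x)" by (rule phom_lincomb[OF f0(1) f2(1)])
  have "int p dvd 1 * f0 v + int c * f2 v" using c by (simp add: cong_iff_dvd_diff add.commute)
  moreover have "\<not> int p dvd 1 * f0 u + int c * f2 u" using f0(3) f2u
    by (metis dvd_add_left_iff dvd_mult mult_1)
  ultimately show ?thesis using that[OF f1 f2(1) f0(2) _ f2u f2(3) _ f2(4)] by blast
qed

text \<open>Among the elements killed by all characters but not by all cocycles choose \<open>u\<close> with the fewest
  characters \<open>\<theta>\<close> having a \<open>\<theta>\<close>-cocycle nonzero at \<open>u\<close>. If there were two such characters, differing at \<open>g\<close>, then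
  \<open>(g - \<theta>\<^sub>1(g)) u\<close>, written multiplicatively, would be a better choice.\<close>

lemma noncyclic_detects_sylow:
  assumes P: "subgroup P G" "card P = p ^ n" "\<not> p dvd order G div card P" and kn: "1 \<le> k" "k \<le> n"
    and M: "M_class (p ^ k) G" and nc: "\<And>x. x \<in> P \<Longrightarrow> ord x \<noteq> p ^ k"
  obtains \<theta> where "character \<theta>" "detects \<theta> P"
proof -
  have Pc: "\<And>h. h \<in> P \<Longrightarrow> h \<in> carrier G" using subgroup.mem_carrier[OF P(1)] .
  \<comment> \<open>Reduced values and extensionality make congruent characters equal, so that they
    can be counted.\<close>
  define Ch where "Ch = {\<theta> \<in> carrier G \<rightarrow>\<^sub>E {0..<int p}. character \<theta>}"
  have finCh: "finite Ch" unfolding Ch_def using finite_PiE[OF fin, of "\<lambda>_. {0..<int p}"] by simp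
  have chc: "character \<theta>" if "\<theta> \<in> Ch" for \<theta> using that by (simp add: Ch_def)
  have normalize: "\<exists>\<theta>'\<in>Ch. detects \<theta>' H" if ch: "character \<theta>" and d: "detects \<theta> H" for \<theta> H
  proof
    let ?t = "restrict (\<lambda>g. \<theta> g mod int p) (carrier G)"
    have e: "[?t g = \<theta> g] (mod int p)" if "g \<in> carrier G" for g using that by (simp add: cong_def)
    have "character ?t"
      unfolding character_def
    proof (intro conjI ballI)
      show "[?t \<one> = 1] (mod int p)" using ch by (simp add: character_def cong_def)
      fix x y assume xy: "x \<in> carrier G" "y \<in> carrier G"
      have "[?t (x \<otimes> y) = \<theta> (x \<otimes> y)] (mod int p)" using e xy by blast
      also have "[\<theta> (x \<otimes> y) = \<theta> x * \<theta> y] (mod int p)" using ch xy by (simp add: character_def)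
      also have "[\<theta> x * \<theta> y = ?t x * ?t y] (mod int p)" using e xy by (intro cong_mult) (auto intro: cong_sym)
      finally show "[?t (x \<otimes> y) = ?t x * ?t y] (mod int p)" .
    qed
    then show "?t \<in> Ch" using p_pos by (auto simp: Ch_def)
    have "cocycle ?t \<delta>" if c: "cocycle \<theta> \<delta>" for \<delta>
      unfolding cocycle_def
    proof (intro ballI)
      fix x y assume xy: "x \<in> carrier G" "y \<in> carrier G"
      have "[\<delta> (x \<otimes> y) = \<delta> x + \<theta> x * \<delta> y] (mod int p)" using c xy by (simp add: cocycle_def)
      also have "[\<delta> x + \<theta> x * \<delta> y = \<delta> x + ?t x * \<delta> y] (mod int p)"
        using e[OF xy(1)] by (intro cong_add cong_mult cong_refl) (rule cong_sym)
      finally show "[\<delta> (x \<otimes> y) = \<delta> x + ?t x * \<delta> y] (mod int p)" .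
    qed
    then show "detects ?t H" using d unfolding detects_def by blast
  qed
  have two: "\<exists>f1 f2 u v. phom p H f1 \<and> phom p H f2 \<and> u \<in> H \<and> \<not> int p dvd f1 u \<and> int p dvd f2 u \<and>
    v \<in> H \<and> int p dvd f1 v \<and> \<not> int p dvd f2 v" if "subgroup H G" "card H = p ^ k" "H \<subseteq> P" for H
  proof -
    have "\<And>x. x \<in> H \<Longrightarrow> ord x \<noteq> p ^ k" using nc that(3) by blast
    from noncyclic_two_phoms[OF that(1,2) kn(1) this] show ?thesis by metis
  qed
  have star: "\<exists>\<theta>\<in>Ch. detects \<theta> H" if H: "subgroup H G" "card H = p ^ k" "H \<subseteq> P" for H
  proof -
    obtain f1 f2 u v where f: "phom p H f1" "phom p H f2" "u \<in> H" "\<not> int p dvd f1 u" "int p dvd f2 u"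
      "v \<in> H" "int p dvd f1 v" "\<not> int p dvd f2 v" using two[OF H] by blast
    have "M_supplemented H G" using M H unfolding M_class_def by blast
    then obtain \<theta> where "character \<theta>" "detects \<theta> H" using noncyclic_detects[OF H(1) _ f] by blast
    then show ?thesis using normalize by blast
  qed
  define van where "van \<theta> u \<longleftrightarrow> (\<forall>\<delta>. cocycle \<theta> \<delta> \<longrightarrow> int p dvd \<delta> u)" for \<theta> u
  define B where "B u = {\<theta> \<in> Ch. \<not> van \<theta> u}" for u
  define U where "U = {u \<in> carrier G. (\<forall>\<theta>\<in>Ch. [\<theta> u = 1] (mod int p)) \<and> B u \<noteq> {}}"
  have chP: "[\<theta> u = 1] (mod int p)" if "u \<in> P" "\<theta> \<in> Ch" for u \<theta>
    using character_p_subgroup[OF chc[OF that(2)] P(1,2) that(1)] .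
  have Une: "U \<noteq> {}"
  proof -
    obtain H where H: "subgroup H G" "H \<subseteq> P" "card H = p ^ k"
      using subgroup_between[OF P(1,2) triv_subgroup _ _ kn(2)] subgroup.one_closed[OF P(1)] p_pos by auto
    obtain \<theta> where \<theta>: "\<theta> \<in> Ch" "detects \<theta> H" using star[OF H(1,3,2)] by blast
    obtain f1 u where f: "phom p H f1" "u \<in> H" "\<not> int p dvd f1 u" using two[OF H(1,3,2)] by blast
    have "\<not> van \<theta> u" using \<theta>(2) f unfolding detects_def van_def by blast
    then have "u \<in> U" using \<theta>(1) f(2) H(2) chP Pc by (auto simp: U_def B_def)
    then show ?thesis by blast
  qed
  then obtain u where u: "u \<in> U" and least: "\<And>w. w \<in> U \<Longrightarrow> card (B u) \<le> card (B w)"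
    using ex_has_least_nat[of "\<lambda>u. u \<in> U" _ "\<lambda>u. card (B u)"] by blast
  have uc: "u \<in> carrier G" and u1: "\<And>\<theta>. \<theta> \<in> Ch \<Longrightarrow> [\<theta> u = 1] (mod int p)" using u by (auto simp: U_def)
  obtain \<theta>2 where \<theta>2: "\<theta>2 \<in> B u" using u by (auto simp: U_def)
  have Bu: "B u = {\<theta>2}"
  proof (rule ccontr)
    assume "B u \<noteq> {\<theta>2}"
    then obtain \<theta>1 where \<theta>1: "\<theta>1 \<in> B u" "\<theta>1 \<noteq> \<theta>2" using \<theta>2 by blast
    have PE: "\<theta>1 \<in> carrier G \<rightarrow>\<^sub>E {0..<int p}" "\<theta>2 \<in> carrier G \<rightarrow>\<^sub>E {0..<int p}"
      using \<theta>1 \<theta>2 by (auto simp: B_def Ch_def)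
    then obtain g where g: "g \<in> carrier G" "\<theta>1 g \<noteq> \<theta>2 g" using PiE_ext[OF PE] \<theta>1(2) by blast
    have rng: "0 \<le> \<theta>1 g" "\<theta>1 g < int p" "0 \<le> \<theta>2 g" "\<theta>2 g < int p" using PE g(1) by (auto simp: PiE_iff)
    have ncong: "\<not> int p dvd \<theta>2 g - \<theta>1 g"
    proof
      assume "int p dvd \<theta>2 g - \<theta>1 g"
      then have "[\<theta>2 g = \<theta>1 g] (mod int p)" by (simp add: cong_iff_dvd_diff)
      then show False using rng g(2) by (simp add: cong_def)
    qed
    \<comment> \<open>A nonnegative stand-in for the exponent \<open>- \<theta>1 g\<close>. With it,
      each \<open>\<theta>\<close>-cocycle at w is its value at u times
      \<open>\<theta> g - \<theta>1 g\<close>, which kills the contribution of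
      \<open>\<theta>1\<close> but not that of \<open>\<theta>2\<close>.\<close>
    define m where "m = nat (int p - \<theta>1 g)"
    have m: "int m = int p - \<theta>1 g" using rng by (simp add: m_def)
    define w where "w = (g \<otimes> u \<otimes> inv g) \<otimes> u [^] m"
    have wc: "w \<in> carrier G" using g uc by (simp add: w_def)
    have w: "[\<theta> w = 1] (mod int p)" "cocycle \<theta> \<delta> \<Longrightarrow> [\<delta> w = (\<theta> g - \<theta>1 g) * \<delta> u] (mod int p)" if \<theta>: "\<theta> \<in> Ch" for \<theta> \<delta>
    proof -
      let ?K = "{z \<in> carrier G. [\<theta> z = 1] (mod int p)}"
      have K: "subgroup ?K G" by (rule character_kernel_subgroup[OF chc[OF \<theta>]])
      have uK: "u \<in> ?K" using uc u1[OF \<theta>] by simp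
      have gK: "g \<otimes> u \<otimes> inv g \<in> ?K" using character_conj[OF chc[OF \<theta>] g(1) uc u1[OF \<theta>]] g(1) uc by simp
      have umK: "u [^] m \<in> ?K" by (rule subgroup_nat_pow_closed[OF K uK])
      have "w \<in> ?K" unfolding w_def by (rule subgroup.m_closed[OF K gK umK])
      then show "[\<theta> w = 1] (mod int p)" by simp
      assume \<delta>: "cocycle \<theta> \<delta>"
      have ph: "phom p ?K \<delta>" by (rule cocycle_phom[OF \<delta>]) auto
      have "[\<delta> w = \<delta> (g \<otimes> u \<otimes> inv g) + \<delta> (u [^] m)] (mod int p)" unfolding w_def by (rule phom_mult[OF ph gK umK])
      also have "[\<delta> (g \<otimes> u \<otimes> inv g) + \<delta> (u [^] m) = \<theta> g * \<delta> u + int m * \<delta> u] (mod int p)"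
        by (rule cong_add[OF cocycle_conj[OF chc[OF \<theta>] \<delta> g(1) uc u1[OF \<theta>]] phom_pow[OF K ph uK]])
      also have "[\<theta> g * \<delta> u + int m * \<delta> u = (\<theta> g - \<theta>1 g) * \<delta> u] (mod int p)"
        unfolding m by (simp add: cong_iff_dvd_diff algebra_simps)
      finally show "[\<delta> w = (\<theta> g - \<theta>1 g) * \<delta> u] (mod int p)" .
    qed
    have "B w \<subseteq> B u - {\<theta>1}"
    proof
      fix \<theta> assume "\<theta> \<in> B w"
      then obtain \<delta> where \<delta>: "\<theta> \<in> Ch" "cocycle \<theta> \<delta>" "\<not> int p dvd \<delta> w" by (auto simp: B_def van_def)
      then have "\<not> int p dvd (\<theta> g - \<theta>1 g) * \<delta> u" using cong_dvd_iff[OF w(2)[OF \<delta>(1,2)]] by simp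
      then have "\<not> int p dvd \<delta> u" "\<theta> \<noteq> \<theta>1" by auto
      then show "\<theta> \<in> B u - {\<theta>1}" using \<delta> by (auto simp: B_def van_def)
    qed
    moreover have "\<theta>2 \<in> B w"
    proof -
      obtain \<delta> where \<delta>: "\<theta>2 \<in> Ch" "cocycle \<theta>2 \<delta>" "\<not> int p dvd \<delta> u" using \<theta>2 by (auto simp: B_def van_def)
      then have "\<not> int p dvd (\<theta>2 g - \<theta>1 g) * \<delta> u" using ncong prime_int_p by (simp add: prime_dvd_mult_iff)
      then have "\<not> int p dvd \<delta> w" using cong_dvd_iff[OF w(2)[OF \<delta>(1,2)]] by simp
      then show ?thesis using \<delta> by (auto simp: B_def van_def)
    qed
    ultimately have "B w \<subset> B u" "B w \<noteq> {}" using \<theta>1 by auto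
    moreover have "finite (B u)" using finCh by (simp add: B_def)
    ultimately have "card (B w) < card (B u)" by (simp add: psubset_card_mono)
    moreover have "w \<in> U" using wc w(1) \<open>B w \<noteq> {}\<close> by (simp add: U_def)
    ultimately show False using least by fastforce
  qed
  \<comment> \<open>Moving u into P multiplies each cocycle value by units only, namely e and
    \<open>\<theta> b\<close>.\<close>
  obtain b e where b: "b \<in> carrier G" "[e = 1] (mod p)" "b \<otimes> u [^] (e::nat) \<otimes> inv b \<in> P"
    using p_element_conj[OF P uc] by blast
  define x where "x = b \<otimes> u [^] e \<otimes> inv b"
  have xP: "x \<in> P" using b(3) by (simp add: x_def)
  have vanx: "van \<theta> x \<longleftrightarrow> van \<theta> u" if \<theta>: "\<theta> \<in> Ch" for \<theta>
  proof -
    have "int p dvd \<delta> x \<longleftrightarrow> int p dvd \<delta> u" if \<delta>: "cocycle \<theta> \<delta>" for \<delta>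
    proof -
      let ?K = "{z \<in> carrier G. [\<theta> z = 1] (mod int p)}"
      have K: "subgroup ?K G" by (rule character_kernel_subgroup[OF chc[OF \<theta>]])
      have uK: "u \<in> ?K" using uc u1[OF \<theta>] by simp
      have ueK: "u [^] e \<in> ?K" by (rule subgroup_nat_pow_closed[OF K uK])
      have ph: "phom p ?K \<delta>" by (rule cocycle_phom[OF \<delta>]) auto
      have "[\<delta> x = \<theta> b * \<delta> (u [^] e)] (mod int p)"
        unfolding x_def by (rule cocycle_conj[OF chc[OF \<theta>] \<delta> b(1)]) (use ueK in auto)
      also have "[\<theta> b * \<delta> (u [^] e) = \<theta> b * (int e * \<delta> u)] (mod int p)"
        by (rule cong_mult[OF cong_refl phom_pow[OF K ph uK]])
      finally have "int p dvd \<delta> x \<longleftrightarrow> int p dvd \<theta> b * (int e * \<delta> u)" by (rule cong_dvd_iff)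
      moreover have "\<not> int p dvd int e"
      proof
        assume "int p dvd int e"
        then have "p dvd 1" using cong_dvd_iff[OF b(2)] by (simp add: int_dvd_int_iff)
        then show False using p_pos by simp
      qed
      moreover have "\<not> int p dvd \<theta> b" by (rule character_nonzero[OF chc[OF \<theta>] b(1)])
      ultimately show ?thesis using prime_int_p by (simp add: prime_dvd_mult_iff)
    qed
    then show ?thesis unfolding van_def by blast
  qed
  have \<theta>2C: "\<theta>2 \<in> Ch" using \<theta>2 by (simp add: B_def)
  have vx: "van \<theta> x" if "\<theta> \<in> Ch" "\<theta> \<noteq> \<theta>2" for \<theta> using Bu vanx[OF that(1)] that by (auto simp: B_def)
  obtain \<delta>x where \<delta>x: "cocycle \<theta>2 \<delta>x" "\<not> int p dvd \<delta>x x"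
    using \<theta>2 vanx[OF \<theta>2C] by (auto simp: B_def van_def)
  have "detects \<theta>2 P"
    unfolding detects_def
  proof (intro ballI impI allI, rule ccontr)
    fix v f assume v: "v \<in> P" and "\<forall>\<delta>. cocycle \<theta>2 \<delta> \<longrightarrow> int p dvd \<delta> v" and f: "phom p P f" "\<not> int p dvd f v"
    then have vv: "van \<theta>2 v" by (simp add: van_def)
    let ?J = "generate G {x, v}"
    have J: "subgroup ?J G" "?J \<subseteq> P" "x \<in> ?J" "v \<in> ?J"
      using generate_is_subgroup[of "{x, v}"] generate_subgroup_incl[of "{x, v}" P] xP v Pc P(1)
      by (auto intro: generate.incl)
    have "card ?J dvd p ^ n" using card_subgroup_dvd[OF fin J(1) P(1) J(2)] P(2) by simp
    then obtain j where j: "card ?J = p ^ j" using prime_p divides_primepow_nat by blast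
    \<comment> \<open>\<open>star\<close> only concerns order \<open>p^k\<close>. If J lies in H,
      the character of H misses v when it is \<open>\<theta>2\<close>, and x otherwise.\<close>
    have "\<exists>H. subgroup H G \<and> card H = p ^ k \<and> H \<subseteq> P \<and> (?J \<subseteq> H \<or> H \<subseteq> ?J)"
    proof (cases "j \<le> k")
      case True
      then have "card ?J \<le> p ^ k" using j p_pos by (simp add: power_increasing)
      then show ?thesis using subgroup_between[OF P(1,2) J(1,2) _ kn(2)] by metis
    next
      case False
      then have "k \<le> j" by simp
      then obtain H where "subgroup H G" "H \<subseteq> ?J" "card H = p ^ k"
        using subgroup_between[OF J(1) j triv_subgroup _ _ \<open>k \<le> j\<close>] subgroup.one_closed[OF J(1)] p_pos by auto
      then show ?thesis using J(2) by blast
    qed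
    then obtain H where H: "subgroup H G" "card H = p ^ k" "H \<subseteq> P" "?J \<subseteq> H \<or> H \<subseteq> ?J" by blast
    obtain \<theta> where \<theta>: "\<theta> \<in> Ch" "detects \<theta> H" using star[OF H(1-3)] by blast
    have det: "int p dvd h z" if "z \<in> H" "van \<theta> z" "phom p H h" for z h
      using \<theta>(2) that unfolding detects_def van_def by blast
    show False
    proof (cases "?J \<subseteq> H")
      case True
      show False
      proof (cases "\<theta> = \<theta>2")
        case \<theta>eq: True
        then show False using det[of v f] vv True J(4) phom_subset[OF f(1) H(3)] f(2) by blast
      next
        case False
        have "phom p H \<delta>x"
          by (rule phom_subset[OF cocycle_phom_p_subgroup[OF P(1,2) chc[OF \<theta>2C] \<delta>x(1)] H(3)])
        then show False using det[of x \<delta>x] vx[OF \<theta>(1) False] True J(3) \<delta>x(2) by blast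
      qed
    next
      case False
      then have HJ: "H \<subseteq> ?J" using H(4) by blast
      \<comment> \<open>The other one of x, v is a common zero of the
        \<open>\<theta>\<close>-cocycles, so on J each of them is determined by its value at
        z.\<close>
      define z where "z = (if \<theta> = \<theta>2 then x else v)"
      have z: "z \<in> P" using xP v by (simp add: z_def)
      define E where "E = {h \<in> P. \<exists>e::int. \<forall>\<delta>. cocycle \<theta> \<delta> \<longrightarrow> [\<delta> h = e * \<delta> z] (mod int p)}"
      have ph: "phom p P \<delta>" if "cocycle \<theta> \<delta>" for \<delta> by (rule cocycle_phom_p_subgroup[OF P(1,2) chc[OF \<theta>(1)] that])
      have E: "subgroup E G"
      proof (rule subgroup_finiteI[OF fin])
        show "E \<subseteq> carrier G" using Pc by (auto simp: E_def)
        have "z \<in> E" using z by (auto simp: E_def intro!: exI[of _ 1])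
        then show "E \<noteq> {}" by blast
        fix h h' assume "h \<in> E" "h' \<in> E"
        then obtain e e' where h: "h \<in> P" "h' \<in> P" "\<And>\<delta>. cocycle \<theta> \<delta> \<Longrightarrow> [\<delta> h = e * \<delta> z] (mod int p)"
          "\<And>\<delta>. cocycle \<theta> \<delta> \<Longrightarrow> [\<delta> h' = e' * \<delta> z] (mod int p)" by (auto simp: E_def)
        have "[\<delta> (h \<otimes> h') = (e + e') * \<delta> z] (mod int p)" if d: "cocycle \<theta> \<delta>" for \<delta>
          using cong_trans[OF phom_mult[OF ph[OF d] h(1,2)] cong_add[OF h(3)[OF d] h(4)[OF d]]]
          by (simp add: distrib_right)
        then show "h \<otimes> h' \<in> E" using subgroup.m_closed[OF P(1) h(1,2)] by (auto simp: E_def)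
      qed
      have zE: "z \<in> E" using z by (auto simp: E_def intro!: exI[of _ 1])
      have vE: "y \<in> E" if "y \<in> P" "van \<theta> y" for y
        using that by (auto simp: E_def van_def cong_0_iff intro!: exI[of _ 0])
      have "x \<in> E" "v \<in> E"
        using vE[OF xP] vx[OF \<theta>(1)] vE[OF v] vv zE by (auto simp: z_def split: if_splits)
      then have "?J \<subseteq> E" using generate_subgroup_incl[OF _ E, of "{x, v}"] by simp
      then have HE: "H \<subseteq> E" using HJ by blast
      obtain f1 f2 a c where ff: "phom p H f1" "phom p H f2" "a \<in> H" "\<not> int p dvd f1 a" "int p dvd f2 a"
        "c \<in> H" "int p dvd f1 c" "\<not> int p dvd f2 c" using two[OF H(1-3)] by blast
      obtain ea where ea: "\<And>\<delta>. cocycle \<theta> \<delta> \<Longrightarrow> [\<delta> a = ea * \<delta> z] (mod int p)" using HE ff(3) by (auto simp: E_def)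
      obtain ec where ec: "\<And>\<delta>. cocycle \<theta> \<delta> \<Longrightarrow> [\<delta> c = ec * \<delta> z] (mod int p)" using HE ff(6) by (auto simp: E_def)
      show False
      proof (cases "int p dvd ec")
        case True
        then have "van \<theta> c" unfolding van_def using cong_dvd_iff[OF ec] by simp
        then show False using det[OF ff(6) _ ff(2)] ff(8) by blast
      next
        case False
        \<comment> \<open>All cocycles are proportional on H, so one combination a c^i is a common
          zero; but \<open>f1\<close> kills c and not a.\<close>
        obtain i :: nat where i: "[int i * ec = - ea] (mod int p)" using cong_solve_mod_p[OF False] by blast
        have ci: "c [^] i \<in> H" by (rule subgroup_nat_pow_closed[OF H(1) ff(6)])
        have "int p dvd \<delta> (a \<otimes> c [^] i)" if d: "cocycle \<theta> \<delta>" for \<delta>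
        proof -
          have phH: "phom p H \<delta>" by (rule phom_subset[OF ph[OF d] H(3)])
          have "[\<delta> (a \<otimes> c [^] i) = ea * \<delta> z + int i * (ec * \<delta> z)] (mod int p)"
            by (rule cong_trans[OF phom_mult[OF phH ff(3) ci] cong_add[OF ea[OF d]
              cong_trans[OF phom_pow[OF H(1) phH ff(6)] cong_mult[OF cong_refl ec[OF d]]]]])
          also have "ea * \<delta> z + int i * (ec * \<delta> z) = (ea + int i * ec) * \<delta> z" by (simp add: algebra_simps)
          finally show ?thesis using i by (simp add: cong_dvd_iff) (simp add: cong_iff_dvd_diff add.commute)
        qed
        then have "int p dvd f1 (a \<otimes> c [^] i)"
          using det[OF subgroup.m_closed[OF H(1) ff(3) ci] _ ff(1)] unfolding van_def by blast
        moreover have "int p dvd f1 (c [^] i)" using cong_dvd_iff[OF phom_pow[OF H(1) ff(1,6)], of i] ff(7) by simp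
        ultimately show False
          using phom_mult[OF ff(1,3) ci] ff(4) by (metis cong_dvd_iff dvd_add_left_iff)
      qed
    qed
  qed
  then show ?thesis using that chc[OF \<theta>2C] by blast
qed

text \<open>Mod 2 the trivial character is the only one, so no distinction by cyclicity is made
  there. For odd p, a cyclic H of order \<open>p^k\<close> is already all of P.\<close>

theorem M_class_detects_sylow:
  assumes P: "subgroup P G" "card P = p ^ n" "\<not> p dvd order G div card P" and k: "2 \<le> k" "k \<le> n"
    and M: "M_class (p ^ k) G"
  obtains \<theta> where "character \<theta>" "detects \<theta> P"
proof (cases "p = 2")
  case True
  have "character (\<lambda>_. 1)" by (simp add: character_def)
  then show ?thesis using that two_detects_sylow[OF P(1,2) _ k(2) M True] k(1) by simp
next
  case p2: False
  show ?thesis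
  proof (cases "\<exists>x\<in>P. ord x = p ^ k")
    case True
    then obtain x where x: "x \<in> P" "ord x = p ^ k" by blast
    have xc: "x \<in> carrier G" using x(1) subgroup.mem_carrier[OF P(1)] by auto
    have gen: "P = generate G {x}" by (rule odd_cyclic_sylow[OF P(1,2) k(1) p2 M x])
    then have cP: "card P = p ^ k" using generate_pow_card[OF xc] x(2) by simp
    have "\<exists>i::nat. y = x [^] i" if "y \<in> P" for y
      using that gen generate_pow_on_finite_carrier[OF fin xc] by auto
    moreover have "M_supplemented P G" using M P(1) cP unfolding M_class_def by blast
    ultimately show ?thesis using cyclic_sylow_detects[OF P(1) cP P(3) k(1) _ x(1)] that by blast
  next
    case False
    then show ?thesis using noncyclic_detects_sylow[OF P _ k(2) M] k(1) that by auto
  qed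
qed

section \<open>Primitive roots and the image of a character\<close>

lemma primitive_root_int:
  obtains a :: int where "\<And>b. \<not> int p dvd b \<Longrightarrow> \<exists>e::nat. [b = a ^ e] (mod int p)"
    "\<And>j::nat. [a ^ j = 1] (mod int p) \<Longrightarrow> p - 1 dvd j" "\<not> int p dvd a"
proof -
  obtain g where g: "residue_primroot p g" using prime_primitive_root_exists[OF p_pos(2) prime_p] by blast
  have "\<exists>e::nat. [b = int g ^ e] (mod int p)" if b: "\<not> int p dvd b" for b
  proof -
    define c where "c = nat (b mod int p)"
    have c: "int c = b mod int p" using p_pos by (simp add: c_def)
    have "c > 0" using b c by (metis mod_0_imp_dvd neq0_conv of_nat_0)
    have "c < p" using c p_pos by (metis of_nat_0_less_iff of_nat_less_iff pos_mod_bound)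
    then have "c \<in> totatives p" using \<open>c > 0\<close> prime_p p_pos by (simp add: totatives_prime)
    then obtain e where "c = g ^ e mod p"
      using residue_primroot_is_generator[OF p_pos(2) g] by (auto simp: bij_betw_def)
    then have "[int c = int (g ^ e)] (mod int p)" by (simp add: cong_def zmod_int)
    moreover have "[b = int c] (mod int p)" using c by (simp add: cong_def)
    ultimately show ?thesis by (metis cong_trans of_nat_power)
  qed
  moreover have "p - 1 dvd j" if j: "[int g ^ j = 1] (mod int p)" for j :: nat
  proof -
    have "[g ^ j = 1] (mod p)" using j by (metis cong_int_iff of_nat_1 of_nat_power)
    then have "Pocklington.ord p g dvd j" by (simp add: ord_divides')
    then show ?thesis using g prime_p by (simp add: residue_primroot_def totient_prime)
  qed
  moreover have "\<not> int p dvd int g"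
  proof
    assume "int p dvd int g"
    then have "p dvd g" by (simp add: int_dvd_int_iff)
    moreover have "coprime p g" using g by (simp add: residue_primroot_def)
    ultimately show False using p_pos by (metis coprime_absorb_left less_irrefl nat_dvd_1_iff_1)
  qed
  ultimately show ?thesis using that by blast
qed

text \<open>The values form a subgroup of the cyclic group of units mod p; c realizes the least
  positive exponent of a primitive root, and division with remainder does the rest.\<close>

lemma character_image_cyclic:
  assumes \<theta>: "character \<theta>"
  obtains c where "c \<in> carrier G" "\<And>g. g \<in> carrier G \<Longrightarrow> \<exists>i::nat. [\<theta> (g \<otimes> inv (c [^] i)) = 1] (mod int p)"
proof -
  obtain a where a: "\<And>b. \<not> int p dvd b \<Longrightarrow> \<exists>e::nat. [b = a ^ e] (mod int p)" "\<not> int p dvd a"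
    using primitive_root_int by metis
  define I where "I e \<longleftrightarrow> e > 0 \<and> (\<exists>g\<in>carrier G. [\<theta> g = a ^ e] (mod int p))" for e
  have t1: "[\<theta> \<one> = 1] (mod int p)" using \<theta> by (simp add: character_def)
  show ?thesis
  proof (cases "p = 2")
    case True
    have "[\<theta> (g \<otimes> inv (\<one> [^] i)) = 1] (mod int p)" if "g \<in> carrier G" for g and i :: nat
      using character_nonzero[OF \<theta> that] that True by (simp add: cong_iff_dvd_diff)
    then show ?thesis using that[of \<one>] by blast
  next
    case False
    have "I (p - 1)" unfolding I_def
    proof
      show "p - 1 > 0" using p_pos by simp
      show "\<exists>g\<in>carrier G. [\<theta> g = a ^ (p - 1)] (mod int p)"
        using cong_trans[OF t1 cong_sym[OF fermat_int[OF a(2)]]] by blast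
    qed
    define d where "d = (LEAST e. I e)"
    have d: "I d" and least: "\<And>e. I e \<Longrightarrow> d \<le> e"
      unfolding d_def using LeastI[of I, OF \<open>I (p - 1)\<close>] Least_le[of I] by auto
    obtain c where c: "c \<in> carrier G" "[\<theta> c = a ^ d] (mod int p)" and dpos: "d > 0" using d by (auto simp: I_def)
    have "\<exists>i::nat. [\<theta> (g \<otimes> inv (c [^] i)) = 1] (mod int p)" if g: "g \<in> carrier G" for g
    proof -
      obtain e where e: "[\<theta> g = a ^ e] (mod int p)" using a(1)[OF character_nonzero[OF \<theta> g]] by blast
      define q r where "q = e div d" and "r = e mod d"
      have eq: "e = d * q + r" by (simp add: q_def r_def)
      define h where "h = g \<otimes> inv (c [^] q)"
      have h: "h \<in> carrier G" "g = h \<otimes> c [^] q" using g c by (simp_all add: h_def m_assoc)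
      have "[\<theta> g = \<theta> h * \<theta> (c [^] q)] (mod int p)"
        using \<theta> h c by (simp add: character_def)
      also have "[\<theta> h * \<theta> (c [^] q) = \<theta> h * (a ^ d) ^ q] (mod int p)"
        by (rule cong_mult[OF cong_refl cong_trans[OF character_pow[OF \<theta> c(1)] cong_pow[OF c(2)]]])
      finally have "[\<theta> h * (a ^ d) ^ q = a ^ e] (mod int p)" using e by (metis cong_sym cong_trans)
      moreover have "a ^ e = a ^ r * (a ^ d) ^ q" by (simp add: eq power_add power_mult)
      ultimately have "[\<theta> h * (a ^ d) ^ q = a ^ r * (a ^ d) ^ q] (mod int p)" by simp
      moreover have "coprime ((a ^ d) ^ q) (int p)"
        using a(2) prime_int_p by (metis coprime_commute coprime_power_left_iff prime_imp_coprime)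
      ultimately have hr: "[\<theta> h = a ^ r] (mod int p)" by (simp add: cong_mult_rcancel)
      have "r = 0"
      proof (rule ccontr)
        assume "r \<noteq> 0"
        then have "I r" using h(1) hr by (auto simp: I_def)
        then have "d \<le> r" by (rule least)
        then show False using mod_less_divisor[OF dpos, of e] by (simp add: r_def)
      qed
      then show ?thesis using hr by (auto simp: h_def)
    qed
    then show ?thesis using that c(1) by blast
  qed
qed

text \<open>\<open>Y\<close> is the kernel of \<open>\<theta>\<close>, and \<open>R\<close> comes from Tate's theorem for the common zeros of the \<open>\<theta>\<close>-cocycles in \<open>Y\<close>.\<close>

theorem detects_normal_series:
  assumes P: "subgroup P G" "card P = p ^ n" "\<not> p dvd order G div card P"
    and \<theta>: "character \<theta>" and det: "detects \<theta> P"
  obtains Y R c where "Y \<lhd> G" "R \<lhd> G" "\<not> p dvd card R" "\<And>y. y \<in> Y \<Longrightarrow> y [^] (p ^ n) \<in> R"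
    "c \<in> carrier G" "c [^] (p - 1) \<in> Y" "\<And>g. g \<in> carrier G \<Longrightarrow> \<exists>i::nat. g \<otimes> inv (c [^] i) \<in> Y"
proof -
  define Y where "Y = {z \<in> carrier G. [\<theta> z = 1] (mod int p)}"
  have sY: "subgroup Y G" unfolding Y_def by (rule character_kernel_subgroup[OF \<theta>])
  have Yc: "\<And>z. z \<in> Y \<Longrightarrow> z \<in> carrier G" by (simp add: Y_def)
  have Yn: "g \<otimes> z \<otimes> inv g \<in> Y" if "g \<in> carrier G" "z \<in> Y" for g z
    using character_conj[OF \<theta> that(1)] that by (simp add: Y_def)
  have nY: "Y \<lhd> G" using sY Yn by (simp add: normal_inv_iff)
  have PY: "P \<subseteq> Y" using character_p_subgroup[OF \<theta> P(1,2)] subgroup.mem_carrier[OF P(1)] by (auto simp: Y_def)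
  have ph: "phom p Y \<delta>" if "cocycle \<theta> \<delta>" for \<delta> by (rule cocycle_phom[OF that]) (auto simp: Y_def)
  define W where "W = {z \<in> Y. \<forall>\<delta>. cocycle \<theta> \<delta> \<longrightarrow> int p dvd \<delta> z}"
  have sW: "subgroup W G"
  proof (rule subgroup_finiteI[OF fin])
    show "W \<subseteq> carrier G" using Yc by (auto simp: W_def)
    show "W \<noteq> {}" using cocycle_one[OF \<theta>] subgroup.one_closed[OF sY] by (auto simp: W_def)
    fix x y assume "x \<in> W" "y \<in> W"
    then have xy: "x \<in> Y" "y \<in> Y" "\<And>\<delta>. cocycle \<theta> \<delta> \<Longrightarrow> int p dvd \<delta> x" "\<And>\<delta>. cocycle \<theta> \<delta> \<Longrightarrow> int p dvd \<delta> y"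
      by (auto simp: W_def)
    have "int p dvd \<delta> (x \<otimes> y)" if "cocycle \<theta> \<delta>" for \<delta>
      using cong_dvd_iff[OF phom_mult[OF ph[OF that] xy(1,2)]] xy(3,4)[OF that] by simp
    then show "x \<otimes> y \<in> W" using subgroup.m_closed[OF sY xy(1,2)] by (simp add: W_def)
  qed
  interpret Y: group "G\<lparr>carrier := Y\<rparr>" by (rule subgroup_imp_group[OF sY])
  interpret Y: prime_group "G\<lparr>carrier := Y\<rparr>" p
    using finite_subset[OF subgroup.subset[OF sY] fin] prime_p by unfold_locales auto
  have invY: "inv\<^bsub>G\<lparr>carrier := Y\<rparr>\<^esub> x = inv x" if "x \<in> Y" for x using m_inv_consistent[OF sY that] .
  have nW: "W \<lhd> G\<lparr>carrier := Y\<rparr>"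
    unfolding Y.normal_inv_iff
  proof (intro conjI ballI)
    show "subgroup W (G\<lparr>carrier := Y\<rparr>)" by (rule subgroup_incl[OF sW sY]) (auto simp: W_def)
    fix x h assume "x \<in> carrier (G\<lparr>carrier := Y\<rparr>)" and h: "h \<in> W"
    then have x: "x \<in> Y" "x \<in> carrier G" using Yc by auto
    have hY: "h \<in> Y" using h by (simp add: W_def)
    have "int p dvd \<delta> (x \<otimes> h \<otimes> inv x)" if "cocycle \<theta> \<delta>" for \<delta>
      using cong_dvd_iff[OF phom_conj[OF sY ph[OF that] x(1) hY]] h that by (simp add: W_def)
    then show "x \<otimes>\<^bsub>G\<lparr>carrier := Y\<rparr>\<^esub> h \<otimes>\<^bsub>G\<lparr>carrier := Y\<rparr>\<^esub> inv\<^bsub>G\<lparr>carrier := Y\<rparr>\<^esub> x \<in> W"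
      using Yn[OF x(2) hY] x(1) by (simp add: W_def invY)
  qed
  have PYs: "subgroup P (G\<lparr>carrier := Y\<rparr>)" by (rule subgroup_incl[OF P(1) sY PY])
  have "\<not> p dvd order (G\<lparr>carrier := Y\<rparr>) div card P"
    using index_in_subgroup[OF P(1) sY PY P(3)] by (simp add: order_def)
  then have "\<exists>R. R \<lhd> G\<lparr>carrier := Y\<rparr> \<and> \<not> p dvd card R \<and>
    (\<forall>g\<in>carrier (G\<lparr>carrier := Y\<rparr>). \<exists>x\<in>P. g \<otimes>\<^bsub>G\<lparr>carrier := Y\<rparr>\<^esub> inv\<^bsub>G\<lparr>carrier := Y\<rparr>\<^esub> x \<in> R)"
  proof (rule Y.tate_normal_p_complement[OF PYs P(2) _ nW])
    fix g assume "g \<in> carrier (G\<lparr>carrier := Y\<rparr>)"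
    then have g: "g \<in> Y" by simp
    obtain b e where b: "b \<in> Y" "[e = 1] (mod p)" "b \<otimes> g [^] (e::nat) \<otimes> inv b \<in> P"
      using p_element_conj_in[OF P sY PY g] by blast
    \<comment> \<open>On Y cocycles are homomorphisms and e is 1 mod p, so x in P has the same
      cocycle values as g; hence Y = PW.\<close>
    define x where "x = b \<otimes> g [^] e \<otimes> inv b"
    have x: "x \<in> P" "x \<in> Y" "inv x \<in> Y" using b(3) PY subgroup.m_inv_closed[OF sY] by (auto simp: x_def)
    have ge: "g [^] e \<in> Y" by (rule subgroup_nat_pow_closed[OF sY g])
    have "int p dvd \<delta> (g \<otimes> inv x)" if d: "cocycle \<theta> \<delta>" for \<delta>
    proof -
      have "[\<delta> x = int e * \<delta> g] (mod int p)" unfolding x_def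
        by (rule cong_trans[OF phom_conj[OF sY ph[OF d] b(1) ge] phom_pow[OF sY ph[OF d] g]])
      also have "[int e * \<delta> g = 1 * \<delta> g] (mod int p)"
        using b(2) by (intro cong_mult cong_refl) (metis cong_int_iff of_nat_1)
      finally have dx: "[\<delta> x = \<delta> g] (mod int p)" by simp
      have "[\<delta> (g \<otimes> inv x) = \<delta> g + - \<delta> x] (mod int p)"
        by (rule cong_trans[OF phom_mult[OF ph[OF d] g x(3)] cong_add[OF cong_refl phom_inv[OF sY ph[OF d] x(2)]]])
      then show ?thesis using dx by (simp add: cong_dvd_iff) (simp add: cong_iff_dvd_diff dvd_diff_commute)
    qed
    then have "g \<otimes> inv x \<in> W" using subgroup.m_closed[OF sY g x(3)] by (simp add: W_def)
    then show "\<exists>x\<in>P. g \<otimes>\<^bsub>G\<lparr>carrier := Y\<rparr>\<^esub> inv\<^bsub>G\<lparr>carrier := Y\<rparr>\<^esub> x \<in> W"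
      using invY[OF x(2)] by (intro bexI[OF _ x(1)]) simp
  next
    fix f x assume f: "Y.phom p P f" and x: "x \<in> P" "x \<in> W"
    have "phom p P f" using f by (simp add: Y.phom_def phom_def)
    then show "int p dvd f x" using det x by (auto simp: detects_def W_def)
  qed
  then obtain R where R: "R \<lhd> G\<lparr>carrier := Y\<rparr>" "\<not> p dvd card R"
    "\<And>g. g \<in> Y \<Longrightarrow> \<exists>x\<in>P. g \<otimes>\<^bsub>G\<lparr>carrier := Y\<rparr>\<^esub> inv\<^bsub>G\<lparr>carrier := Y\<rparr>\<^esub> x \<in> R" by auto
  have RY: "R \<subseteq> Y" using R(1) subgroup.subset[of R "G\<lparr>carrier := Y\<rparr>"] by (auto simp: normal_def)
  have sR: "subgroup R G" using R(1) incl_subgroup[OF sY] by (simp add: normal_def)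
  have Rn: "y \<otimes> a \<otimes> inv y \<in> R" if "y \<in> Y" "a \<in> R" for y a
    using R(1) that unfolding Y.normal_inv_iff by (auto simp: invY)
  have YR: "\<exists>x\<in>P. g \<otimes> inv x \<in> R" if g: "g \<in> Y" for g
  proof -
    obtain x where x: "x \<in> P" "g \<otimes> inv\<^bsub>G\<lparr>carrier := Y\<rparr>\<^esub> x \<in> R" using R(3)[OF g] by auto
    then show ?thesis using invY[OF subsetD[OF PY x(1)]] by (intro bexI[OF _ x(1)]) simp
  qed
  have pows: "y [^] i \<otimes> inv (x [^] i) \<in> R" if "y \<in> Y" "x \<in> P" "y \<otimes> inv x \<in> R" for y x and i :: nat
  proof (induction i)
    case (Suc i)
    have c: "y \<in> carrier G" "x \<in> carrier G" using that Yc PY by auto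
    have "y [^] Suc i \<otimes> inv (x [^] Suc i) = y [^] i \<otimes> (y \<otimes> inv x) \<otimes> inv (y [^] i) \<otimes> (y [^] i \<otimes> inv (x [^] i))"
    proof -
      have "x [^] Suc i = x [^] i \<otimes> x" by simp
      then show ?thesis using c by (simp add: group_word_simps)
    qed
    moreover have "y [^] i \<otimes> (y \<otimes> inv x) \<otimes> inv (y [^] i) \<in> R"
      by (rule Rn[OF subgroup_nat_pow_closed[OF sY that(1)] that(3)])
    ultimately show ?case using Suc subgroup.m_closed[OF sR] by simp
  qed (use subgroup.one_closed[OF sR] in simp)
  have Rpow: "y [^] (p ^ n) \<in> R" if y: "y \<in> Y" for y
  proof -
    obtain x where x: "x \<in> P" "y \<otimes> inv x \<in> R" using YR[OF y] by blast
    have "x [^] (p ^ n) = \<one>" using pow_card_subgroup[OF P(1) x(1)] P(2) by simp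
    then show ?thesis using pows[OF y x, of "p ^ n"] Yc[OF y] by simp
  qed
  \<comment> \<open>So far R is normal only in Y. This description is invariant under conjugation by
    all of G.\<close>
  have Rchar: "y \<in> R \<longleftrightarrow> y \<in> Y \<and> y [^] card R = \<one>" for y
  proof
    assume "y \<in> R" then show "y \<in> Y \<and> y [^] card R = \<one>" using RY pow_card_subgroup[OF sR] by blast
  next
    assume a: "y \<in> Y \<and> y [^] card R = \<one>"
    then have y: "y \<in> Y" "y \<in> carrier G" "y [^] card R = \<one>" using Yc by auto
    have "coprime (card R) (p ^ n)" using R(2) prime_p by (metis coprime_commute coprime_power_right_iff prime_imp_coprime)
    \<comment> \<open>The inverse l of \<open>p^n\<close> modulo |R| makes y a power of
      \<open>y^(p^n)\<close>, which lies in R by \<open>Rpow\<close>.\<close>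
    then obtain l where l: "[p ^ n * l = Suc 0] (mod card R)" using cong_solve_coprime_nat[of "p ^ n" "card R"] by (auto simp: coprime_commute)
    have "y [^] int (p ^ n * l) = y [^] int 1"
    proof -
      have "ord y dvd card R" using y pow_eq_id by blast
      then have "[p ^ n * l = 1] (mod ord y)" using l cong_dvd_modulus_nat by (metis One_nat_def)
      then have "int (ord y) dvd int 1 - int (p ^ n * l)" by (metis cong_iff_dvd_diff cong_int_iff cong_sym)
      then show ?thesis using int_pow_eq[OF y(2)] by blast
    qed
    then have "y = (y [^] (p ^ n)) [^] l" using y(2) by (simp only: int_pow_int nat_pow_pow) simp
    then show "y \<in> R" using subgroup_nat_pow_closed[OF sR Rpow[OF y(1)], of l] by metis
  qed
  have "R \<lhd> G"
    unfolding normal_inv_iff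
  proof (intro conjI ballI sR)
    fix g a assume g: "g \<in> carrier G" and a: "a \<in> R"
    have ac: "a \<in> Y" "a \<in> carrier G" using a RY Yc by auto
    have "(g \<otimes> a \<otimes> inv g) [^] card R = \<one>" using conj_nat_pow[OF g ac(2)] pow_card_subgroup[OF sR a] g by simp
    then show "g \<otimes> a \<otimes> inv g \<in> R" using Yn[OF g ac(1)] Rchar by blast
  qed
  moreover obtain c where c: "c \<in> carrier G" "\<And>g. g \<in> carrier G \<Longrightarrow> \<exists>i::nat. [\<theta> (g \<otimes> inv (c [^] i)) = 1] (mod int p)"
    using character_image_cyclic[OF \<theta>] by blast
  moreover have "c [^] (p - 1) \<in> Y"
    using cong_trans[OF character_pow[OF \<theta> c(1)] fermat_int[OF character_nonzero[OF \<theta> c(1)]]] c(1) by (simp add: Y_def)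
  moreover have "\<exists>i::nat. g \<otimes> inv (c [^] i) \<in> Y" if "g \<in> carrier G" for g
    using c that by (simp add: Y_def)
  ultimately show ?thesis using that[OF nY _ R(2) Rpow] by blast
qed

end

section \<open>Supersolvability\<close>

lemma (in group) cyclic_FactGroup:
  assumes N: "N \<lhd> G" and a: "a \<in> carrier G" and gen: "\<And>g. g \<in> carrier G \<Longrightarrow> \<exists>i::nat. g \<otimes> inv (a [^] i) \<in> N"
  shows "cyclic_group (G Mod N)"
proof -
  interpret N: normal N G by fact
  interpret Q: group "G Mod N" by (rule N.factorgroup_is_group)
  have Na: "N #> a \<in> carrier (G Mod N)" using a by (auto simp: carrier_FactGroup)
  have "carrier (G Mod N) \<subseteq> range (\<lambda>n::int. (N #> a) [^]\<^bsub>G Mod N\<^esub> n)"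
  proof
    fix c assume "c \<in> carrier (G Mod N)"
    then obtain g where g: "g \<in> carrier G" "c = N #> g" by (auto simp: carrier_FactGroup)
    obtain i :: nat where i: "g \<otimes> inv (a [^] i) \<in> N" using gen[OF g(1)] by blast
    have "g \<in> N #> a [^] i"
    proof -
      have "g = (g \<otimes> inv (a [^] i)) \<otimes> a [^] i" using g a by (simp add: m_assoc)
      then show ?thesis using i unfolding r_coset_def by blast
    qed
    then have "N #> a [^] i = N #> g" using repr_independence[OF _ _ N.subgroup_axioms] a by simp
    then have "c = (N #> a) [^]\<^bsub>G Mod N\<^esub> int i" using g N.FactGroup_pow[OF a, of i] by (simp add: int_pow_int)
    then show "c \<in> range (\<lambda>n::int. (N #> a) [^]\<^bsub>G Mod N\<^esub> n)" by blast
  qed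
  moreover have "range (\<lambda>n::int. (N #> a) [^]\<^bsub>G Mod N\<^esub> n) \<subseteq> carrier (G Mod N)"
    using Q.int_pow_closed[OF Na] by auto
  ultimately show ?thesis using Na Q.cyclic_group by blast
qed

section \<open>Diagonalizing the action on a normal p-subgroup\<close>

context prime_group
begin

text \<open>Multiplication by a primitive root a permutes the nonzero residues, so (a^m - 1) times
  the sum is 0.\<close>

lemma sum_powers_cong:
  "[(\<Sum>l\<in>{1..<p}. int l ^ m) = (if p - 1 dvd m then -1 else 0)] (mod int p)"
proof (cases "p - 1 dvd m")
  case True
  then obtain t where t: "m = (p - 1) * t" by auto
  have "[int l ^ m = 1] (mod int p)" if l: "l \<in> {1..<p}" for l
  proof -
    have "\<not> int p dvd int l" using l by (auto simp: int_dvd_int_iff dest: dvd_imp_le)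
    then have "[(int l ^ (p - 1)) ^ t = 1 ^ t] (mod int p)" by (intro cong_pow fermat_int)
    then show ?thesis by (simp add: t power_mult)
  qed
  then have "[(\<Sum>l\<in>{1..<p}. int l ^ m) = (\<Sum>l\<in>{1..<p}. 1)] (mod int p)" by (rule cong_sum)
  moreover have "[int (p - 1) = -1] (mod int p)" using p_pos by (simp add: cong_iff_dvd_diff of_nat_diff)
  ultimately show ?thesis using True by simp (metis cong_trans)
next
  case False
  obtain a :: int where a: "\<And>j::nat. [a ^ j = 1] (mod int p) \<Longrightarrow> p - 1 dvd j" "\<not> int p dvd a"
    using primitive_root_int by metis
  define S where "S = (\<Sum>l\<in>{1..<p}. int l ^ m)"
  define h where "h l = nat ((a * int l) mod int p)" for l :: nat
  have h: "[int (h l) = a * int l] (mod int p)" for l using p_pos by (simp add: h_def cong_def)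
  have hr: "h l \<in> {1..<p}" if l: "l \<in> {1..<p}" for l
  proof -
    have "\<not> int p dvd int l" using l by (auto simp: int_dvd_int_iff dest: dvd_imp_le)
    then have "\<not> int p dvd a * int l" using a(2) prime_int_p by (simp add: prime_dvd_mult_iff)
    then have "(a * int l) mod int p \<noteq> 0" by (simp add: dvd_eq_mod_eq_0)
    moreover have "0 \<le> (a * int l) mod int p" "(a * int l) mod int p < int p" using p_pos by auto
    ultimately show ?thesis by (auto simp: h_def)
  qed
  have "inj_on h {1..<p}"
  proof (rule inj_onI)
    fix l l' assume l: "l \<in> {1..<p}" "l' \<in> {1..<p}" "h l = h l'"
    then have "[a * int l = a * int l'] (mod int p)" using h by (metis cong_sym cong_trans)
    moreover have "coprime a (int p)" using a(2) prime_int_p by (metis coprime_commute prime_imp_coprime)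
    ultimately have "[int l = int l'] (mod int p)" by (simp add: cong_mult_lcancel)
    then show "l = l'" using l by (simp add: cong_int_iff cong_less_modulus_unique_nat)
  qed
  moreover have "h ` {1..<p} \<subseteq> {1..<p}" using hr by blast
  ultimately have bij: "bij_betw h {1..<p} {1..<p}" by (simp add: bij_betw_def endo_inj_surj)
  have "S = (\<Sum>l\<in>{1..<p}. int (h l) ^ m)"
    unfolding S_def using sum.reindex_bij_betw[OF bij, of "\<lambda>l. int l ^ m"] by simp
  also have "[\<dots> = (\<Sum>l\<in>{1..<p}. (a * int l) ^ m)] (mod int p)" by (intro cong_sum cong_pow h)
  also have "(\<Sum>l\<in>{1..<p}. (a * int l) ^ m) = a ^ m * S"
    by (simp add: S_def power_mult_distrib sum_distrib_left)
  finally have "int p dvd (a ^ m - 1) * S" by (simp add: cong_iff_dvd_diff dvd_diff_commute algebra_simps)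
  moreover have "\<not> int p dvd a ^ m - 1" using a(1)[of m] False by (auto simp: cong_iff_dvd_diff)
  ultimately have "int p dvd S" using prime_int_p by (simp add: prime_dvd_mult_iff)
  then show ?thesis using False by (simp add: S_def cong_0_iff)
qed

text \<open>With \<open>F\<^sub>j z = f (d\<^sup>j z d\<^sup>-\<^sup>j)\<close>, the combinations \<open>e\<^sub>l = (\<Sum>j<p-1. l\<^bsup>p-1-j\<^esup> F\<^sub>j)\<close> are eigenvectors of
  conjugation by \<open>d\<close> for the eigenvalues \<open>l\<close>, and they sum to \<open>-f\<close>.\<close>

lemma eigen_phom:
  assumes N: "N \<lhd> G" "card N = p ^ n" and d: "d \<in> carrier G" "d [^] (p - 1) = \<one>"
    and D: "D \<lhd> G" "D \<subseteq> N" "D \<noteq> {\<one>}"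
  obtains e z and l :: int where "phom p D e" "z \<in> D" "\<not> int p dvd e z"
    "\<And>y z. y \<in> N \<Longrightarrow> z \<in> D \<Longrightarrow> [e (y \<otimes> z \<otimes> inv y) = e z] (mod int p)"
    "\<And>z. z \<in> D \<Longrightarrow> [e (d \<otimes> z \<otimes> inv d) = l * e z] (mod int p)"
proof -
  have sN: "subgroup N G" and sD: "subgroup D G" using N(1) D(1) by (simp_all add: normal_imp_subgroup)
  have Dn: "g \<otimes> z \<otimes> inv g \<in> D" if "g \<in> carrier G" "z \<in> D" for g z using D(1) that by (auto simp: normal_inv_iff)
  have Nn: "g \<otimes> z \<otimes> inv g \<in> N" if "g \<in> carrier G" "z \<in> N" for g z using N(1) that by (auto simp: normal_inv_iff)
  have Nc: "\<And>z. z \<in> N \<Longrightarrow> z \<in> carrier G" and Dc: "\<And>z. z \<in> D \<Longrightarrow> z \<in> carrier G"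
    using subgroup.mem_carrier[OF sN] subgroup.mem_carrier[OF sD] by auto
  obtain f z0 where f: "phom p D f" "\<And>y z. y \<in> N \<Longrightarrow> z \<in> D \<Longrightarrow> [f (y \<otimes> z \<otimes> inv y) = f z] (mod int p)"
    and z0: "z0 \<in> D" "\<not> int p dvd f z0"
    using p_group_invariant_phom[OF sN N(2) sD D(2,3)] Dn Nc by blast
  define F where "F j z = f (d [^] j \<otimes> z \<otimes> inv (d [^] j))" for j :: nat and z
  have Fph: "[F j (y \<otimes> z) = F j y + F j z] (mod int p)" if "y \<in> D" "z \<in> D" for j y z
  proof -
    have "d [^] j \<otimes> (y \<otimes> z) \<otimes> inv (d [^] j) = (d [^] j \<otimes> y \<otimes> inv (d [^] j)) \<otimes> (d [^] j \<otimes> z \<otimes> inv (d [^] j))"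
      using that Dc d by (simp add: group_word_simps)
    then show ?thesis unfolding F_def using phom_mult[OF f(1) Dn Dn] that d by simp
  qed
  have FN: "[F j (y \<otimes> z \<otimes> inv y) = F j z] (mod int p)" if "y \<in> N" "z \<in> D" for j y z
  proof -
    have "d [^] j \<otimes> (y \<otimes> z \<otimes> inv y) \<otimes> inv (d [^] j)
      = (d [^] j \<otimes> y \<otimes> inv (d [^] j)) \<otimes> (d [^] j \<otimes> z \<otimes> inv (d [^] j)) \<otimes> inv (d [^] j \<otimes> y \<otimes> inv (d [^] j))"
      using that Dc Nc d by (simp add: group_word_simps)
    then show ?thesis unfolding F_def using f(2)[OF Nn Dn] that d by simp
  qed
  have Fd: "F j (d \<otimes> z \<otimes> inv d) = F (Suc j) z" if "z \<in> D" for j z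
    unfolding F_def using that Dc d by (simp add: group_word_simps)
  have Fp: "F (p - 1) z = F 0 z" if "z \<in> D" for z
    unfolding F_def using that Dc d by simp
  \<comment> \<open>The exponent p - 1 - j represents -j, since l^(p-1) is 1 mod p.\<close>
  define e where "e l z = (\<Sum>j<p-1. l ^ (p - 1 - j) * F j z)" for l :: int and z
  have ep: "phom p D (e l)" for l
    unfolding phom_def
  proof (intro ballI)
    fix y z assume yz: "y \<in> D" "z \<in> D"
    have "[e l (y \<otimes> z) = (\<Sum>j<p-1. l ^ (p - 1 - j) * (F j y + F j z))] (mod int p)"
      unfolding e_def by (intro cong_sum cong_mult cong_refl Fph yz)
    then show "[e l (y \<otimes> z) = e l y + e l z] (mod int p)"
      by (simp add: e_def distrib_left sum.distrib)
  qed
  have eN: "[e l (y \<otimes> z \<otimes> inv y) = e l z] (mod int p)" if "y \<in> N" "z \<in> D" for l y z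
    unfolding e_def by (intro cong_sum cong_mult cong_refl FN that)
  have ed: "[e l (d \<otimes> z \<otimes> inv d) = l * e l z] (mod int p)" if z: "z \<in> D" and l: "\<not> int p dvd l" for l z
  proof -
    define g where "g j = l ^ (p - j) * F j z" for j
    have le: "l * e l z = (\<Sum>j<p-1. g j)"
      unfolding e_def g_def sum_distrib_left
    proof (rule sum.cong[OF refl])
      fix j assume "j \<in> {..<p - 1}"
      then have "p - j = Suc (p - 1 - j)" by auto
      then show "l * (l ^ (p - 1 - j) * F j z) = l ^ (p - j) * F j z" by simp
    qed
    have "e l (d \<otimes> z \<otimes> inv d) = (\<Sum>j<p-1. g (Suc j))"
      unfolding e_def g_def
    proof (rule sum.cong[OF refl])
      fix j assume "j \<in> {..<p - 1}"
      show "l ^ (p - 1 - j) * F j (d \<otimes> z \<otimes> inv d) = l ^ (p - Suc j) * F (Suc j) z"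
        using Fd[OF z, of j] by simp
    qed
    also have "\<dots> = (\<Sum>j<p-1. g j) + (g (p - 1) - g 0)"
      using sum_lessThan_telescope[of g "p - 1"] by (simp add: sum_subtractf)
    finally have "e l (d \<otimes> z \<otimes> inv d) = l * e l z + (g (p - 1) - g 0)" using le by simp
    \<comment> \<open>The shift closes up: d^(p-1) = 1 identifies \<open>F (p - 1)\<close> with
      \<open>F 0\<close>, and Fermat removes l^(p-1).\<close>
    moreover have "[g (p - 1) - g 0 = 0] (mod int p)"
    proof -
      have "g (p - 1) = l * F 0 z" unfolding g_def using Fp[OF z] p_pos by simp
      moreover have "g 0 = l ^ (p - 1) * l * F 0 z"
        unfolding g_def using p_pos by (simp flip: power_Suc2)
      moreover have "[l ^ (p - 1) * l * F 0 z = 1 * l * F 0 z] (mod int p)"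
        by (intro cong_mult cong_refl fermat_int l)
      ultimately show ?thesis by (simp add: cong_iff_dvd_diff dvd_diff_commute)
    qed
    ultimately show ?thesis by (simp add: cong_iff_dvd_diff)
  qed
  \<comment> \<open>In the range of j, p - 1 divides p - 1 - j only for j = 0, so the other power
    sums vanish.\<close>
  have "[(\<Sum>l\<in>{1..<p}. e (int l) z) = - f z] (mod int p)" if z: "z \<in> D" for z
  proof -
    have "(\<Sum>l\<in>{1..<p}. e (int l) z) = (\<Sum>j<p-1. (\<Sum>l\<in>{1..<p}. int l ^ (p - 1 - j)) * F j z)"
      unfolding e_def sum_distrib_right by (rule sum.swap)
    also have "[\<dots> = (\<Sum>j<p-1. (if p - 1 dvd p - 1 - j then -1 else 0) * F j z)] (mod int p)"
      by (intro cong_sum cong_mult cong_refl sum_powers_cong)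
    also have "(\<Sum>j<p-1. (if p - 1 dvd p - 1 - j then -1 else 0) * F j z) = (\<Sum>j<p-1. if j = 0 then - F 0 z else 0)"
    proof (rule sum.cong[OF refl])
      fix j assume j: "j \<in> {..<p - 1}"
      have "p - 1 dvd p - 1 - j \<longleftrightarrow> j = 0"
      proof
        assume a: "p - 1 dvd p - 1 - j"
        show "j = 0"
        proof (rule ccontr)
          assume "j \<noteq> 0"
          then have "0 < p - 1 - j" "p - 1 - j < p - 1" using j by auto
          then show False using a by (meson dvd_imp_le leD)
        qed
      qed simp
      then show "(if p - 1 dvd p - 1 - j then -1 else 0) * F j z = (if j = 0 then - F 0 z else 0)" by simp
    qed
    also have "\<dots> = - F 0 z" using p_pos by (simp add: sum.delta)
    also have "F 0 z = f z" using z Dc by (simp add: F_def)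
    finally show ?thesis .
  qed
  from this[OF z0(1)] have "\<not> int p dvd (\<Sum>l\<in>{1..<p}. e (int l) z0)"
    using z0(2) by (simp add: cong_dvd_iff)
  then obtain l where l: "l \<in> {1..<p}" "\<not> int p dvd e (int l) z0" by (meson dvd_sum)
  have "\<not> int p dvd int l" using l(1) by (auto simp: int_dvd_int_iff dest: dvd_imp_le)
  then show ?thesis using that[OF ep z0(1) l(2) eN ed] by blast
qed

text \<open>The kernel of an eigenvector is normal in G: N fixes the eigenvector, d scales it, and N
  and d generate G. The quotient of D by it embeds in Z/p, which adds one cyclic factor.\<close>

lemma supersolvable_seq_p_subgroup:
  assumes N: "N \<lhd> G" "card N = p ^ n" and d: "d \<in> carrier G" "d [^] (p - 1) = \<one>"
    and gen: "\<And>g. g \<in> carrier G \<Longrightarrow> \<exists>i::nat. g \<otimes> inv (d [^] i) \<in> N"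
    and D: "D \<lhd> G" "D \<subseteq> N"
  shows "supersolvable_seq G D"
  using D
proof (induction "card D" arbitrary: D rule: less_induct)
  case less
  note D = less.prems
  show ?case
  proof (cases "D = {\<one>}")
    case True
    then show ?thesis using supersolvable_seq.unity by simp
  next
    case False
    obtain e z and l :: int where e: "phom p D e" and z: "z \<in> D" "\<not> int p dvd e z"
      and eN: "\<And>y z. y \<in> N \<Longrightarrow> z \<in> D \<Longrightarrow> [e (y \<otimes> z \<otimes> inv y) = e z] (mod int p)"
      and ed: "\<And>z. z \<in> D \<Longrightarrow> [e (d \<otimes> z \<otimes> inv d) = l * e z] (mod int p)"
      using eigen_phom[OF N d D False] by metis
    have sN: "subgroup N G" and sD: "subgroup D G" using N(1) D(1) by (simp_all add: normal_imp_subgroup)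
    have Dn: "g \<otimes> z \<otimes> inv g \<in> D" if "g \<in> carrier G" "z \<in> D" for g z using D(1) that by (auto simp: normal_inv_iff)
    have Nc: "\<And>z. z \<in> N \<Longrightarrow> z \<in> carrier G" and Dc: "\<And>z. z \<in> D \<Longrightarrow> z \<in> carrier G"
      using subgroup.mem_carrier[OF sN] subgroup.mem_carrier[OF sD] by auto
    define E where "E = {z \<in> D. int p dvd e z}"
    have sE: "subgroup E G" unfolding E_def by (rule phom_kernel_subgroup[OF fin sD e])
    have Ed: "d [^] i \<otimes> z \<otimes> inv (d [^] i) \<in> E" if "z \<in> E" for z and i :: nat
      using that
    proof (induction i arbitrary: z)
      case 0
      then show ?case using Dc by (auto simp: E_def)
    next
      case (Suc i)
      have zz: "z \<in> D" "z \<in> carrier G" "int p dvd e z" using Suc.prems Dc by (auto simp: E_def)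
      have "d \<otimes> z \<otimes> inv d \<in> E" using Dn[OF d(1) zz(1)] cong_dvd_iff[OF ed[OF zz(1)]] zz(3) by (simp add: E_def)
      then have "d [^] i \<otimes> (d \<otimes> z \<otimes> inv d) \<otimes> inv (d [^] i) \<in> E" by (rule Suc.IH)
      then show ?case using zz d by (simp add: group_word_simps)
    qed
    have nE: "E \<lhd> G"
      unfolding normal_inv_iff
    proof (intro conjI ballI sE)
      fix g a assume g: "g \<in> carrier G" and a: "a \<in> E"
      obtain i :: nat where i: "g \<otimes> inv (d [^] i) \<in> N" using gen[OF g] by blast
      define y where "y = g \<otimes> inv (d [^] i)"
      have y: "y \<in> N" "y \<in> carrier G" "g = y \<otimes> d [^] i" using i g d Nc by (auto simp: y_def m_assoc)
      define w where "w = d [^] i \<otimes> a \<otimes> inv (d [^] i)"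
      have w: "w \<in> E" "w \<in> D" using Ed[OF a, of i] by (auto simp: w_def E_def)
      have "g \<otimes> a \<otimes> inv g = y \<otimes> w \<otimes> inv y"
        using y d a Dc by (simp add: w_def E_def group_word_simps)
      moreover have "y \<otimes> w \<otimes> inv y \<in> E"
        using Dn[OF y(2) w(2)] cong_dvd_iff[OF eN[OF y(1) w(2)]] w(1) by (simp add: E_def)
      ultimately show "g \<otimes> a \<otimes> inv g \<in> E" by simp
    qed
    have ED: "E \<subset> D" using z by (auto simp: E_def)
    have "card E < card D"
      using ED finite_subset[OF subgroup.subset[OF sD] fin] by (rule psubset_card_mono[rotated])
    then have "supersolvable_seq G E" using less.hyps[OF _ nE] ED D(2) by blast
    moreover have "cyclic_group ((G\<lparr>carrier := D\<rparr>) Mod E)"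
    proof -
      interpret DD: group "G\<lparr>carrier := D\<rparr>" by (rule subgroup_imp_group[OF sD])
      have invD: "inv\<^bsub>G\<lparr>carrier := D\<rparr>\<^esub> x = inv x" if "x \<in> D" for x using m_inv_consistent[OF sD that] .
      have nED: "E \<lhd> G\<lparr>carrier := D\<rparr>"
        unfolding DD.normal_inv_iff
      proof (intro conjI ballI)
        show "subgroup E (G\<lparr>carrier := D\<rparr>)" by (rule subgroup_incl[OF sE sD]) (use ED in auto)
        fix x h assume "x \<in> carrier (G\<lparr>carrier := D\<rparr>)" "h \<in> E"
        then show "x \<otimes>\<^bsub>G\<lparr>carrier := D\<rparr>\<^esub> h \<otimes>\<^bsub>G\<lparr>carrier := D\<rparr>\<^esub> inv\<^bsub>G\<lparr>carrier := D\<rparr>\<^esub> x \<in> E"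
          using nE Dc by (auto simp: normal_inv_iff invD)
      qed
      show ?thesis
      proof (rule DD.cyclic_FactGroup[OF nED])
        show "z \<in> carrier (G\<lparr>carrier := D\<rparr>)" using z by simp
        fix g assume "g \<in> carrier (G\<lparr>carrier := D\<rparr>)"
        then have g: "g \<in> D" by simp
        obtain i :: nat where i: "[int i * e z = e g] (mod int p)" using cong_solve_mod_p[OF z(2)] by blast
        have zi: "z [^] i \<in> D" "inv (z [^] i) \<in> D"
          using subgroup_nat_pow_closed[OF sD z(1)] subgroup.m_inv_closed[OF sD] by auto
        have "[e (g \<otimes> inv (z [^] i)) = e g + - e (z [^] i)] (mod int p)"
          by (rule cong_trans[OF phom_mult[OF e g zi(2)] cong_add[OF cong_refl phom_inv[OF sD e zi(1)]]])
        moreover have "[e (z [^] i) = e g] (mod int p)" by (rule cong_trans[OF phom_pow[OF sD e z(1)] i])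
        ultimately have "int p dvd e (g \<otimes> inv (z [^] i))"
          by (simp add: cong_dvd_iff) (simp add: cong_iff_dvd_diff dvd_diff_commute)
        then have "g \<otimes> inv (z [^] i) \<in> E" using subgroup.m_closed[OF sD g zi(2)] by (simp add: E_def)
        then show "\<exists>i::nat. g \<otimes>\<^bsub>G\<lparr>carrier := D\<rparr>\<^esub> inv\<^bsub>G\<lparr>carrier := D\<rparr>\<^esub> (z [^]\<^bsub>G\<lparr>carrier := D\<rparr>\<^esub> i) \<in> E"
          using invD[OF zi(1)] by (intro exI[of _ i]) (simp flip: nat_pow_consistent)
      qed
    qed
    ultimately show ?thesis using supersolvable_seq.extension[of G E D] ED D(1) by blast
  qed
qed

theorem cyclic_over_normal_p_subgroup:
  assumes N: "N \<lhd> G" "card N = p ^ n" and c: "c \<in> carrier G" "c [^] (p - 1) \<in> N"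
    and gen: "\<And>g. g \<in> carrier G \<Longrightarrow> \<exists>i::nat. g \<otimes> inv (c [^] i) \<in> N"
  shows "supersolvable G" and "sylow_subgroup p N G"
    and "\<exists>C. p_complement p C G \<and> cyclic_group (G\<lparr>carrier := C\<rparr>)"
proof -
  have sN: "subgroup N G" using N(1) by (simp add: normal_imp_subgroup)
  have Nc: "\<And>z. z \<in> N \<Longrightarrow> z \<in> carrier G" using subgroup.mem_carrier[OF sN] by auto
  have Nn: "g \<otimes> z \<otimes> inv g \<in> N" if "g \<in> carrier G" "z \<in> N" for g z using N(1) that by (auto simp: normal_inv_iff)
  \<comment> \<open>c^(p-1) lies in N, which has exponent dividing \<open>p^n\<close>; so the order
    of d divides p - 1 and \<open><d>\<close> can serve as the p-complement.\<close>
  define d where "d = c [^] (p ^ n)"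
  have d: "d \<in> carrier G" using c by (simp add: d_def)
  have "d [^] (p - 1) = (c [^] (p - 1)) [^] (p ^ n)" using c by (simp add: d_def nat_pow_pow mult.commute)
  then have d1: "d [^] (p - 1) = \<one>" using pow_card_subgroup[OF sN c(2)] N(2) by simp
  \<comment> \<open>As p is 1 modulo p - 1, d differs from c by a power of c^(p-1), an element of N;
    nothing is lost modulo N.\<close>
  have "[p ^ n = 1 ^ n] (mod p - 1)"
  proof (rule cong_pow)
    show "[p = 1] (mod p - 1)" using p_pos by (metis cong_add_lcancel_0_nat cong_def le_add_diff_inverse2 less_imp_le_nat mod_add_self1)
  qed
  then obtain t where t: "p ^ n = (p - 1) * t + 1"
    using p_pos by (metis cong_le_nat mult.commute one_le_power power_one less_imp_le_nat)
  have dc: "d \<otimes> inv c \<in> N"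
  proof -
    have "d = (c [^] (p - 1)) [^] t \<otimes> c" unfolding d_def t using c by (simp add: nat_pow_pow flip: nat_pow_mult)
    then have "d \<otimes> inv c = (c [^] (p - 1)) [^] t" using c by (simp add: m_assoc)
    then show ?thesis using subgroup_nat_pow_closed[OF sN c(2)] by simp
  qed
  have cd: "c [^] i \<otimes> inv (d [^] i) \<in> N" for i :: nat
  proof (induction i)
    case (Suc i)
    have "c [^] Suc i \<otimes> inv (d [^] Suc i)
      = (c [^] i \<otimes> inv (d \<otimes> inv c) \<otimes> inv (c [^] i)) \<otimes> (c [^] i \<otimes> inv (d [^] i))"
    proof -
      have "d [^] Suc i = d [^] i \<otimes> d" by simp
      then show ?thesis using c(1) d by (simp add: group_word_simps)
    qed
    moreover have "c [^] i \<otimes> inv (d \<otimes> inv c) \<otimes> inv (c [^] i) \<in> N"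
      by (rule Nn) (use c(1) subgroup.m_inv_closed[OF sN dc] in auto)
    ultimately show ?case using Suc subgroup.m_closed[OF sN] by simp
  qed (use subgroup.one_closed[OF sN] in simp)
  have gend: "\<exists>i::nat. g \<otimes> inv (d [^] i) \<in> N" if g: "g \<in> carrier G" for g
  proof -
    obtain i :: nat where i: "g \<otimes> inv (c [^] i) \<in> N" using gen[OF g] by blast
    have "g \<otimes> inv (d [^] i) = (g \<otimes> inv (c [^] i)) \<otimes> (c [^] i \<otimes> inv (d [^] i))"
      using g c(1) d by (simp add: group_word_simps)
    then show ?thesis using subgroup.m_closed[OF sN i cd[of i]] by metis
  qed
  have "supersolvable_seq G N" by (rule supersolvable_seq_p_subgroup[OF N d d1 gend N(1)]) auto
  moreover have "carrier G \<lhd> G" by (rule normal_self)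
  moreover have "cyclic_group ((G\<lparr>carrier := carrier G\<rparr>) Mod N)"
    using cyclic_FactGroup[OF N(1) d gend] by simp
  ultimately have "supersolvable_seq G (carrier G)"
    using supersolvable_seq.extension[of G N "carrier G"] subgroup.subset[OF sN] by blast
  then show "supersolvable G" by (simp add: supersolvable_def)
  let ?C = "generate G {d}"
  have C: "?C = {d [^] (i::nat) | i. True}" using generate_pow_on_finite_carrier[OF fin d] by auto
  have sC: "subgroup ?C G" using generate_is_subgroup[of "{d}"] d by simp
  have cC: "card ?C = ord d" using generate_pow_card[OF d] by simp
  have "ord d dvd p - 1" using d1 pow_eq_id[OF d] by simp
  have cop: "coprime (card ?C) p"
  proof -
    have "\<not> p dvd card ?C"
    proof
      assume "p dvd card ?C"
      then have "p dvd p - 1" using cC \<open>ord d dvd p - 1\<close> dvd_trans by metis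
      then show False using p_pos by (auto dest: dvd_imp_le)
    qed
    then show ?thesis using prime_p by (metis coprime_commute prime_imp_coprime)
  qed
  have CN: "x = \<one>" if "x \<in> ?C" "x \<in> N" for x
  proof -
    have xc: "x \<in> carrier G" using that Nc by auto
    have "ord x dvd card ?C" using pow_card_subgroup[OF sC that(1)] pow_eq_id[OF xc] by blast
    moreover have "ord x dvd p ^ n" using pow_card_subgroup[OF sN that(2)] N(2) pow_eq_id[OF xc] by metis
    moreover have "coprime (card ?C) (p ^ n)" using cop by simp
    ultimately have "ord x = 1" by (metis coprime_common_divisor_nat)
    then show ?thesis using ord_eq_1[OF xc] by simp
  qed
  have Cc: "\<And>x. x \<in> ?C \<Longrightarrow> x \<in> carrier G" using subgroup.mem_carrier[OF sC] .
  have "(\<lambda>x. x <# N) ` carrier G = (\<lambda>x. x <# N) ` ?C"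
  proof
    show "(\<lambda>x. x <# N) ` carrier G \<subseteq> (\<lambda>x. x <# N) ` ?C"
    proof
      fix a assume "a \<in> (\<lambda>x. x <# N) ` carrier G"
      then obtain g where g: "g \<in> carrier G" "a = g <# N" by auto
      obtain i :: nat where i: "g \<otimes> inv (d [^] i) \<in> N" using gend[OF g(1)] by blast
      have "inv (d [^] i) \<otimes> (g \<otimes> inv (d [^] i)) \<otimes> inv (inv (d [^] i)) \<in> N" by (rule Nn[OF _ i]) (use d in simp)
      then have "inv (d [^] i) \<otimes> g \<in> N" using d g by (simp add: group_word_simps)
      then have "(d [^] i) <# N = g <# N" using l_coset_eq_iff[OF sN, of "d [^] i" g] d g by simp
      then show "a \<in> (\<lambda>x. x <# N) ` ?C" using g C by blast
    qed
  qed (use Cc in auto)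
  moreover have "inj_on (\<lambda>x. x <# N) ?C"
  proof (rule inj_onI)
    fix x y assume xy: "x \<in> ?C" "y \<in> ?C" "x <# N = y <# N"
    then have "inv x \<otimes> y \<in> N" using l_coset_eq_iff[OF sN Cc Cc] by blast
    moreover have "inv x \<otimes> y \<in> ?C" using xy subgroup.m_closed[OF sC] subgroup.m_inv_closed[OF sC] by blast
    ultimately have "inv x \<otimes> y = \<one>" using CN by blast
    then show "x = y" using xy Cc by (metis inv_solve_left r_one one_closed)
  qed
  ultimately have ord: "order G = card ?C * p ^ n"
    using card_l_cosets[OF fin sN subgroup_self subgroup.subset[OF sN]] N(2) by (simp add: order_def card_image)
  have "card ?C > 0" using finite_subset[OF subgroup.subset[OF sC] fin] subgroup.one_closed[OF sC] by (auto simp: card_gt_0_iff)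
  have "multiplicity p (order G) = n"
  proof (rule multiplicity_eqI)
    show "p ^ n dvd order G" using ord by simp
    show "\<not> p ^ Suc n dvd order G"
    proof
      assume "p ^ Suc n dvd order G"
      then have "p dvd card ?C" using ord p_pos by (simp add: mult.commute)
      then show False using cop p_pos by (metis coprime_absorb_left coprime_commute less_irrefl nat_dvd_1_iff_1)
    qed
  qed
  then show "sylow_subgroup p N G" using sN N(2) by (simp add: sylow_subgroup_def)
  have "card (rcosets ?C) * card ?C = order G" by (rule lagrange[OF sC])
  then have "card (rcosets ?C) = p ^ n" using ord \<open>card ?C > 0\<close> by (simp add: mult.commute)
  then have "p_complement p ?C G" using sC cop by (auto simp: p_complement_def)
  moreover have "cyclic_group (G\<lparr>carrier := ?C\<rparr>)"
  proof -
    interpret C: group "G\<lparr>carrier := ?C\<rparr>" by (rule subgroup_imp_group[OF sC])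
    have dC: "d \<in> ?C" by (simp add: generate.incl)
    have "carrier (G\<lparr>carrier := ?C\<rparr>) = range (\<lambda>n::int. d [^]\<^bsub>G\<lparr>carrier := ?C\<rparr>\<^esub> n)"
      unfolding int_pow_consistent[OF sC dC, symmetric] using generate_pow[OF d] by auto
    then show ?thesis using C.cyclic_group dC by auto
  qed
  ultimately show "\<exists>C. p_complement p C G \<and> cyclic_group (G\<lparr>carrier := C\<rparr>)" by blast
qed

text \<open>R is a normal p'-subgroup, hence contained in the core K. Modulo K the elements of Y
  thus have p-power order, so Y becomes a normal p-subgroup with cyclic quotient, and
  \<open>cyclic_over_normal_p_subgroup\<close> applies.\<close>

theorem M_class_quotient_structure:
  assumes "2 \<le> k" and "p ^ k dvd Coset.order G" and "M_class (p ^ k) G"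
  shows "supersolvable (G Mod p_prime_core p G) \<and>
    (\<exists>P. sylow_subgroup p P (G Mod p_prime_core p G) \<and> P \<lhd> (G Mod p_prime_core p G)) \<and>
    (\<exists>C. p_complement p C (G Mod p_prime_core p G) \<and>
       cyclic_group ((G Mod p_prime_core p G)\<lparr>carrier := C\<rparr>))"
proof -
  define n where "n = multiplicity p (Coset.order G)"
  have og: "Coset.order G > 0" using order_gt_0_iff_finite fin by blast
  have "k \<le> n" unfolding n_def using assms(2) og p_pos by (intro multiplicity_geI) auto
  obtain m where m: "Coset.order G = p ^ n * m" "\<not> p dvd m"
    using multiplicity_decompose'[of "Coset.order G" p] og p_pos unfolding n_def by (auto simp: mult.commute)
  obtain P where P: "subgroup P G" "card P = p ^ n"
    using sylow_thm[OF prime_p is_group m(1) fin] by blast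
  have Pi: "\<not> p dvd Coset.order G div card P" using m P(2) p_pos by simp
  obtain \<theta> where \<theta>: "character \<theta>" "detects \<theta> P"
    using M_class_detects_sylow[OF P Pi assms(1) \<open>k \<le> n\<close> assms(3)] by blast
  obtain Y R c where Y: "Y \<lhd> G" "R \<lhd> G" "\<not> p dvd card R" "\<And>y. y \<in> Y \<Longrightarrow> y [^] (p ^ n) \<in> R"
    and c: "c \<in> carrier G" "c [^] (p - 1) \<in> Y" "\<And>g. g \<in> carrier G \<Longrightarrow> \<exists>i::nat. g \<otimes> inv (c [^] i) \<in> Y"
    using detects_normal_series[OF P Pi \<theta>] by blast
  define K where "K = p_prime_core p G"
  have nK: "K \<lhd> G" unfolding K_def by (rule p_prime_core_greatest(1)[OF fin])
  have "coprime (card R) p" using Y(3) prime_p by (metis coprime_commute prime_imp_coprime)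
  then have RK: "R \<subseteq> K" unfolding K_def using p_prime_core_greatest(3)[OF fin Y(2)] by blast
  interpret K: normal K G by (rule nK)
  let ?Q = "G Mod K"
  interpret Q: group ?Q by (rule K.factorgroup_is_group)
  interpret Q: prime_group ?Q p
    using fin prime_p by unfold_locales (simp_all add: carrier_FactGroup)
  have hom: "(\<lambda>g. K #> g) \<in> hom G ?Q" by (rule K.r_coset_hom_Mod)
  interpret h: group_hom G ?Q "\<lambda>g. K #> g" using hom by unfold_locales
  have Yc: "\<And>y. y \<in> Y \<Longrightarrow> y \<in> carrier G" and sY: "subgroup Y G"
    using normal_imp_subgroup[OF Y(1)] subgroup.mem_carrier[OF normal_imp_subgroup[OF Y(1)]] by auto
  define N where "N = (\<lambda>g. K #> g) ` Y"
  have sN: "subgroup N ?Q" unfolding N_def by (rule h.subgroup_img_is_subgroup[OF sY])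
  have nN: "N \<lhd> ?Q"
    unfolding Q.normal_inv_iff
  proof (intro conjI ballI sN)
    fix x a assume "x \<in> carrier ?Q" "a \<in> N"
    then obtain g y where gy: "g \<in> carrier G" "x = K #> g" "y \<in> Y" "a = K #> y"
      by (auto simp: carrier_FactGroup N_def)
    have "x \<otimes>\<^bsub>?Q\<^esub> a \<otimes>\<^bsub>?Q\<^esub> inv\<^bsub>?Q\<^esub> x = K #> (g \<otimes> y \<otimes> inv g)"
      using gy Yc by simp
    moreover have "g \<otimes> y \<otimes> inv g \<in> Y" using Y(1) gy by (auto simp: normal_inv_iff)
    ultimately show "x \<otimes>\<^bsub>?Q\<^esub> a \<otimes>\<^bsub>?Q\<^esub> inv\<^bsub>?Q\<^esub> x \<in> N" unfolding N_def by blast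
  qed
  have Npow: "x [^]\<^bsub>?Q\<^esub> (p ^ n) = \<one>\<^bsub>?Q\<^esub>" if xN: "x \<in> N" for x
  proof -
    obtain y where y: "y \<in> Y" "x = K #> y" using xN by (auto simp: N_def)
    have "x [^]\<^bsub>?Q\<^esub> (p ^ n) = K #> (y [^] (p ^ n))" using y Yc K.FactGroup_pow by simp
    also have "\<dots> = K" using Y(4)[OF y(1)] RK coset_join2[OF _ K.subgroup_axioms] Yc[OF y(1)] by auto
    finally show ?thesis by simp
  qed
  \<comment> \<open>By Cauchy's theorem a prime divisor of \<open>card N\<close> is the order of an
    element of N, and these orders divide \<open>p^n\<close>.\<close>
  have "\<exists>i. card N = p ^ i"
  proof -
    have "q = p" if q: "Factorial_Ring.prime q" "q dvd card N" for q
    proof -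
      interpret Qq: prime_group ?Q q using Q.fin q(1) by unfold_locales
      obtain r where r: "r \<in> N" "r \<noteq> \<one>\<^bsub>?Q\<^esub>" "r [^]\<^bsub>?Q\<^esub> q = \<one>\<^bsub>?Q\<^esub>"
        using Qq.order_p_element[OF sN q(2)] by blast
      have rc: "r \<in> carrier ?Q" using r(1) subgroup.mem_carrier[OF sN] by blast
      have "Q.ord r dvd q" "Q.ord r dvd p ^ n" using r(3) Npow[OF r(1)] Q.pow_eq_id[OF rc] by auto
      moreover have "Q.ord r \<noteq> 1" using r(2) Q.ord_eq_1[OF rc] by simp
      ultimately have "q dvd p ^ n" using q(1) by (metis prime_nat_iff)
      then have "q dvd p" using q(1) prime_dvd_power by blast
      then show "q = p" using q(1) prime_p primes_dvd_imp_eq by blast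
    qed
    moreover have "card N \<noteq> 0"
      using finite_subset[OF subgroup.subset[OF sN] Q.fin] subgroup.one_closed[OF sN] by auto
    moreover obtain a l where al: "card N = p ^ a * l" "\<not> p dvd l"
      using multiplicity_decompose'[of "card N" p] calculation(2) p_pos by (metis mult.commute nat_dvd_1_iff_1 less_irrefl)
    ultimately have "l = 1" using prime_factor_nat[of l] by (metis dvd_mult dvd_refl)
    then show ?thesis using al(1) by auto
  qed
  then obtain i where i: "card N = p ^ i" by blast
  have cQ: "K #> c \<in> carrier ?Q" "(K #> c) [^]\<^bsub>?Q\<^esub> (p - 1) \<in> N"
    using c(1,2) K.FactGroup_pow by (auto simp: carrier_FactGroup N_def)
  have gQ: "\<exists>i::nat. x \<otimes>\<^bsub>?Q\<^esub> inv\<^bsub>?Q\<^esub> ((K #> c) [^]\<^bsub>?Q\<^esub> i) \<in> N" if "x \<in> carrier ?Q" for x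
  proof -
    obtain g where g: "g \<in> carrier G" "x = K #> g" using \<open>x \<in> carrier ?Q\<close> by (auto simp: carrier_FactGroup)
    obtain j :: nat where j: "g \<otimes> inv (c [^] j) \<in> Y" using c(3)[OF g(1)] by blast
    have "x \<otimes>\<^bsub>?Q\<^esub> inv\<^bsub>?Q\<^esub> ((K #> c) [^]\<^bsub>?Q\<^esub> j) = K #> (g \<otimes> inv (c [^] j))"
      using g c(1) K.FactGroup_pow by simp
    then show ?thesis using j unfolding N_def by (metis image_eqI)
  qed
  show ?thesis
    using Q.cyclic_over_normal_p_subgroup[OF nN i cQ gQ] nN unfolding K_def by blast
qed

end

theorem corollaryB:
  fixes G :: "('a, 'b) monoid_scheme" and p k :: nat
  assumes "group G" and "finite (carrier G)"
    and "Factorial_Ring.prime p" and "2 \<le> k" and "p ^ k dvd Coset.order G"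
    and "M_class (p ^ k) G"
  shows "supersolvable (G Mod p_prime_core p G) \<and>
    (\<exists>P. sylow_subgroup p P (G Mod p_prime_core p G) \<and> P \<lhd> (G Mod p_prime_core p G)) \<and>
    (\<exists>C. p_complement p C (G Mod p_prime_core p G) \<and>
       cyclic_group ((G Mod p_prime_core p G)\<lparr>carrier := C\<rparr>))"
proof -
  interpret G: group G by fact
  interpret prime_group G p using assms(2,3) by unfold_locales
  show ?thesis using M_class_quotient_structure[OF assms(4-6)] .
qed

end
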